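(* Let $\mathcal C$ be a strict pivotal fusion category over $\Bbbk$, let $z$ be a natural endomorphism of the identity functor of $Z(\mathcal C)$, and let $k,r,m$ be non-negative integers with $l:=k+r+1\le m$. If $m$ and $l$ are relatively prime, then $\mathrm{FS}^{(m,k,r)}_{V,z}$ is natural in $V$. In particular, $\nu^{\mathbf X}_{m,l}(V)$ is additive in $V$ (for simple $\mathbf X\in Z(\mathcal C)$). In addition, if $\mathcal C$ is spherical, then $\mathrm{FS}^{(m,k,r)}_{V,z}=\mathrm{FS}^{(m,l)}_{V,z}$ for all $V\in\mathcal C$.
   Context: $\Bbbk$ is an algebraically closed field of characteristic zero. A pivotal category is a left rigid monoidal category (left duals $V^\vee$ with $\mathrm{ev}:V^\vee\otimes V\to I$, $\mathrm{db}:I\to V\otimes V^\vee$) with an isomorphism of monoidal functors $j:\mathrm{Id}\to(-)^{\vee\vee}$; it is strict if the associativity isomorphisms, $j$, and the canonical isomorphisms $(V\otimes W)^\vee\to W^\vee\otimes V^\vee$ are identities. Then put $\overline{\mathrm{ev}}_V=\mathrm{ev}_{V^\vee}:V\otimes V^\vee\to I$, $\overline{\mathrm{db}}_V=\mathrm{db}_{V^\vee}:I\to V^\vee\otimes V$. For $f:V\to V$, $\mathrm{ptr}^r(f)=\overline{\mathrm{ev}}(f\otimes V^\vee)\mathrm{db}$, $\mathrm{ptr}^\ell(f)=\mathrm{ev}(V^\vee\otimes f)\overline{\mathrm{db}}$; spherical means these always agree. A fusion category over $\Bbbk$ is a semisimple left rigid $\Bbbk$-linear monoidal category with finite-dimensional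 morphism spaces, simple unit and finitely many simple objects up to isomorphism. $V^0=I$, $V^m=V\otimes V^{m-1}$ for $m>0$, $V^m=(V^\vee)^{-m}$ for $m<0$. The center $\mathcal D=Z(\mathcal C)$ has objects $\mathbf X=(X,\sigma_X)$ with natural isomorphisms $\sigma_X(V):X\otimes V\to V\otimes X$, $\sigma_X(I)=\mathrm{id}$, $\sigma_X(V\otimes W)=(V\otimes\sigma_X(W))(\sigma_X(V)\otimes W)$; it is a pivotal fusion category, braided by $c_{\mathbf X,\mathbf Y}=\sigma_X(Y)$, with pivotal structure inherited from $\mathcal C$ and associated twist $\theta=u^{-1}j$, $u_{\mathbf X}=(\mathrm{ev}\otimes\mathbf X^{\vee\vee})(\mathbf X^\vee\otimes c^{-1}_{\mathbf X,\mathbf X^{\vee\vee}})(\mathrm{db}_{\mathbf X^\vee}\otimes\mathbf X)$. For $f\in\mathcal C(U,V)$, $g\in\mathcal C(V,U)$ put $(f,g)_\ell=\mathrm{ptr}^\ell(fg)$ (nondegenerate; similarly in $\mathcal D$). The forgetful functor $\mathcal D\to\mathcal C$ has a two-sided adjoint $K$, with natural isomorphisms $\overline\Psi_{W,\mathbf X}:\mathcal C(W,X)\to\mathcal D(K(W),\mathbf X)$ and $\Psi_{\mathbf X,W}:\mathcal D(\mathbf X,K(W))\to\mathcal C(X,W)$ chosen so that $(\overline\Psi(f),g)_\ell=(f,\Psi(g))_\ell$. Put $\mathrm u_W=\overline\Psi^{-1}(\mathrm{id}_{K(W)}):W\to K(W)$ and $\mathrm c_W=\Psi(\mathrm{id}_{K(W)}):K(W)\to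 W$. For $k,r\ge0$, $l=k+r+1\le m$ and $z$ a natural endomorphism of the identity functor of $\mathcal D=Z(\mathcal C)$, $\mathrm{FS}^{(m,k,r)}_{V,z}:V\to V$ is the composite of the following steps (identities on unaffected factors): (1) insert $\overline{\mathrm{db}}_{V^k}:I\to V^{-k}\otimes V^k$ to the left of $V$, $\mathrm{db}_{V^r}:I\to V^r\otimes V^{-r}$ to the right of $V$, and $\overline{\mathrm{db}}_{V^{m-l}}:I\to V^{l-m}\otimes V^{m-l}$ between $V^{-k}$ and $V^k$, giving a morphism from $V$ to $V^{-k}\otimes V^{l-m}\otimes(V^{m-l}\otimes V^k\otimes V\otimes V^r)\otimes V^{-r}=V^{-k}\otimes V^{l-m}\otimes V^m\otimes V^{-r}$; (2) apply $\theta^{-1}_{K(V^m)}\mathrm u_{V^m}$ to $V^m$; (3) apply $\sigma_{K(V^m)}(V^{l-m})^{-1}:V^{l-m}\otimes K(V^m)\to K(V^m)\otimes V^{l-m}$; (4) apply $\mathrm c_{V^m}z_{K(V^m)}:K(V^m)\to V^m=V^k\otimes V\otimes V^r\otimes V^{m-l}$, landing in $V^{-k}\otimes V^k\otimes V\otimes V^r\otimes V^{m-l}\otimes V^{l-m}\otimes V^{-r}$; (5) contract $V^{-k}\otimes V^k$ by $\mathrm{ev}_{V^k}$, $V^{m-l}\otimes V^{l-m}$ by $\overline{\mathrm{ev}}_{V^{m-l}}$, then $V^r\otimes V^{-r}$ by $\overline{\mathrm{ev}}_{V^r}$, leaving $V$. Write $\mathrm{FS}^{(m,l)}_{V,z}=\mathrm{FS}^{(m,l-1,0)}_{V,z}$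 for $1\le l\le m$. Naturality in $V$ means $f\circ\mathrm{FS}_{V,z}^{(m,k,r)}=\mathrm{FS}_{W,z}^{(m,k,r)}\circ f$ for all $f:V\to W$. The GFS indicator for $m\ge l\ge1$ is the trace $\nu^{\mathbf X}_{m,l}(V)$ of the linear map on $\mathcal C(X,V^m)$ sending $f$ to $(\mathrm{ev}_{V^l}\otimes V^m)(V^{-l}\otimes f\otimes V^l)(\sigma_X(V^{-l})\otimes V^l)(X\otimes\overline{\mathrm{db}}_{V^l})$, where $V^m\otimes V^l=V^l\otimes V^m$. Additivity means $\nu^{\mathbf X}_{m,l}(U\oplus V)=\nu^{\mathbf X}_{m,l}(U)+\nu^{\mathbf X}_{m,l}(V)$. *)

theory Defs
  imports Complex_Main "HOL-Computational_Algebra.Polynomial" "HOL-Library.FuncSet"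
begin

section \<open>Linear categories with tensor product and duals\<close>

text \<open>
  The objects form a set \<open>Obj\<close> inside a type.  All morphisms live in one vector space
  (think of the direct sum, or the product, of all morphism spaces), and \<open>Hom V W\<close> is a subspace
  of it.  Every small linear category is of this form, up to renaming of morphisms; composition and
  tensor product of morphisms are only constrained on the morphism spaces.  This convention makes
  the spaces \<open>Hom V W\<close> amenable to the linear algebra of the library.  Distinct morphism spaces are
  allowed to overlap: this happens in the center below, whose morphisms are morphisms
  of the original category.
\<close>

record ('o, 'm, 'k) pivcat =
  Obj :: "'o set"
  Hom :: "'o \<Rightarrow> 'o \<Rightarrow> 'm set"
  Id :: "'o \<Rightarrow> 'm"
  Comp :: "'m \<Rightarrow> 'm \<Rightarrow> 'm"  (infixl \<open>\<cdot>\<index>\<close> 68)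
  scal :: "'k \<Rightarrow> 'm \<Rightarrow> 'm"
  Unit :: "'o"  (\<open>\<one>\<index>\<close>)
  TensO :: "'o \<Rightarrow> 'o \<Rightarrow> 'o"  (infixl \<open>\<odot>\<index>\<close> 75)
  TensM :: "'m \<Rightarrow> 'm \<Rightarrow> 'm"  (infixl \<open>\<otimes>\<index>\<close> 70)
  Dual :: "'o \<Rightarrow> 'o"
  Ev :: "'o \<Rightarrow> 'm"
  Db :: "'o \<Rightarrow> 'm"

text \<open>Composition is written in the usual order: \<open>f \<cdot> g\<close> is \<open>g\<close> followed by \<open>f\<close>.\<close>

locale linear_category =
  fixes C :: "('o, 'm::ab_group_add, 'k::field) pivcat" (structure)
  assumes scal: "vector_space (scal C)"
    and Hom_subspace: "\<lbrakk>V \<in> Obj C; W \<in> Obj C\<rbrakk> \<Longrightarrow> module.subspace (scal C) (Hom C V W)"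
    and Id_Hom: "V \<in> Obj C \<Longrightarrow> Id C V \<in> Hom C V V"
    and Comp_Hom: "\<lbrakk>U \<in> Obj C; V \<in> Obj C; W \<in> Obj C; f \<in> Hom C V W; g \<in> Hom C U V\<rbrakk>
      \<Longrightarrow> f \<cdot> g \<in> Hom C U W"
    and Comp_assoc: "\<lbrakk>T \<in> Obj C; U \<in> Obj C; V \<in> Obj C; W \<in> Obj C;
      f \<in> Hom C V W; g \<in> Hom C U V; h \<in> Hom C T U\<rbrakk> \<Longrightarrow> (f \<cdot> g) \<cdot> h = f \<cdot> (g \<cdot> h)"
    and Id_Comp: "\<lbrakk>V \<in> Obj C; W \<in> Obj C; f \<in> Hom C V W\<rbrakk> \<Longrightarrow> Id C W \<cdot> f = f"
    and Comp_Id: "\<lbrakk>V \<in> Obj C; W \<in> Obj C; f \<in> Hom C V W\<rbrakk> \<Longrightarrow> f \<cdot> Id C V = f"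
    and Comp_add_left: "\<lbrakk>U \<in> Obj C; V \<in> Obj C; W \<in> Obj C;
      f \<in> Hom C V W; f' \<in> Hom C V W; g \<in> Hom C U V\<rbrakk> \<Longrightarrow> (f + f') \<cdot> g = f \<cdot> g + f' \<cdot> g"
    and Comp_add_right: "\<lbrakk>U \<in> Obj C; V \<in> Obj C; W \<in> Obj C;
      f \<in> Hom C V W; g \<in> Hom C U V; g' \<in> Hom C U V\<rbrakk> \<Longrightarrow> f \<cdot> (g + g') = f \<cdot> g + f \<cdot> g'"
    and Comp_scal_left: "\<lbrakk>U \<in> Obj C; V \<in> Obj C; W \<in> Obj C;
      f \<in> Hom C V W; g \<in> Hom C U V\<rbrakk> \<Longrightarrow> scal C c f \<cdot> g = scal C c (f \<cdot> g)"
    and Comp_scal_right: "\<lbrakk>U \<in> Obj C; V \<in> Obj C; W \<in> Obj C;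
      f \<in> Hom C V W; g \<in> Hom C U V\<rbrakk> \<Longrightarrow> f \<cdot> scal C c g = scal C c (f \<cdot> g)"

text \<open>Strict monoidal linear categories (tensor product bilinear on morphisms).\<close>

locale strict_monoidal_linear_category = linear_category +
  assumes Unit_Obj: "\<one> \<in> Obj C"
    and TensO_Obj: "\<lbrakk>V \<in> Obj C; W \<in> Obj C\<rbrakk> \<Longrightarrow> V \<odot> W \<in> Obj C"
    and TensM_Hom: "\<lbrakk>V \<in> Obj C; W \<in> Obj C; V' \<in> Obj C; W' \<in> Obj C;
      f \<in> Hom C V W; g \<in> Hom C V' W'\<rbrakk> \<Longrightarrow> f \<otimes> g \<in> Hom C (V \<odot> V') (W \<odot> W')"
    and TensM_Id: "\<lbrakk>V \<in> Obj C; W \<in> Obj C\<rbrakk> \<Longrightarrow> Id C V \<otimes> Id C W = Id C (V \<odot> W)"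
    and TensM_Comp: "\<lbrakk>U \<in> Obj C; V \<in> Obj C; W \<in> Obj C; U' \<in> Obj C; V' \<in> Obj C; W' \<in> Obj C;
      f \<in> Hom C V W; g \<in> Hom C U V; f' \<in> Hom C V' W'; g' \<in> Hom C U' V'\<rbrakk>
      \<Longrightarrow> (f \<cdot> g) \<otimes> (f' \<cdot> g') = (f \<otimes> f') \<cdot> (g \<otimes> g')"
    and TensM_add_left: "\<lbrakk>V \<in> Obj C; W \<in> Obj C; V' \<in> Obj C; W' \<in> Obj C;
      f \<in> Hom C V W; f' \<in> Hom C V W; g \<in> Hom C V' W'\<rbrakk> \<Longrightarrow> (f + f') \<otimes> g = f \<otimes> g + f' \<otimes> g"
    and TensM_add_right: "\<lbrakk>V \<in> Obj C; W \<in> Obj C; V' \<in> Obj C; W' \<in> Obj C;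
      f \<in> Hom C V W; g \<in> Hom C V' W'; g' \<in> Hom C V' W'\<rbrakk> \<Longrightarrow> f \<otimes> (g + g') = f \<otimes> g + f \<otimes> g'"
    and TensM_scal_left: "\<lbrakk>V \<in> Obj C; W \<in> Obj C; V' \<in> Obj C; W' \<in> Obj C;
      f \<in> Hom C V W; g \<in> Hom C V' W'\<rbrakk> \<Longrightarrow> scal C c f \<otimes> g = scal C c (f \<otimes> g)"
    and TensM_scal_right: "\<lbrakk>V \<in> Obj C; W \<in> Obj C; V' \<in> Obj C; W' \<in> Obj C;
      f \<in> Hom C V W; g \<in> Hom C V' W'\<rbrakk> \<Longrightarrow> f \<otimes> scal C c g = scal C c (f \<otimes> g)"
    and TensO_assoc: "\<lbrakk>U \<in> Obj C; V \<in> Obj C; W \<in> Obj C\<rbrakk> \<Longrightarrow> (U \<odot> V) \<odot> W = U \<odot> (V \<odot> W)"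
    and TensM_assoc: "\<lbrakk>U \<in> Obj C; V \<in> Obj C; W \<in> Obj C; U' \<in> Obj C; V' \<in> Obj C; W' \<in> Obj C;
      f \<in> Hom C U U'; g \<in> Hom C V V'; h \<in> Hom C W W'\<rbrakk> \<Longrightarrow> (f \<otimes> g) \<otimes> h = f \<otimes> (g \<otimes> h)"
    and TensO_Unit_left: "V \<in> Obj C \<Longrightarrow> \<one> \<odot> V = V"
    and TensO_Unit_right: "V \<in> Obj C \<Longrightarrow> V \<odot> \<one> = V"
    and TensM_Unit_left: "\<lbrakk>V \<in> Obj C; W \<in> Obj C; f \<in> Hom C V W\<rbrakk> \<Longrightarrow> Id C \<one> \<otimes> f = f"
    and TensM_Unit_right: "\<lbrakk>V \<in> Obj C; W \<in> Obj C; f \<in> Hom C V W\<rbrakk> \<Longrightarrow> f \<otimes> Id C \<one> = f"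

definition dual_mor :: "('o, 'm, 'k) pivcat \<Rightarrow> 'o \<Rightarrow> 'o \<Rightarrow> 'm \<Rightarrow> 'm" where
  "dual_mor C V W f =
    (Ev C W \<otimes> Id C (Dual C V)) \<cdot> (Id C (Dual C W) \<otimes> f \<otimes> Id C (Dual C V))
      \<cdot> (Id C (Dual C W) \<otimes> Db C V)" for C (structure)

text \<open>
  Strict pivotal structure: the pivotal isomorphism \<open>j: Id \<rightarrow> (-)\<^sup>\<or>\<^sup>\<or>\<close> is the identity, i.e.\ the
  double dual functor is the identity on objects and on morphisms, and the
  canonical isomorphism
  \<open>(ev \<otimes> W\<^sup>\<or> \<otimes> V\<^sup>\<or>)((V \<otimes> W)\<^sup>\<or> \<otimes> V \<otimes> db \<otimes> V\<^sup>\<or>)((V \<otimes> W)\<^sup>\<or> \<otimes> db): (V \<otimes> W)\<^sup>\<or> \<rightarrow> W\<^sup>\<or> \<otimes> V\<^sup>\<or>\<close>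
  is an identity.  Then the identity is automatically monoidal as a transformation
  to the double dual functor.
\<close>

locale strict_pivotal_category = strict_monoidal_linear_category +
  assumes Dual_Obj: "V \<in> Obj C \<Longrightarrow> Dual C V \<in> Obj C"
    and Ev_Hom: "V \<in> Obj C \<Longrightarrow> Ev C V \<in> Hom C (Dual C V \<odot> V) \<one>"
    and Db_Hom: "V \<in> Obj C \<Longrightarrow> Db C V \<in> Hom C \<one> (V \<odot> Dual C V)"
    and zigzag: "V \<in> Obj C \<Longrightarrow> (Id C V \<otimes> Ev C V) \<cdot> (Db C V \<otimes> Id C V) = Id C V"
    and zigzag_Dual: "V \<in> Obj C \<Longrightarrow>
      (Ev C V \<otimes> Id C (Dual C V)) \<cdot> (Id C (Dual C V) \<otimes> Db C V) = Id C (Dual C V)"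
    and Dual_Dual: "V \<in> Obj C \<Longrightarrow> Dual C (Dual C V) = V"
    and dual_dual_mor: "\<lbrakk>V \<in> Obj C; W \<in> Obj C; f \<in> Hom C V W\<rbrakk>
      \<Longrightarrow> dual_mor C (Dual C W) (Dual C V) (dual_mor C V W f) = f"
    and Dual_TensO: "\<lbrakk>V \<in> Obj C; W \<in> Obj C\<rbrakk> \<Longrightarrow> Dual C (V \<odot> W) = Dual C W \<odot> Dual C V"
    and Dual_TensO_iso: "\<lbrakk>V \<in> Obj C; W \<in> Obj C\<rbrakk> \<Longrightarrow>
      (Ev C (V \<odot> W) \<otimes> Id C (Dual C W) \<otimes> Id C (Dual C V))
        \<cdot> (Id C (Dual C (V \<odot> W)) \<otimes> Id C V \<otimes> Db C W \<otimes> Id C (Dual C V))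
        \<cdot> (Id C (Dual C (V \<odot> W)) \<otimes> Db C V)
      = Id C (Dual C (V \<odot> W))"

definition Evbar :: "('o, 'm, 'k) pivcat \<Rightarrow> 'o \<Rightarrow> 'm" where
  "Evbar C V = Ev C (Dual C V)"

definition Dbbar :: "('o, 'm, 'k) pivcat \<Rightarrow> 'o \<Rightarrow> 'm" where
  "Dbbar C V = Db C (Dual C V)"

text \<open>The pivotal traces of \<open>f: V \<rightarrow> V\<close>, as endomorphisms of the unit object.\<close>

definition ptr_r :: "('o, 'm, 'k) pivcat \<Rightarrow> 'o \<Rightarrow> 'm \<Rightarrow> 'm" where
  "ptr_r C V f = Evbar C V \<cdot> (f \<otimes> Id C (Dual C V)) \<cdot> Db C V" for C (structure)

definition ptr_l :: "('o, 'm, 'k) pivcat \<Rightarrow> 'o \<Rightarrow> 'm \<Rightarrow> 'm" where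
  "ptr_l C V f = Ev C V \<cdot> (Id C (Dual C V) \<otimes> f) \<cdot> Dbbar C V" for C (structure)

definition spherical :: "('o, 'm, 'k) pivcat \<Rightarrow> bool" where
  "spherical C \<longleftrightarrow> (\<forall>V\<in>Obj C. \<forall>f\<in>Hom C V V. ptr_r C V f = ptr_l C V f)"

text \<open>\<open>(f, g)\<^sub>\<ell>\<close> for \<open>f: U \<rightarrow> V\<close> and \<open>g: V \<rightarrow> U\<close>.\<close>

definition pairing_l :: "('o, 'm, 'k) pivcat \<Rightarrow> 'o \<Rightarrow> 'm \<Rightarrow> 'm \<Rightarrow> 'm" where
  "pairing_l C V f g = ptr_l C V (f \<cdot> g)" for C (structure)


section \<open>Semisimplicity and fusion categories\<close>

definition is_mono :: "('o, 'm, 'k) pivcat \<Rightarrow> 'o \<Rightarrow> 'o \<Rightarrow> 'm \<Rightarrow> bool" where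
  "is_mono C V W f \<longleftrightarrow> f \<in> Hom C V W \<and>
    (\<forall>U\<in>Obj C. \<forall>g\<in>Hom C U V. \<forall>h\<in>Hom C U V. f \<cdot> g = f \<cdot> h \<longrightarrow> g = h)" for C (structure)

definition is_epi :: "('o, 'm, 'k) pivcat \<Rightarrow> 'o \<Rightarrow> 'o \<Rightarrow> 'm \<Rightarrow> bool" where
  "is_epi C V W f \<longleftrightarrow> f \<in> Hom C V W \<and>
    (\<forall>U\<in>Obj C. \<forall>g\<in>Hom C W U. \<forall>h\<in>Hom C W U. g \<cdot> f = h \<cdot> f \<longrightarrow> g = h)" for C (structure)

definition inverses :: "('o, 'm, 'k) pivcat \<Rightarrow> 'o \<Rightarrow> 'o \<Rightarrow> 'm \<Rightarrow> 'm \<Rightarrow> bool" where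
  "inverses C V W f g \<longleftrightarrow> f \<in> Hom C V W \<and> g \<in> Hom C W V \<and> g \<cdot> f = Id C V \<and> f \<cdot> g = Id C W"
  for C (structure)

definition is_iso :: "('o, 'm, 'k) pivcat \<Rightarrow> 'o \<Rightarrow> 'o \<Rightarrow> 'm \<Rightarrow> bool" where
  "is_iso C V W f \<longleftrightarrow> (\<exists>g. inverses C V W f g)"

definition inv_mor :: "('o, 'm, 'k) pivcat \<Rightarrow> 'o \<Rightarrow> 'o \<Rightarrow> 'm \<Rightarrow> 'm" where
  "inv_mor C V W f = (THE g. inverses C V W f g)"

definition is_kernel ::
  "('o, 'm::zero, 'k) pivcat \<Rightarrow> 'o \<Rightarrow> 'o \<Rightarrow> 'm \<Rightarrow> 'o \<Rightarrow> 'm \<Rightarrow> bool" where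
  "is_kernel C V W f K i \<longleftrightarrow> i \<in> Hom C K V \<and> f \<cdot> i = 0 \<and>
    (\<forall>U\<in>Obj C. \<forall>g\<in>Hom C U V. f \<cdot> g = 0 \<longrightarrow> (\<exists>!h. h \<in> Hom C U K \<and> i \<cdot> h = g))" for C (structure)

definition is_cokernel ::
  "('o, 'm::zero, 'k) pivcat \<Rightarrow> 'o \<Rightarrow> 'o \<Rightarrow> 'm \<Rightarrow> 'o \<Rightarrow> 'm \<Rightarrow> bool" where
  "is_cokernel C V W f Q p \<longleftrightarrow> p \<in> Hom C W Q \<and> p \<cdot> f = 0 \<and>
    (\<forall>U\<in>Obj C. \<forall>g\<in>Hom C W U. g \<cdot> f = 0 \<longrightarrow> (\<exists>!h. h \<in> Hom C Q U \<and> h \<cdot> p = g))" for C (structure)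

text \<open>\<open>W\<close> is a direct sum (biproduct) of the family \<open>S\<close> indexed by the finite set \<open>J\<close>.\<close>

definition is_direct_sum ::
  "('o, 'm::comm_monoid_add, 'k) pivcat \<Rightarrow> 'i set \<Rightarrow> ('i \<Rightarrow> 'o) \<Rightarrow> 'o \<Rightarrow> bool" where
  "is_direct_sum C J S W \<longleftrightarrow>
    (\<exists>\<iota> \<pi>. (\<forall>i\<in>J. \<iota> i \<in> Hom C (S i) W \<and> \<pi> i \<in> Hom C W (S i)) \<and>
      (\<forall>i\<in>J. \<forall>j\<in>J. \<pi> i \<cdot> \<iota> j = (if i = j then Id C (S i) else 0)) \<and>
      (\<Sum>i\<in>J. \<iota> i \<cdot> \<pi> i) = Id C W)" for C (structure)

definition is_direct_sum2 ::
  "('o, 'm::comm_monoid_add, 'k) pivcat \<Rightarrow> 'o \<Rightarrow> 'o \<Rightarrow> 'o \<Rightarrow> bool" where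
  "is_direct_sum2 C U V W \<longleftrightarrow> is_direct_sum C UNIV (\<lambda>b. if b then U else V) W"

definition simple_obj :: "('o, 'm::zero, 'k) pivcat \<Rightarrow> 'o \<Rightarrow> bool" where
  "simple_obj C S \<longleftrightarrow> S \<in> Obj C \<and> Id C S \<noteq> 0 \<and>
    (\<forall>V\<in>Obj C. \<forall>f. is_mono C V S f \<longrightarrow> f = 0 \<or> is_iso C V S f)"

text \<open>
  Semisimple: abelian (the first five axioms), and every object is a finite direct sum of simple
  objects.
\<close>

locale semisimple_category = linear_category +
  assumes zero_object: "\<exists>Z\<in>Obj C. Id C Z = 0"
    and direct_sums: "\<lbrakk>U \<in> Obj C; V \<in> Obj C\<rbrakk> \<Longrightarrow> \<exists>W\<in>Obj C. is_direct_sum2 C U V W"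
    and kernels: "\<lbrakk>V \<in> Obj C; W \<in> Obj C; f \<in> Hom C V W\<rbrakk>
      \<Longrightarrow> (\<exists>K\<in>Obj C. \<exists>i. is_kernel C V W f K i) \<and> (\<exists>Q\<in>Obj C. \<exists>p. is_cokernel C V W f Q p)"
    and mono_kernel: "\<lbrakk>V \<in> Obj C; W \<in> Obj C; is_mono C V W f\<rbrakk>
      \<Longrightarrow> \<exists>U\<in>Obj C. \<exists>g\<in>Hom C W U. is_kernel C W U g V f"
    and epi_cokernel: "\<lbrakk>V \<in> Obj C; W \<in> Obj C; is_epi C V W f\<rbrakk>
      \<Longrightarrow> \<exists>U\<in>Obj C. \<exists>g\<in>Hom C U V. is_cokernel C U V g W f"
    and sum_of_simples: "V \<in> Obj C
      \<Longrightarrow> \<exists>(n::nat) S. (\<forall>i<n. simple_obj C (S i)) \<and> is_direct_sum C {..<n} S V"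

locale strict_pivotal_fusion_category = strict_pivotal_category + semisimple_category +
  assumes Hom_finite_dim: "\<lbrakk>V \<in> Obj C; W \<in> Obj C\<rbrakk>
      \<Longrightarrow> \<exists>B. finite B \<and> Hom C V W = module.span (scal C) B"
    and Unit_simple: "simple_obj C \<one>"
    and finitely_many_simples:
      "\<exists>F. finite F \<and> (\<forall>S. simple_obj C S \<longrightarrow> (\<exists>T\<in>F. T \<in> Obj C \<and> (\<exists>f. is_iso C S T f)))"


section \<open>The center\<close>

definition half_braiding :: "('o, 'm, 'k) pivcat \<Rightarrow> 'o \<Rightarrow> ('o \<Rightarrow> 'm) \<Rightarrow> bool" where
  "half_braiding C X \<sigma> \<longleftrightarrow>
    \<sigma> \<in> extensional (Obj C) \<and>
    (\<forall>V\<in>Obj C. is_iso C (X \<odot> V) (V \<odot> X) (\<sigma> V)) \<and>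
    (\<forall>V\<in>Obj C. \<forall>W\<in>Obj C. \<forall>f\<in>Hom C V W. \<sigma> W \<cdot> (Id C X \<otimes> f) = (f \<otimes> Id C X) \<cdot> \<sigma> V) \<and>
    \<sigma> \<one> = Id C X \<and>
    (\<forall>V\<in>Obj C. \<forall>W\<in>Obj C. \<sigma> (V \<odot> W) = (Id C V \<otimes> \<sigma> W) \<cdot> (\<sigma> V \<otimes> Id C W))" for C (structure)

text \<open>
  The dual of \<open>(X, \<sigma>)\<close> is \<open>X\<^sup>\<or>\<close> with the unique half-braiding for which \<open>ev\<^sub>X\<close> and \<open>db\<^sub>X\<close> are
  morphisms in the center.
\<close>

definition center ::
  "('o, 'm, 'k) pivcat \<Rightarrow> ('o \<times> ('o \<Rightarrow> 'm), 'm, 'k) pivcat" where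
  "center C = \<lparr>
    Obj = {(X, \<sigma>). X \<in> Obj C \<and> half_braiding C X \<sigma>},
    Hom = (\<lambda>(X, \<sigma>) (Y, \<tau>). {f \<in> Hom C X Y. \<forall>V\<in>Obj C. (Id C V \<otimes> f) \<cdot> \<sigma> V = \<tau> V \<cdot> (f \<otimes> Id C V)}),
    Id = (\<lambda>(X, \<sigma>). Id C X),
    Comp = Comp C,
    scal = scal C,
    Unit = (\<one>, \<lambda>V\<in>Obj C. Id C V),
    TensO = (\<lambda>(X, \<sigma>) (Y, \<tau>).
      (X \<odot> Y, \<lambda>V\<in>Obj C. (\<sigma> V \<otimes> Id C Y) \<cdot> (Id C X \<otimes> \<tau> V))),
    TensM = TensM C,
    Dual = (\<lambda>(X, \<sigma>).
      (Dual C X, \<lambda>V\<in>Obj C.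
        (Ev C X \<otimes> Id C V \<otimes> Id C (Dual C X))
          \<cdot> (Id C (Dual C X) \<otimes> inv_mor C (X \<odot> V) (V \<odot> X) (\<sigma> V) \<otimes> Id C (Dual C X))
          \<cdot> (Id C (Dual C X) \<otimes> Id C V \<otimes> Db C X))),
    Ev = (\<lambda>(X, \<sigma>). Ev C X),
    Db = (\<lambda>(X, \<sigma>). Db C X)\<rparr>" for C (structure)

text \<open>The forgetful functor is \<^const>\<open>fst\<close> on objects and the identity on morphisms.\<close>

definition braiding :: "'o \<times> ('o \<Rightarrow> 'm) \<Rightarrow> 'o \<times> ('o \<Rightarrow> 'm) \<Rightarrow> 'm" where
  "braiding X Y = snd X (fst Y)"

definition drinfeld_u :: "('o, 'm, 'k) pivcat \<Rightarrow> 'o \<times> ('o \<Rightarrow> 'm) \<Rightarrow> 'm" where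
  "drinfeld_u C X =
    (let D = center C; X' = Dual D X; X'' = Dual D X' in
      (Ev D X \<otimes>\<^bsub>D\<^esub> Id D X'')
        \<cdot>\<^bsub>D\<^esub> (Id D X' \<otimes>\<^bsub>D\<^esub> inv_mor D (X \<odot>\<^bsub>D\<^esub> X'') (X'' \<odot>\<^bsub>D\<^esub> X) (braiding X X''))
        \<cdot>\<^bsub>D\<^esub> (Db D X' \<otimes>\<^bsub>D\<^esub> Id D X))"

text \<open>
  The twist \<open>\<theta> = u\<^sup>-\<^sup>1 j\<close>; the pivotal structure \<open>j: X \<rightarrow> X\<^sup>\<or>\<^sup>\<or>\<close> of the center is inherited, hence an
  identity.
\<close>

definition twist :: "('o, 'm, 'k) pivcat \<Rightarrow> 'o \<times> ('o \<Rightarrow> 'm) \<Rightarrow> 'm" where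
  "twist C X =
    (let D = center C; X'' = Dual D (Dual D X) in
      inv_mor D X X'' (drinfeld_u C X) \<cdot>\<^bsub>D\<^esub> Id D X)"

definition natural_id_endo :: "('o, 'm, 'k) pivcat \<Rightarrow> ('o \<Rightarrow> 'm) \<Rightarrow> bool" where
  "natural_id_endo C z \<longleftrightarrow>
    (\<forall>V\<in>Obj C. z V \<in> Hom C V V) \<and>
    (\<forall>V\<in>Obj C. \<forall>W\<in>Obj C. \<forall>f\<in>Hom C V W. f \<cdot> z V = z W \<cdot> f)" for C (structure)


section \<open>The two-sided adjoint of the forgetful functor\<close>

text \<open>
  \<open>KO\<close> and \<open>KM V W\<close> are the object and morphism parts of the functor \<open>K\<close>;
  \<open>PsiBar W X: C(W, X) \<rightarrow> D(K(W), X)\<close> and \<open>Psi X W: D(X, K(W)) \<rightarrow> C(X, W)\<close>.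
\<close>

record ('o, 'm) adjdata =
  KO :: "'o \<Rightarrow> 'o \<times> ('o \<Rightarrow> 'm)"
  KM :: "'o \<Rightarrow> 'o \<Rightarrow> 'm \<Rightarrow> 'm"
  PsiBar :: "'o \<Rightarrow> 'o \<times> ('o \<Rightarrow> 'm) \<Rightarrow> 'm \<Rightarrow> 'm"
  Psi :: "'o \<times> ('o \<Rightarrow> 'm) \<Rightarrow> 'o \<Rightarrow> 'm \<Rightarrow> 'm"

locale center_adjunction =
  fixes C :: "('o, 'm, 'k) pivcat" (structure) and A :: "('o, 'm) adjdata"
    and D :: "('o \<times> ('o \<Rightarrow> 'm), 'm, 'k) pivcat"
  defines D_def: "D \<equiv> center C"
  assumes KO_Obj: "W \<in> Obj C \<Longrightarrow> KO A W \<in> Obj D"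
    and KM_Hom: "\<lbrakk>V \<in> Obj C; W \<in> Obj C; f \<in> Hom C V W\<rbrakk>
      \<Longrightarrow> KM A V W f \<in> Hom D (KO A V) (KO A W)"
    and KM_Id: "V \<in> Obj C \<Longrightarrow> KM A V V (Id C V) = Id D (KO A V)"
    and KM_Comp: "\<lbrakk>U \<in> Obj C; V \<in> Obj C; W \<in> Obj C; f \<in> Hom C V W; g \<in> Hom C U V\<rbrakk>
      \<Longrightarrow> KM A U W (f \<cdot> g) = KM A V W f \<cdot>\<^bsub>D\<^esub> KM A U V g"
    and PsiBar_bij: "\<lbrakk>W \<in> Obj C; X \<in> Obj D\<rbrakk>
      \<Longrightarrow> bij_betw (PsiBar A W X) (Hom C W (fst X)) (Hom D (KO A W) X)"
    and PsiBar_natural: "\<lbrakk>W \<in> Obj C; W' \<in> Obj C; X \<in> Obj D; X' \<in> Obj D;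
      a \<in> Hom C W' W; f \<in> Hom C W (fst X); b \<in> Hom D X X'\<rbrakk>
      \<Longrightarrow> PsiBar A W' X' (b \<cdot> f \<cdot> a) = b \<cdot>\<^bsub>D\<^esub> PsiBar A W X f \<cdot>\<^bsub>D\<^esub> KM A W' W a"
    and Psi_bij: "\<lbrakk>W \<in> Obj C; X \<in> Obj D\<rbrakk>
      \<Longrightarrow> bij_betw (Psi A X W) (Hom D X (KO A W)) (Hom C (fst X) W)"
    and Psi_natural: "\<lbrakk>W \<in> Obj C; W' \<in> Obj C; X \<in> Obj D; X' \<in> Obj D;
      a \<in> Hom C W W'; g \<in> Hom D X (KO A W); b \<in> Hom D X' X\<rbrakk>
      \<Longrightarrow> Psi A X' W' (KM A W W' a \<cdot>\<^bsub>D\<^esub> g \<cdot>\<^bsub>D\<^esub> b) = a \<cdot> Psi A X W g \<cdot> b"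
    and Psi_adjoint: "\<lbrakk>W \<in> Obj C; X \<in> Obj D; f \<in> Hom C W (fst X); g \<in> Hom D X (KO A W)\<rbrakk>
      \<Longrightarrow> pairing_l D X (PsiBar A W X f) g = pairing_l C (fst X) f (Psi A X W g)"

definition adj_u :: "('o, 'm, 'k) pivcat \<Rightarrow> ('o, 'm) adjdata \<Rightarrow> 'o \<Rightarrow> 'm" where
  "adj_u C A W =
    inv_into (Hom C W (fst (KO A W))) (PsiBar A W (KO A W)) (Id (center C) (KO A W))"

definition adj_c :: "('o, 'm, 'k) pivcat \<Rightarrow> ('o, 'm) adjdata \<Rightarrow> 'o \<Rightarrow> 'm" where
  "adj_c C A W = Psi A (KO A W) W (Id (center C) (KO A W))"


section \<open>The endomorphisms FS and the generalized Frobenius-Schur indicators\<close>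

definition zpow :: "('o, 'm, 'k) pivcat \<Rightarrow> 'o \<Rightarrow> int \<Rightarrow> 'o" where
  "zpow C V n =
    (if n \<ge> 0 then (TensO C V ^^ nat n) \<one> else (TensO C (Dual C V) ^^ nat (- n)) \<one>)"
  for C (structure)

text \<open>
  The objects \<open>V\<^bsup>-n\<^esup>\<close> are written as powers of \<open>V\<^sup>\<or>\<close>; by strictness they coincide with the duals of
  \<open>V\<^sup>n\<close> that are involved in \<open>ev\<close>, \<open>db\<close> and their variants.  The rebracketing
  \<open>V\<^bsup>m-l\<^esup> \<otimes> V\<^sup>k \<otimes> V \<otimes> V\<^sup>r = V\<^sup>m = V\<^sup>k \<otimes> V \<otimes> V\<^sup>r \<otimes> V\<^bsup>m-l\<^esup>\<close> is an equality of objects.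
\<close>

definition FS ::
  "('o, 'm, 'k) pivcat \<Rightarrow> ('o, 'm) adjdata \<Rightarrow> ('o \<times> ('o \<Rightarrow> 'm) \<Rightarrow> 'm)
    \<Rightarrow> nat \<Rightarrow> nat \<Rightarrow> nat \<Rightarrow> 'o \<Rightarrow> 'm" where
  "FS C A z m k r V =
    (let l = k + r + 1;
         P = (\<lambda>n. zpow C V n);
         I = (\<lambda>n. Id C (P n));
         W = P (int m);
         K = KO A W;
         X = fst K;
         N = P (int l - int m)
     in
       (Id C V \<otimes> Evbar C (P (int r)))
       \<cdot> (Ev C (P (int k)) \<otimes> Id C V \<otimes> I (int r) \<otimes> Evbar C (P (int m - int l)) \<otimes> I (- int r))
       \<cdot> (I (- int k) \<otimes> (adj_c C A W \<cdot> z K) \<otimes> I (int l - int m) \<otimes> I (- int r))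
       \<cdot> (I (- int k) \<otimes> inv_mor C (X \<odot> N) (N \<odot> X) (snd K N) \<otimes> I (- int r))
       \<cdot> (I (- int k) \<otimes> I (int l - int m)
           \<otimes> (inv_mor (center C) K K (twist C K) \<cdot> adj_u C A W) \<otimes> I (- int r))
       \<cdot> (I (- int k) \<otimes> Dbbar C (P (int m - int l))
           \<otimes> I (int k) \<otimes> Id C V \<otimes> I (int r) \<otimes> I (- int r))
       \<cdot> (Dbbar C (P (int k)) \<otimes> Id C V \<otimes> Db C (P (int r))))" for C (structure)

definition FS2 ::
  "('o, 'm, 'k) pivcat \<Rightarrow> ('o, 'm) adjdata \<Rightarrow> ('o \<times> ('o \<Rightarrow> 'm) \<Rightarrow> 'm)
    \<Rightarrow> nat \<Rightarrow> nat \<Rightarrow> 'o \<Rightarrow> 'm" where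
  "FS2 C A z m l V = FS C A z m (l - 1) 0 V"

text \<open>The trace of a linear endomorphism \<open>T\<close> of a finite-dimensional subspace \<open>S\<close>.\<close>

definition trace_on ::
  "('k::field \<Rightarrow> 'm::ab_group_add \<Rightarrow> 'm) \<Rightarrow> 'm set \<Rightarrow> ('m \<Rightarrow> 'm) \<Rightarrow> 'k" where
  "trace_on s S T =
    (let B = (SOME B. B \<subseteq> S \<and> \<not> module.dependent s B \<and> module.span s B = S)
     in \<Sum>b\<in>B. module.representation s B (T b) b)"

definition GFS_map ::
  "('o, 'm, 'k) pivcat \<Rightarrow> 'o \<times> ('o \<Rightarrow> 'm) \<Rightarrow> nat \<Rightarrow> nat \<Rightarrow> 'o \<Rightarrow> 'm \<Rightarrow> 'm" where
  "GFS_map C X m l V f =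
    (Ev C (zpow C V (int l)) \<otimes> Id C (zpow C V (int m)))
    \<cdot> (Id C (zpow C V (- int l)) \<otimes> f \<otimes> Id C (zpow C V (int l)))
    \<cdot> (snd X (zpow C V (- int l)) \<otimes> Id C (zpow C V (int l)))
    \<cdot> (Id C (fst X) \<otimes> Dbbar C (zpow C V (int l)))" for C (structure)

definition GFS_indicator ::
  "('o, 'm::ab_group_add, 'k::field) pivcat \<Rightarrow> 'o \<times> ('o \<Rightarrow> 'm) \<Rightarrow> nat \<Rightarrow> nat \<Rightarrow> 'o \<Rightarrow> 'k" where
  "GFS_indicator C X m l V =
    trace_on (scal C) (Hom C (fst X) (zpow C V (int m))) (GFS_map C X m l V)"

end

theory Submission
  imports Defs "HOL-Number_Theory.Cong"
begin

text \<open>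
  Number the tensor factors of \<open>V\<^sup>m\<close> from \<open>0\<close> to \<open>m - 1\<close>.  The middle of the diagram of
  \<open>FS V\<close> is a coupon \<open>T: N \<otimes> V\<^sup>m \<rightarrow> V\<^sup>m \<otimes> N\<close>, built from the adjunction, the twist, the
  half-braiding and \<open>z\<close>, and \<open>T\<close> is natural in both arguments (\<open>natural_crossing_FS\<close>).  Outside the
  coupon, caps and cups join the output strand \<open>i\<close> to the input strand \<open>\<sigma> i = (i + m - l) mod m\<close>,
  except that the output \<open>k\<close> is the upper end of the diagram and the input \<open>\<sigma> k\<close> its lower end.
  If \<open>m\<close> and \<open>l\<close> are coprime then \<open>\<sigma>\<close> is a single cycle, so the diagram is one strand that runs
  \<open>m\<close> times through the coupon, and a morphism placed on it can be pushed from one end to the other.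

  The proof uses this in the following form.  Let \<open>e\<close> be an idempotent of \<open>W\<close>, and let \<open>\<phi>\<close> be a
  function on endomorphisms of \<open>W\<^sup>m\<close> such that \<open>\<phi> (e\<^sub>i \<cdot> q) = \<phi> (q \<cdot> e\<^bsub>\<sigma> i\<^esub>)\<close> for \<open>i \<noteq> k\<close>, where \<open>e\<^sub>i\<close>
  is \<open>e\<close> in position \<open>i\<close>.  Since \<open>e \<cdot> e = e\<close>, a copy of \<open>e\<close> may be split off and pushed to the next
  position on the strand; repeating this yields \<open>\<phi> (e\<^bsub>\<sigma> k\<^esub>) = \<phi> (e\<^sup>m)\<close>, with \<open>e\<close> in all positions
  (\<open>idempotent_spreads\<close>).  If \<open>e = \<iota> \<cdot> \<pi>\<close> is split by \<open>\<iota>: V \<rightarrow> W\<close>, then \<open>e\<^sup>m = \<iota>\<^sup>m \<cdot> \<pi>\<^sup>m\<close>, and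
  \<open>\<phi> (e\<^sup>m)\<close> can be computed on \<open>V\<close>.

  Naturality.  Let \<open>\<phi> q\<close> be the diagram of \<open>FS W\<close> with \<open>q\<close> inserted into the coupon.  The result is
  \<open>FS W \<cdot> \<iota> = \<iota> \<cdot> FS V\<close> for every split monomorphism \<open>\<iota>\<close> (\<open>FS_arrow_natural_split_mono\<close>).
  For an arbitrary \<open>f: V \<rightarrow> V'\<close> this is applied to three split monomorphisms into \<open>V \<oplus> V'\<close>: the two
  inclusions and the graph of \<open>f\<close> (\<open>FS_natural\<close>).

  Additivity.  Let \<open>\<phi> q\<close> be the trace of \<open>f \<mapsto> E (q \<cdot> f)\<close> on \<open>C(X, W\<^sup>m)\<close>, where the trace of \<open>E\<close> is the
  indicator.  Since \<open>E (e\<^sub>i \<cdot> f) = e\<^bsub>\<sigma> i\<^esub> \<cdot> E f\<close>, cyclicity of the trace gives the condition on \<open>\<phi>\<close>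
  for all \<open>i\<close>.  If \<open>W = U \<oplus> V\<close>, then the identity of \<open>W\<^sup>m\<close> is the sum of two idempotents in a
  single position, and the two summands of the trace are the indicators of \<open>U\<close> and \<open>V\<close>
  (\<open>GFS_additive\<close>).

  Comparison with the case \<open>r = 0\<close>.  Both endomorphisms are natural, so it suffices to compare them
  on simple objects, where they are scalars.  Because the pivotal dimension of a simple object does
  not vanish (\<open>simple_dim_nonzero\<close>), the scalars are determined by traces.  In a spherical category
  the strands that \<open>FS\<close> closes on the left may be closed on the right instead, so that the trace of
  \<open>FS V\<close> depends on \<open>k\<close> and \<open>r\<close> only through \<open>l\<close> (\<open>FS_arrow_trace\<close>).
\<close>

section \<open>Arrows with source and target\<close>

text \<open>
  A morphism of \<open>C\<close> does not determine its source and target.  Diagrams are therefore computed with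
  triples, on which composition and tensor product are total: ill-typed expressions have the value
  \<open>Null\<close>.  Both operations are then associative without side conditions, and the side conditions of
  the remaining laws are decided by the simplifier, since source and target are functions.
\<close>

datatype ('o, 'm) arrow = Null | Arrow 'o 'm 'o

fun src :: "('o, 'm) arrow \<Rightarrow> 'o" where "src (Arrow A f B) = A" | "src Null = undefined"
fun trg :: "('o, 'm) arrow \<Rightarrow> 'o" where "trg (Arrow A f B) = B" | "trg Null = undefined"
fun mor :: "('o, 'm) arrow \<Rightarrow> 'm" where "mor (Arrow A f B) = f" | "mor Null = undefined"

context strict_monoidal_linear_category
begin

fun arr :: "('a, 'b) arrow \<Rightarrow> bool" where
  "arr (Arrow A f B) \<longleftrightarrow> A \<in> Obj C \<and> B \<in> Obj C \<and> f \<in> Hom C A B"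
| "arr Null \<longleftrightarrow> False"

definition cmp :: "('a, 'b) arrow \<Rightarrow> ('a, 'b) arrow \<Rightarrow> ('a, 'b) arrow"  (infixr \<open>oo\<close> 60) where
  "f oo g = (if arr f \<and> arr g \<and> src f = trg g then Arrow (src g) (mor f \<cdot> mor g) (trg f) else Null)"

definition tns :: "('a, 'b) arrow \<Rightarrow> ('a, 'b) arrow \<Rightarrow> ('a, 'b) arrow"  (infixr \<open>**\<close> 70) where
  "f ** g = (if arr f \<and> arr g
    then Arrow (src f \<odot> src g) (mor f \<otimes> mor g) (trg f \<odot> trg g) else Null)"

definition ide :: "'a \<Rightarrow> ('a, 'b) arrow" where
  "ide A = (if A \<in> Obj C then Arrow A (Id C A) A else Null)"

lemmas [simp] = Unit_Obj TensO_Obj TensO_assoc TensO_Unit_left TensO_Unit_right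

lemma arr_Arrow_iff: "arr f \<longleftrightarrow> (\<exists>A g B. f = Arrow A g B \<and> A \<in> Obj C \<and> B \<in> Obj C \<and> g \<in> Hom C A B)"
  by (cases f) auto

lemma arr_Obj [simp]: "arr f \<Longrightarrow> src f \<in> Obj C" "arr f \<Longrightarrow> trg f \<in> Obj C"
  by (auto simp: arr_Arrow_iff)

lemma arr_mor: "arr f \<Longrightarrow> mor f \<in> Hom C (src f) (trg f)"
  by (auto simp: arr_Arrow_iff)

lemma arrow_eqI: "\<lbrakk>arr f; arr g; src f = src g; trg f = trg g; mor f = mor g\<rbrakk> \<Longrightarrow> f = g"
  by (auto simp: arr_Arrow_iff)

lemma not_arr_cmp: "\<not> arr f \<or> \<not> arr g \<or> src f \<noteq> trg g \<Longrightarrow> f oo g = Null"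
  by (auto simp: cmp_def)

lemma arr_ide [simp]: "arr (ide A) \<longleftrightarrow> A \<in> Obj C"
  and src_ide [simp]: "A \<in> Obj C \<Longrightarrow> src (ide A) = A"
  and trg_ide [simp]: "A \<in> Obj C \<Longrightarrow> trg (ide A) = A"
  and mor_ide [simp]: "A \<in> Obj C \<Longrightarrow> mor (ide A) = Id C A"
  by (auto simp: ide_def Id_Hom)

lemma arr_cmp [simp]: "arr (f oo g) \<longleftrightarrow> arr f \<and> arr g \<and> src f = trg g"
proof -
  have "mor f \<cdot> mor g \<in> Hom C (src g) (trg f)" if "arr f" "arr g" "src f = trg g"
    using that Comp_Hom[of "src g" "src f" "trg f" "mor f" "mor g"] arr_mor[of f] arr_mor[of g] by simp
  then show ?thesis by (auto simp: cmp_def)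
qed

lemma src_cmp [simp]: "\<lbrakk>arr f; arr g; src f = trg g\<rbrakk> \<Longrightarrow> src (f oo g) = src g"
  and trg_cmp [simp]: "\<lbrakk>arr f; arr g; src f = trg g\<rbrakk> \<Longrightarrow> trg (f oo g) = trg f"
  and mor_cmp [simp]: "\<lbrakk>arr f; arr g; src f = trg g\<rbrakk> \<Longrightarrow> mor (f oo g) = mor f \<cdot> mor g"
  by (auto simp: cmp_def)

lemma arr_tns [simp]: "arr (f ** g) \<longleftrightarrow> arr f \<and> arr g"
  by (auto simp: tns_def intro!: TensM_Hom arr_mor)

lemma src_tns [simp]: "\<lbrakk>arr f; arr g\<rbrakk> \<Longrightarrow> src (f ** g) = src f \<odot> src g"
  and trg_tns [simp]: "\<lbrakk>arr f; arr g\<rbrakk> \<Longrightarrow> trg (f ** g) = trg f \<odot> trg g"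
  and mor_tns [simp]: "\<lbrakk>arr f; arr g\<rbrakk> \<Longrightarrow> mor (f ** g) = mor f \<otimes> mor g"
  by (auto simp: tns_def)

lemma cmp_assoc [simp]: "(f oo g) oo h = f oo g oo h"
proof (cases "arr f \<and> arr g \<and> arr h \<and> src f = trg g \<and> src g = trg h")
  case True
  then show ?thesis
    using Comp_assoc[of "src h" "src g" "src f" "trg f" "mor f" "mor g" "mor h"]
      arr_mor[of f] arr_mor[of g] arr_mor[of h]
    by (intro arrow_eqI) simp_all
next
  case False
  then have "\<not> arr ((f oo g) oo h)" "\<not> arr (f oo g oo h)" by auto
  then show ?thesis by (metis arr_cmp not_arr_cmp)
qed

lemma tns_assoc [simp]: "(f ** g) ** h = f ** g ** h"
proof (cases "arr f \<and> arr g \<and> arr h")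
  case True
  then show ?thesis
    by (intro arrow_eqI) (auto intro!: TensM_assoc arr_mor)
next
  case False
  then show ?thesis by (auto simp: tns_def)
qed

lemma ide_cmp [simp]: "\<lbrakk>arr f; trg f = A\<rbrakk> \<Longrightarrow> ide A oo f = f"
  using Id_Comp[of "src f" "trg f" "mor f"] arr_mor[of f] by (intro arrow_eqI) auto

lemma cmp_ide [simp]: "\<lbrakk>arr f; src f = A\<rbrakk> \<Longrightarrow> f oo ide A = f"
  using Comp_Id[of "src f" "trg f" "mor f"] arr_mor[of f] by (intro arrow_eqI) auto

lemma ide_cmp' [simp]: "\<lbrakk>arr f; trg f = A\<rbrakk> \<Longrightarrow> ide A oo f oo g = f oo g"
  by (metis cmp_assoc ide_cmp)

lemma ide_tns [simp]: "\<lbrakk>A \<in> Obj C; B \<in> Obj C\<rbrakk> \<Longrightarrow> ide (A \<odot> B) = ide A ** ide B"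
  by (intro arrow_eqI) (auto simp: TensM_Id)

lemma ide_Unit_tns [simp]: "arr f \<Longrightarrow> ide \<one> ** f = f"
  by (intro arrow_eqI) (auto intro!: TensM_Unit_left arr_mor)

lemma tns_ide_Unit [simp]: "arr f \<Longrightarrow> f ** ide \<one> = f"
  by (intro arrow_eqI) (auto intro!: TensM_Unit_right arr_mor)

text \<open>
  The orientation from two layers to one layer of columns is the one used for rewriting.  The
  variants below merge layers whose blocks do not match one to one: a column of one layer may be
  matched with two or three columns of the other, and a factor that starts or ends at the unit
  object may be missing from one of the layers.
\<close>

lemma interchange: "\<lbrakk>arr a; arr b; arr c; arr d; src a = trg c; src b = trg d\<rbrakk>
  \<Longrightarrow> (a ** b) oo (c ** d) = (a oo c) ** (b oo d)"
proof (intro arrow_eqI)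
  assume "arr a" "arr b" "arr c" "arr d" "src a = trg c" "src b = trg d"
  then show "mor ((a ** b) oo (c ** d)) = mor ((a oo c) ** (b oo d))"
    using TensM_Comp[of "src c" "src a" "trg a" "src d" "src b" "trg b" "mor a" "mor c" "mor b" "mor d"]
    by (auto simp: arr_mor) (metis arr_Obj(1) arr_mor arr_Obj(2))
qed auto

lemma interchange_2_1: "\<lbrakk>arr a; arr b; arr r; arr g; arr s; src a \<odot> src b = trg g; src r = trg s\<rbrakk>
  \<Longrightarrow> (a ** b ** r) oo (g ** s) = ((a ** b) oo g) ** (r oo s)"
  using interchange[of "a ** b" r g s] by simp

lemma interchange_1_2: "\<lbrakk>arr a; arr b; arr r; arr g; arr s; src g = trg a \<odot> trg b; src s = trg r\<rbrakk>
  \<Longrightarrow> (g ** s) oo (a ** b ** r) = (g oo (a ** b)) ** (s oo r)"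
  using interchange[of g s "a ** b" r] by simp

lemma cap_left: "\<lbrakk>arr f; arr e; arr g; trg e = \<one>; src f = trg g\<rbrakk> \<Longrightarrow> f oo (e ** g) = e ** (f oo g)"
  using interchange[of "ide \<one>" f e g] by simp
lemma cap_right: "\<lbrakk>arr f; arr e; arr g; trg e = \<one>; src f = trg g\<rbrakk> \<Longrightarrow> f oo (g ** e) = (f oo g) ** e"
  using interchange[of f "ide \<one>" g e] by simp
lemma cup_left: "\<lbrakk>arr f; arr e; arr g; src e = \<one>; trg f = src g\<rbrakk> \<Longrightarrow> (e ** g) oo f = e ** (g oo f)"
  using interchange[of e g "ide \<one>" f] by simp
lemma cup_right: "\<lbrakk>arr f; arr e; arr g; src e = \<one>; trg f = src g\<rbrakk> \<Longrightarrow> (g ** e) oo f = (g oo f) ** e"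
  using interchange[of g e f "ide \<one>"] by simp

lemma cap_right_2: "\<lbrakk>arr f; arr e; arr g; arr h; trg e = \<one>; src f = trg g \<odot> trg h\<rbrakk>
  \<Longrightarrow> f oo (g ** h ** e) = (f oo (g ** h)) ** e"
  using cap_right[of f e "g ** h"] by simp
lemma cup_right_2: "\<lbrakk>arr f; arr e; arr g; arr h; src e = \<one>; trg f = src g \<odot> src h\<rbrakk>
  \<Longrightarrow> (g ** h ** e) oo f = ((g ** h) oo f) ** e"
  using cup_right[of f e "g ** h"] by simp

lemma ide2_cmp: "\<lbrakk>arr f; A \<in> Obj C; B \<in> Obj C; trg f = A \<odot> B\<rbrakk> \<Longrightarrow> (ide A ** ide B) oo f = f"
  using ide_cmp[of f "A \<odot> B"] by simp
lemma ide3_cmp: "\<lbrakk>arr f; A \<in> Obj C; B \<in> Obj C; D \<in> Obj C; trg f = A \<odot> B \<odot> D\<rbrakk>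
  \<Longrightarrow> (ide A ** ide B ** ide D) oo f = f"
  using ide_cmp[of f "A \<odot> B \<odot> D"] by simp
lemma cmp_ide2: "\<lbrakk>arr f; A \<in> Obj C; B \<in> Obj C; src f = A \<odot> B\<rbrakk> \<Longrightarrow> f oo (ide A ** ide B) = f"
  using cmp_ide[of f "A \<odot> B"] by simp
lemma cmp_ide3: "\<lbrakk>arr f; A \<in> Obj C; B \<in> Obj C; D \<in> Obj C; src f = A \<odot> B \<odot> D\<rbrakk>
  \<Longrightarrow> f oo (ide A ** ide B ** ide D) = f"
  using cmp_ide[of f "A \<odot> B \<odot> D"] by simp

text \<open>
  The opposite direction: a composite inside a tensor product with identities is spread over several
  layers.  An equation of diagrams is typically proved by spreading both sides with \<open>whisk\<close> and by
  exchanging neighbouring layers with equations that were obtained by \<open>merge\<close>.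
\<close>

lemma whiskL: "\<lbrakk>arr f; arr g; src f = trg g; A \<in> Obj C\<rbrakk> \<Longrightarrow> ide A ** (f oo g) = (ide A ** f) oo (ide A ** g)"
  by (simp add: interchange)
lemma whiskR: "\<lbrakk>arr f; arr g; src f = trg g; A \<in> Obj C\<rbrakk> \<Longrightarrow> (f oo g) ** ide A = (f ** ide A) oo (g ** ide A)"
  by (simp add: interchange)

lemma whiskR_2: "\<lbrakk>arr f; arr g; src f = trg g; A \<in> Obj C; B \<in> Obj C\<rbrakk>
  \<Longrightarrow> (f oo g) ** ide A ** ide B = (f ** ide A ** ide B) oo (g ** ide A ** ide B)"
  by (simp add: interchange)

lemmas whisk = whiskL whiskR whiskR_2

lemmas merge_pairs = ide2_cmp ide3_cmp cmp_ide2 cmp_ide3 cap_right_2  cup_right_2  interchange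
    interchange_2_1 interchange_1_2 
  cap_left cap_right cup_left cup_right

lemma cmp_rewrite: "f oo g = h \<Longrightarrow> f oo g oo z = h oo z"
  by (metis cmp_assoc)

lemmas merge_longer = merge_pairs[THEN cmp_rewrite]

lemmas merge = merge_pairs merge_longer[simplified]

end

section \<open>Duality and partial traces\<close>

context strict_pivotal_category
begin

lemmas [simp] = Dual_Obj Dual_Dual Dual_TensO

definition ev :: "'a \<Rightarrow> ('a, 'b) arrow" where
  "ev A = (if A \<in> Obj C then Arrow (Dual C A \<odot> A) (Ev C A) \<one> else Null)"

definition db :: "'a \<Rightarrow> ('a, 'b) arrow" where
  "db A = (if A \<in> Obj C then Arrow \<one> (Db C A) (A \<odot> Dual C A) else Null)"

lemma arr_ev [simp]: "arr (ev A) \<longleftrightarrow> A \<in> Obj C"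
  and src_ev [simp]: "A \<in> Obj C \<Longrightarrow> src (ev A) = Dual C A \<odot> A"
  and trg_ev [simp]: "A \<in> Obj C \<Longrightarrow> trg (ev A) = \<one>"
  and mor_ev [simp]: "A \<in> Obj C \<Longrightarrow> mor (ev A) = Ev C A"
  and arr_db [simp]: "arr (db A) \<longleftrightarrow> A \<in> Obj C"
  and src_db [simp]: "A \<in> Obj C \<Longrightarrow> src (db A) = \<one>"
  and trg_db [simp]: "A \<in> Obj C \<Longrightarrow> trg (db A) = A \<odot> Dual C A"
  and mor_db [simp]: "A \<in> Obj C \<Longrightarrow> mor (db A) = Db C A"
  by (auto simp: ev_def db_def Ev_Hom Db_Hom)

lemma Dual_Unit [simp]: "Dual C \<one> = \<one>"
  using Dual_TensO[of \<one> "Dual C \<one>"] by simp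

lemma snake: "A \<in> Obj C \<Longrightarrow> (ide A ** ev A) oo (db A ** ide A) = ide A"
  by (intro arrow_eqI) (auto simp: zigzag)

lemma snake_dual: "A \<in> Obj C \<Longrightarrow> (ev A ** ide (Dual C A)) oo (ide (Dual C A) ** db A) = ide (Dual C A)"
  by (intro arrow_eqI) (auto simp: zigzag_Dual)

definition dual :: "('a, 'b) arrow \<Rightarrow> ('a, 'b) arrow" where
  "dual f = ((ev (trg f) ** ide (Dual C (src f))) oo (ide (Dual C (trg f)) ** f ** ide (Dual C (src f))))
    oo (ide (Dual C (trg f)) ** db (src f))"

lemma dual_simps [simp]: "arr f \<Longrightarrow> arr (dual f)" "arr f \<Longrightarrow> src (dual f) = Dual C (trg f)"
  "arr f \<Longrightarrow> trg (dual f) = Dual C (src f)"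
  by (auto simp: dual_def)

lemma mor_dual: "arr f \<Longrightarrow> mor (dual f) = dual_mor C (src f) (trg f) (mor f)"
proof -
  assume f: "arr f"
  have "dual f = ((ev (trg f) ** ide (Dual C (src f)))
    oo ((ide (Dual C (trg f)) ** f) ** ide (Dual C (src f))))
    oo (ide (Dual C (trg f)) ** db (src f))" by (simp add: dual_def)
  also have "mor \<dots> = dual_mor C (src f) (trg f) (mor f)"
    unfolding dual_mor_def using f by (simp del: tns_assoc cmp_assoc)
  finally show ?thesis .
qed

lemma dual_involution [simp]: "arr f \<Longrightarrow> dual (dual f) = f"
  by (intro arrow_eqI) (auto simp: mor_dual dual_dual_mor arr_mor)

text \<open>
  A morphism on the right leg of a cap is pushed to its left leg, where it appears as its dual.  Cups
  behave in the same way, and the caps and cups of the opposite orientation are covered because strict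
  pivotality makes \<^const>\<open>dual\<close> an involution.
\<close>

lemma ev_slide: assumes "arr f" "src f = V" "trg f = W"
  shows "ev W oo (ide (Dual C W) ** f) = ev V oo (dual f ** ide V)"
proof -
  have [simp]: "V \<in> Obj C" "W \<in> Obj C" using assms by auto
  let ?V = "Dual C V" and ?W = "Dual C W"
  have 1: "ev V oo (ev W ** ide ?V ** ide V) oo (ide ?W ** f ** ide ?V ** ide V)
    = ev W oo (ide ?W ** f) oo (ide ?W ** ide V ** ev V)"
    using assms by (simp add: merge)
  have "ev V oo (dual f ** ide V) = (ev V oo (ev W ** ide ?V ** ide V) oo (ide ?W ** f ** ide ?V ** ide V))
     oo (ide ?W ** db V ** ide V)"
    using assms unfolding dual_def by (simp add: whisk)
  also have "\<dots> = (ev W oo (ide ?W ** f)) oo (ide ?W ** ((ide V ** ev V) oo (db V ** ide V)))"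
    unfolding 1 using assms by (simp add: interchange)
  also have "\<dots> = ev W oo (ide ?W ** f)"
    using assms by (simp add: snake cmp_ide2)
  finally show ?thesis by simp
qed

lemma db_slide: assumes "arr f" "src f = V" "trg f = W"
  shows "(f ** ide (Dual C V)) oo db V = (ide W ** dual f) oo db W"
proof -
  have [simp]: "V \<in> Obj C" "W \<in> Obj C" using assms by auto
  let ?V = "Dual C V" and ?W = "Dual C W"
  have 1: "(ide W ** ide ?W ** f ** ide ?V) oo (ide W ** ide ?W ** db V) oo db W
    = (db W ** ide W ** ide ?V) oo (f ** ide ?V) oo db V"
    using assms by (simp add: merge)
  have "(ide W ** dual f) oo db W = (ide W ** ev W ** ide ?V) oo (ide W ** ide ?W ** f ** ide ?V)
      oo (ide W ** ide ?W ** db V) oo db W"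
    using assms unfolding dual_def by (simp add: whisk)
  also have "\<dots> = (((ide W ** ev W) oo (db W ** ide W)) ** ide ?V) oo (f ** ide ?V) oo db V"
    unfolding 1 using assms by (simp add: whisk)
  also have "\<dots> = (f ** ide ?V) oo db V"
    using assms by (simp add: snake merge)
  finally show ?thesis by simp
qed

lemma evbar_slide: assumes "arr f" "src f = V" "trg f = W"
  shows "ev (Dual C W) oo (f ** ide (Dual C W)) = ev (Dual C V) oo (ide V ** dual f)"
  using ev_slide[of "dual f" "Dual C W" "Dual C V"] assms by (auto simp: )

lemma dbbar_slide: assumes "arr f" "src f = V" "trg f = W"
  shows "(ide (Dual C V) ** f) oo db (Dual C V) = (dual f ** ide W) oo db (Dual C W)"
  using db_slide[of "dual f" "Dual C W" "Dual C V"] assms by (auto simp: )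

text \<open>
  The partial traces of \<open>g: A \<otimes> B \<rightarrow> A \<otimes> B'\<close> over the left factor and of \<open>g: B \<otimes> A \<rightarrow> B' \<otimes> A\<close> over
  the right factor.
\<close>

definition ltrace :: "'a \<Rightarrow> 'a \<Rightarrow> 'a \<Rightarrow> ('a, 'b) arrow \<Rightarrow> ('a, 'b) arrow" where
  "ltrace A B B' g = (ev A ** ide B') oo (ide (Dual C A) ** g) oo (db (Dual C A) ** ide B)"

definition rtrace :: "'a \<Rightarrow> 'a \<Rightarrow> 'a \<Rightarrow> ('a, 'b) arrow \<Rightarrow> ('a, 'b) arrow" where
  "rtrace A B B' g = (ide B' ** ev (Dual C A)) oo (g ** ide (Dual C A)) oo (ide B ** db A)"

lemma ltrace_simps [simp]:
  assumes "A \<in> Obj C" "B \<in> Obj C" "B' \<in> Obj C" "arr g" "src g = A \<odot> B" "trg g = A \<odot> B'"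
  shows "arr (ltrace A B B' g)" "src (ltrace A B B' g) = B" "trg (ltrace A B B' g) = B'"
  using assms by (auto simp: ltrace_def)

lemma rtrace_simps [simp]:
  assumes "A \<in> Obj C" "B \<in> Obj C" "B' \<in> Obj C" "arr g" "src g = B \<odot> A" "trg g = B' \<odot> A"
  shows "arr (rtrace A B B' g)" "src (rtrace A B B' g) = B" "trg (rtrace A B B' g) = B'"
  using assms by (auto simp: rtrace_def)

text \<open>
  Cyclicity of the partial trace: \<open>a\<close> is pushed around the closed strand, and appears on it as the
  dual of \<open>a\<close> on the way.
\<close>

lemma ltrace_slide:
  assumes "arr a" "src a = A" "trg a = A'" "B \<in> Obj C" "B' \<in> Obj C"
    "arr g" "src g = A' \<odot> B" "trg g = A \<odot> B'"
  shows "ltrace A' B B' ((a ** ide B') oo g) = ltrace A B B' (g oo (a ** ide B))"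
proof -
  have [simp]: "A \<in> Obj C" "A' \<in> Obj C" using assms by auto
  let ?A = "Dual C A" and ?A' = "Dual C A'"
  have 1: "(dual a ** ide A ** ide B') oo (ide ?A' ** g) = (ide ?A ** g) oo (dual a ** ide A' ** ide B)"
    using assms by (simp add: merge)
  have "ltrace A' B B' ((a ** ide B') oo g)
    = ((ev A' oo (ide ?A' ** a)) ** ide B') oo (ide ?A' ** g) oo (db ?A' ** ide B)"
    using assms unfolding ltrace_def by (simp add: whisk)
  also have "\<dots> = (ev A ** ide B') oo (ide ?A ** g) oo (((dual a ** ide A') oo db ?A') ** ide B)"
    unfolding ev_slide[OF assms(1-3)] using assms by (simp add: whisk cmp_rewrite[OF 1])
  also have "\<dots> = ltrace A B B' (g oo (a ** ide B))"
    unfolding dbbar_slide[OF assms(1-3), symmetric] ltrace_def using assms by (simp add: whisk)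
  finally show ?thesis .
qed

lemma rtrace_slide:
  assumes "arr a" "src a = A" "trg a = A'" "B \<in> Obj C" "B' \<in> Obj C"
    "arr g" "src g = B \<odot> A'" "trg g = B' \<odot> A"
  shows "rtrace A' B B' ((ide B' ** a) oo g) = rtrace A B B' (g oo (ide B ** a))"
proof -
  have [simp]: "A \<in> Obj C" "A' \<in> Obj C" using assms by auto
  let ?A = "Dual C A" and ?A' = "Dual C A'"
  have 1: "(ide B' ** ide A ** dual a) oo (g ** ide ?A') = (g ** ide ?A) oo (ide B ** ide A' ** dual a)"
    using assms by (simp add: merge)
  have "rtrace A' B B' ((ide B' ** a) oo g)
    = (ide B' ** (ev ?A' oo (a ** ide ?A'))) oo (g ** ide ?A') oo (ide B ** db A')"
    using assms unfolding rtrace_def by (simp add: whisk)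
  also have "\<dots> = (ide B' ** ev ?A) oo (g ** ide ?A) oo (ide B ** ((ide A' ** dual a) oo db A'))"
    unfolding evbar_slide[OF assms(1-3)] using assms by (simp add: whisk cmp_rewrite[OF 1])
  also have "\<dots> = rtrace A B B' (g oo (ide B ** a))"
    unfolding db_slide[OF assms(1-3), symmetric] rtrace_def using assms by (simp add: whisk)
  finally show ?thesis .
qed

lemma ltrace_out:
  assumes "arr b" "src b = B" "trg b = B'" "arr b'" "src b' = D" "trg b' = D'" "A \<in> Obj C"
    "arr g" "src g = A \<odot> B'" "trg g = A \<odot> D"
  shows "ltrace A B D' ((ide A ** b') oo g oo (ide A ** b)) = b' oo ltrace A B' D g oo b"
proof -
  have [simp]: "B \<in> Obj C" "B' \<in> Obj C" "D \<in> Obj C" "D' \<in> Obj C" using assms by auto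
  let ?A = "Dual C A"
  have 1: "(ev A ** ide D') oo (ide ?A ** ide A ** b') = b' oo (ev A ** ide D)"
    using assms by (simp add: merge)
  have 2: "(ide ?A ** ide A ** b) oo (db ?A ** ide B) = (db ?A ** ide B') oo b"
    using assms by (simp add: merge)
  show ?thesis unfolding ltrace_def using assms
    by (simp add: whisk 2 cmp_rewrite[OF 1])
qed

lemma rtrace_out:
  assumes "arr b" "src b = B" "trg b = B'" "arr b'" "src b' = D" "trg b' = D'" "A \<in> Obj C"
    "arr g" "src g = B' \<odot> A" "trg g = D \<odot> A"
  shows "rtrace A B D' ((b' ** ide A) oo g oo (b ** ide A)) = b' oo rtrace A B' D g oo b"
proof -
  have [simp]: "B \<in> Obj C" "B' \<in> Obj C" "D \<in> Obj C" "D' \<in> Obj C" using assms by auto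
  let ?A = "Dual C A"
  have 1: "(ide D' ** ev ?A) oo (b' ** ide A ** ide ?A) = b' oo (ide D ** ev ?A)"
    using assms by (simp add: merge)
  have 2: "(b ** ide A ** ide ?A) oo (ide B ** db A) = (ide B' ** db A) oo b"
    using assms by (simp add: merge)
  show ?thesis unfolding rtrace_def using assms
    by (simp add: whisk 2 cmp_rewrite[OF 1])
qed

text \<open>
  The closed strand \<open>A\<close> leaves \<open>q\<close> on the right, returns downwards through the crossing \<open>t\<close> from right
  to left, and enters \<open>p\<close> on the left.  For \<open>A = V\<^bsup>m-l\<^esup>\<close> this is the part of \<open>FS\<close> between the
  partial traces over \<open>V\<^sup>k\<close> and \<open>V\<^sup>r\<close>.
\<close>

definition crossing_closure :: "'a \<Rightarrow> 'a \<Rightarrow> 'a \<Rightarrow> ('a, 'b) arrow \<Rightarrow> ('a, 'b) arrow \<Rightarrow> ('a, 'b) arrow \<Rightarrow> ('a, 'b) arrow" where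
  "crossing_closure A B B' q t p = (ide B' ** ev (Dual C A)) oo (q ** ide (Dual C A)) oo t
      oo (ide (Dual C A) ** p)
     oo (db (Dual C A) ** ide B)"

lemma crossing_closure_simps [simp]:
  assumes "A \<in> Obj C" "B \<in> Obj C" "B' \<in> Obj C" "arr p" "src p = A \<odot> B" "arr q" "trg q = B' \<odot> A"
    "arr t" "src t = Dual C A \<odot> trg p" "trg t = src q \<odot> Dual C A"
  shows "arr (crossing_closure A B B' q t p)" "src (crossing_closure A B B' q t p) = B"
      "trg (crossing_closure A B B' q t p) = B'"
  using assms by (auto simp: crossing_closure_def)

text \<open>
  Pushing \<open>a\<close> along the strand \<open>A\<close>: naturality of the crossing lets the dual of \<open>a\<close> pass through \<open>t\<close>.
\<close>

lemma crossing_closure_dinat: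
  assumes "arr a" "src a = A" "trg a = A'" "B \<in> Obj C" "B' \<in> Obj C"
    and "arr p" "src p = A' \<odot> B" "trg p = M" "arr q" "src q = N" "trg q = B' \<odot> A"
    and "arr t" "src t = Dual C A \<odot> M" "trg t = N \<odot> Dual C A"
    and "arr t'" "src t' = Dual C A' \<odot> M" "trg t' = N \<odot> Dual C A'"
    and nat: "(ide N ** dual a) oo t' = t oo (dual a ** ide M)"
  shows "crossing_closure A' B B' ((ide B' ** a) oo q) t' p
      = crossing_closure A B B' q t (p oo (a ** ide B))"
proof -
  have [simp]: "A \<in> Obj C" "A' \<in> Obj C" "M \<in> Obj C" "N \<in> Obj C" using assms by auto
  let ?A = "Dual C A" and ?A' = "Dual C A'"
  have 1: "(ide B' ** ide A ** dual a) oo (q ** ide ?A') = (q ** ide ?A) oo (ide N ** dual a)"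
    using assms(1-17) by (simp add: merge)
  have 2: "(ide ?A ** p) oo (dual a ** ide A' ** ide B) = (dual a ** ide M) oo (ide ?A' ** p)"
    using assms(1-17) by (simp add: merge)
  have "crossing_closure A' B B' ((ide B' ** a) oo q) t' p
    = (ide B' ** (ev ?A' oo (a ** ide ?A'))) oo (q ** ide ?A') oo t' oo (ide ?A' ** p) oo (db ?A' ** ide B)"
    using assms(1-17) unfolding crossing_closure_def by (simp add: whisk)
  also have "\<dots> = (ide B' ** ev ?A) oo (q ** ide ?A) oo ((ide N ** dual a) oo t') oo (ide ?A' ** p)
      oo (db ?A' ** ide B)"
    unfolding evbar_slide[OF assms(1-3)] using assms(1-17) by (simp add: whisk cmp_rewrite[OF 1])
  also have "\<dots> = (ide B' ** ev ?A) oo (q ** ide ?A) oo t oo (ide ?A ** p)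
      oo (((dual a ** ide A') oo db ?A') ** ide B)"
    unfolding nat using assms(1-17) by (simp add: whisk cmp_rewrite[OF 2])
  also have "\<dots> = crossing_closure A B B' q t (p oo (a ** ide B))"
    unfolding dbbar_slide[OF assms(1-3), symmetric] crossing_closure_def using assms(1-17)
      by (simp add: whisk)
  finally show ?thesis .
qed

lemma crossing_closure_out:
  assumes "arr b" "src b = B" "trg b = B'" "arr b'" "src b' = D" "trg b' = D'" "A \<in> Obj C"
    and "arr p" "src p = A \<odot> B'" "trg p = M" "arr q" "src q = N" "trg q = D \<odot> A"
    and "arr t" "src t = Dual C A \<odot> M" "trg t = N \<odot> Dual C A"
  shows "crossing_closure A B D' ((b' ** ide A) oo q) t (p oo (ide A ** b))
      = b' oo crossing_closure A B' D q t p oo b"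
proof -
  have [simp]: "B \<in> Obj C" "B' \<in> Obj C" "D \<in> Obj C" "D' \<in> Obj C" "M \<in> Obj C" "N \<in> Obj C"
    using assms by auto
  let ?A = "Dual C A"
  have 1: "(ide D' ** ev ?A) oo (b' ** ide A ** ide ?A) = b' oo (ide D ** ev ?A)"
    using assms by (simp add: merge)
  have 2: "(ide ?A ** ide A ** b) oo (db ?A ** ide B) = (db ?A ** ide B') oo b"
    using assms by (simp add: merge)
  show ?thesis unfolding crossing_closure_def using assms
    by (simp add: whisk 2 cmp_rewrite[OF 1])
qed

lemma crossing_closure_nat:
  assumes "arr x" "src x = M" "trg x = M'" "A \<in> Obj C" "B \<in> Obj C" "B' \<in> Obj C"
    and "arr p" "src p = A \<odot> B" "trg p = M" "arr q" "src q = M'" "trg q = B' \<odot> A"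
    and "arr t" "src t = Dual C A \<odot> M" "trg t = M \<odot> Dual C A"
    and "arr t'" "src t' = Dual C A \<odot> M'" "trg t' = M' \<odot> Dual C A"
    and nat: "t' oo (ide (Dual C A) ** x) = (x ** ide (Dual C A)) oo t"
  shows "crossing_closure A B B' q t' (x oo p) = crossing_closure A B B' (q oo x) t p"
  unfolding crossing_closure_def using assms(1-18)
  by (simp add: whisk cmp_rewrite[OF nat])

end

section \<open>Tensor powers and idempotents on a rotated strand\<close>

context strict_monoidal_linear_category
begin

definition opow :: "'a \<Rightarrow> nat \<Rightarrow> 'a" where "opow V n = (TensO C V ^^ n) \<one>"

lemma opow_0 [simp]: "opow V 0 = \<one>" by (simp add: opow_def)
lemma opow_Suc: "opow V (Suc n) = V \<odot> opow V n" by (simp add: opow_def)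
lemma opow_Obj [simp]: "V \<in> Obj C \<Longrightarrow> opow V n \<in> Obj C"
  by (induction n) (auto simp: opow_Suc)
lemma opow_add: "V \<in> Obj C \<Longrightarrow> opow V (a + b) = opow V a \<odot> opow V b"
  by (induction a) (auto simp: opow_Suc)
lemma opow_1 [simp]: "V \<in> Obj C \<Longrightarrow> opow V (Suc 0) = V"
  by (simp add: opow_Suc)
lemma opow_Suc_right: "V \<in> Obj C \<Longrightarrow> opow V (Suc n) = opow V n \<odot> V"
  using opow_add[of V n 1] by simp

primrec mprod :: "(nat \<Rightarrow> ('a, 'b) arrow) \<Rightarrow> nat \<Rightarrow> ('a, 'b) arrow" where
  "mprod F 0 = ide \<one>"
| "mprod F (Suc n) = mprod F n ** F n"

lemma mprod_cong: "(\<And>i. i < n \<Longrightarrow> F i = G i) \<Longrightarrow> mprod F n = mprod G n"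
  by (induction n) auto

lemma mprod_arr:
  assumes "V \<in> Obj C" "W \<in> Obj C" "\<And>i. i < n \<Longrightarrow> arr (F i)" "\<And>i. i < n \<Longrightarrow> src (F i) = V" "\<And>i. i < n
      \<Longrightarrow> trg (F i) = W"
  shows "arr (mprod F n) \<and> src (mprod F n) = opow V n \<and> trg (mprod F n) = opow W n"
  using assms(3-) by (induction n) (auto simp: opow_Suc_right assms(1,2))

lemma mprod_add: "(\<And>i. i < a + b \<Longrightarrow> arr (F i)) \<Longrightarrow> mprod F (a + b) = mprod F a ** mprod (\<lambda>i. F (a + i)) b"
proof (induction b)
  case 0
  have "arr (mprod F n)" if "n \<le> a" for n using that 0 by (induction n) auto
  then show ?case by simp
qed simp

lemma mprod_cmp:
  assumes "\<And>i. i < n \<Longrightarrow> arr (F i)" "\<And>i. i < n \<Longrightarrow> src (F i) = V" "\<And>i. i < n \<Longrightarrow> trg (F i) = W"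
   "\<And>i. i < n \<Longrightarrow> arr (G i)" "\<And>i. i < n \<Longrightarrow> src (G i) = U" "\<And>i. i < n \<Longrightarrow> trg (G i) = V"
   "U \<in> Obj C" "V \<in> Obj C" "W \<in> Obj C"
  shows "mprod F n oo mprod G n = mprod (\<lambda>i. F i oo G i) n"
  using assms(1-6)
proof (induction n)
  case (Suc n)
  have "arr (mprod F n) \<and> src (mprod F n) = opow V n \<and> trg (mprod F n) = opow W n"
    "arr (mprod G n) \<and> src (mprod G n) = opow U n \<and> trg (mprod G n) = opow V n"
    by (intro mprod_arr; use Suc.prems assms(7-) in simp)+
  then show ?case using Suc by (simp add: interchange)
qed simp

lemma mprod_ide: "V \<in> Obj C \<Longrightarrow> mprod (\<lambda>_. ide V) n = ide (opow V n)"
  by (induction n) (auto simp: opow_Suc_right)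

abbreviation mpow :: "('a, 'b) arrow \<Rightarrow> nat \<Rightarrow> ('a, 'b) arrow" where "mpow f \<equiv> mprod (\<lambda>_. f)"

lemma mpow_simps [simp]: "arr f \<Longrightarrow> arr (mpow f n)" "arr f \<Longrightarrow> src (mpow f n) = opow (src f) n"
  "arr f \<Longrightarrow> trg (mpow f n) = opow (trg f) n"
  using mprod_arr[of "src f" "trg f" n "\<lambda>_. f"] by auto

definition at_pos :: "('a, 'b) arrow \<Rightarrow> nat set \<Rightarrow> nat \<Rightarrow> ('a, 'b) arrow" where
  "at_pos e Q = mprod (\<lambda>i. if i \<in> Q then e else ide (src e))"

lemma at_pos_simps [simp]:
  assumes "arr e" "trg e = src e"
  shows "arr (at_pos e Q n)" "src (at_pos e Q n) = opow (src e) n" "trg (at_pos e Q n) = opow (src e) n"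
  using mprod_arr[of "src e" "src e" n "\<lambda>i. if i \<in> Q then e else ide (src e)"] assms
    by (auto simp: at_pos_def)

lemma at_pos_cmp:
  assumes "arr e" "trg e = src e" "e oo e = e"
  shows "at_pos e Q n oo at_pos e R n = at_pos e (Q \<union> R) n"
proof -
  have "at_pos e Q n oo at_pos e R n = mprod (\<lambda>i. (if i \<in> Q then e else ide (src e))
      oo (if i \<in> R then e else ide (src e))) n"
    unfolding at_pos_def by (rule mprod_cmp[where U="src e" and V="src e" and W="src e"]) (auto simp: assms)
  also have "\<dots> = at_pos e (Q \<union> R) n" unfolding at_pos_def by (rule mprod_cong) (auto simp: assms)
  finally show ?thesis .
qed

lemma at_pos_all: "{..<n} \<subseteq> Q \<Longrightarrow> at_pos e Q n = mpow e n"
  unfolding at_pos_def by (rule mprod_cong) auto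

lemma at_pos_left:
  assumes "arr e" "trg e = src e" "j < a"
  shows "at_pos e {j} (a + b) = at_pos e {j} a ** ide (opow (src e) b)"
proof -
  have "mprod (\<lambda>i. if a + i \<in> {j} then e else ide (src e)) b = mpow (ide (src e)) b"
    using assms by (intro mprod_cong) auto
  then show ?thesis using assms unfolding at_pos_def by (subst mprod_add) (auto simp: mprod_ide)
qed

lemma at_pos_right:
  assumes "arr e" "trg e = src e"
  shows "at_pos e {a + j} (a + b) = ide (opow (src e) a) ** at_pos e {j} b"
proof -
  have "mprod (\<lambda>i. if i \<in> {a + j} then e else ide (src e)) a = mpow (ide (src e)) a"
    using assms by (intro mprod_cong) auto
  moreover have "mprod (\<lambda>i. if a + i \<in> {a + j} then e else ide (src e)) b
      = mprod (\<lambda>i. if i \<in> {j} then e else ide (src e)) b"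
    by (intro mprod_cong) auto
  ultimately show ?thesis using assms unfolding at_pos_def by (subst mprod_add) (auto simp: mprod_ide)
qed

text \<open>
  Moving the first \<open>l\<close> of \<open>m\<close> tensor factors to the end moves the position \<open>j\<close> to
  \<open>(j + (m - l)) mod m\<close>.  The position is located relative to the two blocks before and after this
  rotation.
\<close>

lemma at_pos_rotation:
  assumes e: "arr e" "src e = W" "trg e = W" and l: "l \<le> m"
  shows "j < l \<Longrightarrow> at_pos e {j} m = at_pos e {j} l ** ide (opow W (m - l))"
    and "j < l \<Longrightarrow> at_pos e {(j + (m - l)) mod m} m = ide (opow W (m - l)) ** at_pos e {j} l"
    and "l \<le> j \<Longrightarrow> j < m \<Longrightarrow> at_pos e {j} m = ide (opow W l) ** at_pos e {j - l} (m - l)"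
    and "l \<le> j \<Longrightarrow> j < m \<Longrightarrow> at_pos e {(j + (m - l)) mod m} m = at_pos e {j - l} (m - l) ** ide (opow W l)"
proof -
  have W: "W \<in> Obj C" using e by auto
  have *: "l + (m - l) = m" "(m - l) + l = m" using l by auto
  show "at_pos e {j} m = at_pos e {j} l ** ide (opow W (m - l))" if "j < l"
    using at_pos_left[of e j l "m - l"] that * e by simp
  show "at_pos e {(j + (m - l)) mod m} m = ide (opow W (m - l)) ** at_pos e {j} l" if "j < l"
  proof -
    have "(j + (m - l)) mod m = (m - l) + j" using that l by simp
    then show ?thesis using at_pos_right[of e "m - l" j l] * e by simp
  qed
  show "at_pos e {j} m = ide (opow W l) ** at_pos e {j - l} (m - l)" if "l \<le> j" "j < m"
    using at_pos_right[of e l "j - l" "m - l"] * e that by simp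
  show "at_pos e {(j + (m - l)) mod m} m = at_pos e {j - l} (m - l) ** ide (opow W l)" if "l \<le> j" "j < m"
  proof -
    have "j + (m - l) = (j - l) + m" using that by simp
    then have "(j + (m - l)) mod m = j - l" using that by (simp only: mod_add_self2) simp
    then show ?thesis using at_pos_left[of e "j - l" "m - l" l] * e that by simp
  qed
qed

lemma at_pos_single:
  assumes "arr e" "src e = W" "trg e = W" "j < m"
  shows "at_pos e {j} m = ide (opow W j) ** e ** ide (opow W (m - Suc j))"
proof -
  have "at_pos e {0} (Suc b) = e ** ide (opow W b)" for b
    using at_pos_left[of e 0 1 b] assms by (simp add: at_pos_def)
  moreover have "j + Suc (m - Suc j) = m" using assms by simp
  ultimately show ?thesis using at_pos_right[of e j 0 "Suc (m - Suc j)"] assms by simp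
qed

lemma coprime_gap:
  fixes m l :: nat
  assumes "coprime m l" "l \<le> m"
  shows "coprime (m - l) m"
proof -
  have "gcd (m - l) m = gcd l (m - l)"
    using gcd_diff1_nat[of "m - l" m] assms(2) by (simp add: gcd.commute)
  also have "\<dots> = gcd m l" using gcd_diff1_nat[OF assms(2)] by (simp only: gcd.commute)
  finally show ?thesis using assms(1) by (simp only: coprime_iff_gcd_eq_1)
qed

text \<open>
  The steps \<open>i \<mapsto> i + d\<close> form a single cycle modulo \<open>m\<close>.  The step from \<open>k\<close> is not among the closure
  conditions, because it leads back to the point at which the set \<open>Q\<close> started.
\<close>

lemma rotation_closed:
  fixes m d k :: nat
  assumes "coprime d m" "k < m" "(k + d) mod m \<in> Q"
    and "\<And>i. i \<in> Q \<Longrightarrow> i < m \<Longrightarrow> i \<noteq> k \<Longrightarrow> (i + d) mod m \<in> Q"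
  shows "{..<m} \<subseteq> Q"
proof
  have *: "(k + Suc s * d) mod m \<in> Q" for s
  proof (induction s)
    case (Suc s)
    let ?i = "(k + Suc s * d) mod m"
    have "(?i + d) mod m \<in> Q"
      using assms(2-4) Suc by (cases "?i = k") auto
    then show ?case by (simp add: mod_simps ac_simps)
  qed (use assms in simp)
  fix j assume "j \<in> {..<m}" then have j: "j < m" by simp
  obtain x where x: "[d * x = 1] (mod m)" using cong_solve_coprime_nat[OF assms(1)] by auto
  \<comment> \<open>Modulo \<open>m\<close>, \<open>x\<close> steps advance by 1 and \<open>m\<close> steps do not advance; the latter are added to make the
    number \<open>Suc s\<close> of steps positive.\<close>
  define s where "s = x * (j + (m - k)) + (m - 1)"
  have "[k + Suc s * d = j] (mod m)"
  proof -
    have "k + Suc s * d = k + (d * x) * (j + (m - k)) + m * d"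
      using assms(2) by (simp add: s_def algebra_simps)
    also have "[\<dots> = k + 1 * (j + (m - k)) + 0] (mod m)"
      by (intro cong_add cong_mult x cong_refl) (simp add: cong_def)
    also have "k + 1 * (j + (m - k)) + 0 = j + m" using assms by simp
    also have "[j + m = j] (mod m)" by (simp add: cong_def)
    finally show ?thesis .
  qed
  then show "j \<in> Q" using *[of s] j by (simp add: cong_def)
qed

text \<open>
  If \<open>e\<close> sits in position \<open>i\<close> then it can be doubled, and one of the copies is carried by the
  hypothesis on \<open>\<phi>\<close> to position \<open>i + d\<close>.  So a largest set of positions that \<open>e\<close> can reach from
  \<open>k + d\<close> is closed under these steps, hence contains all positions.
\<close>

lemma idempotent_spreads:
  fixes \<phi> :: "('a, 'b) arrow \<Rightarrow> 'x"
  assumes e: "arr e" "src e = W" "trg e = W" "e oo e = e"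
    and "coprime d m" "k < m"
    and \<phi>: "\<And>i q. \<lbrakk>i < m; i \<noteq> k; arr q; src q = opow W m; trg q = opow W m\<rbrakk>
      \<Longrightarrow> \<phi> (at_pos e {i} m oo q) = \<phi> (q oo at_pos e {(i + d) mod m} m)"
  shows "\<phi> (at_pos e {(k + d) mod m} m) = \<phi> (mpow e m)"
proof -
  let ?P = "\<lambda>Q. Q \<subseteq> {..<m} \<and> (k + d) mod m \<in> Q \<and> \<phi> (at_pos e Q m) = \<phi> (at_pos e {(k + d) mod m} m)"
  have "?P {(k + d) mod m}" using assms(6) by auto
  moreover have "card Q < Suc m" if "?P Q" for Q
    using that card_mono[of "{..<m}" Q] by (auto simp: less_Suc_eq_le)
  ultimately obtain Q where Q: "?P Q" and max: "\<And>R. ?P R \<Longrightarrow> card R \<le> card Q"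
    using ex_has_greatest_nat[of ?P "{(k + d) mod m}" card "Suc m"] by blast
  have "(i + d) mod m \<in> Q" if i: "i \<in> Q" "i < m" "i \<noteq> k" for i
  proof (rule ccontr)
    assume n: "(i + d) mod m \<notin> Q"
    let ?R = "Q \<union> {(i + d) mod m}"
    have "\<phi> (at_pos e Q m) = \<phi> (at_pos e {i} m oo at_pos e Q m)"
      using i e by (simp add: at_pos_cmp insert_absorb)
    also have "\<dots> = \<phi> (at_pos e Q m oo at_pos e {(i + d) mod m} m)"
      using i e by (intro \<phi>) auto
    also have "\<dots> = \<phi> (at_pos e ?R m)" using e by (simp add: at_pos_cmp)
    finally have "?P ?R" using Q i by auto
    then have "card ?R \<le> card Q" by (rule max)
    moreover have "finite Q" using Q finite_subset by blast
    ultimately show False using n by simp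
  qed
  then have "{..<m} \<subseteq> Q" using rotation_closed[OF assms(5,6), of Q] Q by blast
  then show ?thesis using Q by (simp add: at_pos_all)
qed

end

context strict_pivotal_category
begin

lemma Dual_opow: "V \<in> Obj C \<Longrightarrow> Dual C (opow V n) = opow (Dual C V) n"
  by (induction n) (simp_all add: opow_Suc flip: opow_Suc_right)

text \<open>
  The properties of the coupon on which the sliding argument rests.
\<close>

definition natural_crossing :: "('a \<Rightarrow> 'a \<Rightarrow> ('a, 'b) arrow) \<Rightarrow> bool" where
  "natural_crossing T \<longleftrightarrow> (\<forall>N M. N \<in> Obj C \<longrightarrow> M \<in> Obj C \<longrightarrow> arr (T N M) \<and> src (T N M) = N \<odot> M \<and> trg (T N M)
      = M \<odot> N)
   \<and> (\<forall>a M. arr a \<longrightarrow> M \<in> Obj C \<longrightarrow> (ide M ** a) oo T (src a) M = T (trg a) M oo (a ** ide M))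
   \<and> (\<forall>x N. arr x \<longrightarrow> N \<in> Obj C \<longrightarrow> T N (trg x) oo (ide N ** x) = (x ** ide N) oo T N (src x))"

lemma natural_crossing_simps:
  assumes "natural_crossing T" "N \<in> Obj C" "M \<in> Obj C"
  shows "arr (T N M)" "src (T N M) = N \<odot> M" "trg (T N M) = M \<odot> N"
  using assms by (auto simp: natural_crossing_def)

lemma natural_crossing_left: "natural_crossing T \<Longrightarrow> arr a \<Longrightarrow> M \<in> Obj C
    \<Longrightarrow> (ide M ** a) oo T (src a) M = T (trg a) M oo (a ** ide M)"
  and natural_crossing_right: "natural_crossing T \<Longrightarrow> arr x \<Longrightarrow> N \<in> Obj C
      \<Longrightarrow> T N (trg x) oo (ide N ** x) = (x ** ide N) oo T N (src x)"
  by (auto simp: natural_crossing_def)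

text \<open>
  The crossing closure with an endomorphism \<open>q\<close> of \<open>M = A \<otimes> L = L \<otimes> A\<close> inserted above the crossing.
\<close>

definition coupon_closure where
  "coupon_closure T A L M q = crossing_closure A L L q (T (Dual C A) M) (ide M)"

context
  fixes T A L M
  assumes T: "natural_crossing T" and obj: "A \<in> Obj C" "L \<in> Obj C" and rot: "A \<odot> L = M" "L \<odot> A = M"
begin

lemma M_Obj: "M \<in> Obj C" using obj rot by auto

lemmas closure_typing = T obj rot M_Obj natural_crossing_simps

lemma coupon_closure_simps [simp]:
  assumes "arr q" "src q = M" "trg q = M"
  shows "arr (coupon_closure T A L M q)" "src (coupon_closure T A L M q) = L"
      "trg (coupon_closure T A L M q) = L"
  using assms by (simp_all add: coupon_closure_def closure_typing)

lemma coupon_closure_in: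
  assumes "arr x" "src x = M" "trg x = M" "arr q" "src q = M" "trg q = M"
  shows "coupon_closure T A L M (q oo x) = crossing_closure A L L q (T (Dual C A) M) x"
  using crossing_closure_nat[of x M M A L L "ide M" q "T (Dual C A) M"
      "T (Dual C A) M"] natural_crossing_right[of T x "Dual C A"] assms
  unfolding coupon_closure_def by (simp add: closure_typing)

lemma coupon_closure_slide:
  assumes "arr a" "src a = A" "trg a = A" "arr q" "src q = M" "trg q = M"
  shows "coupon_closure T A L M ((ide L ** a) oo q) = coupon_closure T A L M (q oo (a ** ide L))"
proof -
  have "coupon_closure T A L M ((ide L ** a) oo q)
      = crossing_closure A L L q (T (Dual C A) M) (ide M oo (a ** ide L))"
    unfolding coupon_closure_def
    by (rule crossing_closure_dinat[where M=M and N=M])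
        (use assms natural_crossing_left[of T "dual a" M] in \<open>simp_all add: closure_typing\<close>)
  then show ?thesis using assms by (subst coupon_closure_in) (simp_all add: closure_typing)
qed

lemma coupon_closure_out:
  assumes "arr b" "src b = L" "trg b = L" "arr b'" "src b' = L" "trg b' = L" "arr q" "src q = M" "trg q = M"
  shows "coupon_closure T A L M ((b' ** ide A) oo q oo (ide A ** b)) = b' oo coupon_closure T A L M q oo b"
proof -
  have "coupon_closure T A L M ((b' ** ide A) oo q oo (ide A ** b))
    = crossing_closure A L L ((b' ** ide A) oo q) (T (Dual C A) M) (ide M oo (ide A ** b))"
    using coupon_closure_in[of "ide A ** b" "(b' ** ide A) oo q"] assms by (simp add: closure_typing)
  also have "\<dots> = b' oo coupon_closure T A L M q oo b" unfolding coupon_closure_def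
    by (rule crossing_closure_out[where M=M and N=M]) (use assms in \<open>simp_all add: closure_typing\<close>)
  finally show ?thesis .
qed

lemma coupon_closure_out_l:
  assumes "arr b'" "src b' = L" "trg b' = L" "arr q" "src q = M" "trg q = M"
  shows "coupon_closure T A L M ((b' ** ide A) oo q) = b' oo coupon_closure T A L M q"
  using coupon_closure_out[of "ide L" b' q] assms by (simp add: closure_typing flip: ide_tns)

lemma coupon_closure_out_r:
  assumes "arr b" "src b = L" "trg b = L" "arr q" "src q = M" "trg q = M"
  shows "coupon_closure T A L M (q oo (ide A ** b)) = coupon_closure T A L M q oo b"
  using coupon_closure_out[of b "ide L" q] assms by (simp add: closure_typing flip: ide_tns)

end

text \<open>
  The morphism \<open>pM\<close> is moved below the crossing, where it splits as \<open>pA \<otimes> pL\<close>, while \<open>iM\<close> splits as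
  \<open>iL \<otimes> iA\<close> above.  The factors \<open>iL\<close> and \<open>pL\<close> leave the diagram, and \<open>iA\<close> travels along the closed
  strand until it cancels with \<open>pA\<close>.
\<close>

lemma coupon_closure_split:
  assumes T: "natural_crossing T" and obj: "A \<in> Obj C" "L \<in> Obj C" "A' \<in> Obj C" "L' \<in> Obj C"
    and rot: "A \<odot> L = M" "L \<odot> A = M" "A' \<odot> L' = M'" "L' \<odot> A' = M'"
    and a: "arr iA" "src iA = A" "trg iA = A'" "arr pA" "src pA = A'" "trg pA = A" "pA oo iA = ide A"
    and l: "arr iL" "src iL = L" "trg iL = L'" "arr pL" "src pL = L'" "trg pL = L"
    and iM: "iL ** iA = iM" and pM: "pA ** pL = pM"
  shows "coupon_closure T A' L' M' (iM oo pM) = iL oo coupon_closure T A L M (ide M) oo pL"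
proof -
  have M: "M \<in> Obj C" "M' \<in> Obj C" using obj rot by auto
  have i: "arr iM" "src iM = M" "trg iM = M'" "arr pM" "src pM = M'" "trg pM = M"
    using a l rot unfolding iM[symmetric] pM[symmetric] by auto
  note facts = obj rot M a l i natural_crossing_simps[OF T]
  have 1: "iM = (iL ** ide A') oo (ide L ** iA)" "pM = (pA ** ide L) oo (ide A' ** pL)"
    unfolding iM[symmetric] pM[symmetric] by (simp_all add: facts interchange)
  have 2: "ide M oo (pA ** ide L) oo (iA ** ide L) = ide M"
    by (simp add: facts interchange flip: ide_tns)
  have 3: "(ide L ** iA) oo ide M = ide L ** iA" by (simp add: facts)
  have "coupon_closure T A' L' M' (iM oo pM) = crossing_closure A' L' L' iM (T (Dual C A') M) pM"
    using crossing_closure_nat[of pM M' M A' L' L' "ide M'" iM "T (Dual C A') M'" "T (Dual C A') M"]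
      natural_crossing_right[OF T, of pM "Dual C A'"] unfolding coupon_closure_def by (simp add: facts)
  also have "\<dots> = crossing_closure A' L' L' ((iL ** ide A')
      oo (ide L ** iA)) (T (Dual C A') M) ((pA ** ide L) oo (ide A' ** pL))"
    by (simp only: 1)
  also have "\<dots> = iL oo crossing_closure A' L L (ide L ** iA) (T (Dual C A') M) (pA ** ide L) oo pL"
    by (rule crossing_closure_out[where M=M and N=M]) (simp_all add: facts)
  also have "crossing_closure A' L L (ide L ** iA) (T (Dual C A') M) (pA ** ide L)
     = crossing_closure A' L L ((ide L ** iA) oo ide M) (T (Dual C A') M) (pA ** ide L)" by (simp only: 3)
  also have "\<dots> = crossing_closure A L L (ide M) (T (Dual C A) M) ((pA ** ide L) oo (iA ** ide L))"
    by (rule crossing_closure_dinat[where M=M and N=M]) (use natural_crossing_left[OF T, of "dual iA" M]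
        in \<open>simp_all add: facts\<close>)
  also have "(pA ** ide L) oo (iA ** ide L) = ide M"
    by (simp add: facts interchange flip: ide_tns)
  finally show ?thesis by (simp add: coupon_closure_def)
qed

definition midtrace where "midtrace K V R g = ltrace K V V (rtrace R (K \<odot> V) (K \<odot> V) g)"

lemma midtrace_simps [simp]:
  assumes "K \<in> Obj C" "V \<in> Obj C" "R \<in> Obj C" "arr g" "src g = K \<odot> V \<odot> R" "trg g = K \<odot> V \<odot> R"
  shows "arr (midtrace K V R g)" "src (midtrace K V R g) = V" "trg (midtrace K V R g) = V"
  using assms by (auto simp: midtrace_def)

lemma midtrace_split:
  assumes k: "arr iK" "src iK = K" "trg iK = K'" "arr pK" "src pK = K'" "trg pK = K" "pK oo iK = ide K"
    and r: "arr iR" "src iR = R" "trg iR = R'" "arr pR" "src pR = R'" "trg pR = R" "pR oo iR = ide R"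
    and i: "arr i" "src i = V" "trg i = V'" "arr p" "src p = V'" "trg p = V"
    and g: "arr g" "src g = K \<odot> V \<odot> R" "trg g = K \<odot> V \<odot> R"
  shows "midtrace K' V' R' ((iK ** i ** iR) oo g oo (pK ** p ** pR)) = i oo midtrace K V R g oo p"
proof -
  have obj: "K \<in> Obj C" "V \<in> Obj C" "R \<in> Obj C" "K' \<in> Obj C" "V' \<in> Obj C" "R' \<in> Obj C"
    using arr_Obj[OF k(1), unfolded k(2,3)] arr_Obj[OF r(1), unfolded r(2,3)]
        arr_Obj[OF i(1), unfolded i(2,3)] by blast+
  note facts = k r i g obj
  let ?h = "rtrace R (K \<odot> V) (K \<odot> V) g"
  let ?g = "(ide (K \<odot> V) ** iR) oo g oo (ide (K \<odot> V) ** pR)"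
  have 1: "g oo (ide K ** ide V ** pR) oo (ide K ** ide V ** iR) = g"
    by (simp add: facts interchange cmp_ide3)
  have 2: "?h oo (pK ** ide V) oo (iK ** ide V) = ?h"
    by (simp add: facts interchange cmp_ide2)
  have "(iK ** i ** iR) oo g oo (pK ** p ** pR) = ((iK ** i) ** ide R') oo ?g oo ((pK ** p) ** ide R')"
    by (simp add: facts interchange cmp_rewrite[OF interchange] ide_cmp cmp_ide)
  then have "rtrace R' (K' \<odot> V') (K' \<odot> V') ((iK ** i ** iR) oo g oo (pK ** p ** pR))
    = (iK ** i) oo rtrace R' (K \<odot> V) (K \<odot> V) ?g oo (pK ** p)"
    using rtrace_out[of "pK ** p" "K' \<odot> V'" "K \<odot> V" "iK ** i" "K \<odot> V" "K' \<odot> V'" R' ?g] by (simp add: facts)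
  also have "rtrace R' (K \<odot> V) (K \<odot> V) ?g = ?h"
    using rtrace_slide[of iR R R' "K \<odot> V" "K \<odot> V" "g oo (ide (K \<odot> V) ** pR)"] by (simp add: facts 1)
  also have "(iK ** i) oo ?h oo (pK ** p) = (ide K' ** i) oo ((iK ** ide V) oo ?h oo (pK ** ide V))
      oo (ide K' ** p)"
    by (simp add: facts interchange cmp_rewrite[OF interchange])
  finally have "midtrace K' V' R' ((iK ** i ** iR) oo g oo (pK ** p ** pR))
    = ltrace K' V' V' ((ide K' ** i) oo ((iK ** ide V) oo ?h oo (pK ** ide V)) oo (ide K' ** p))"
    by (simp only: midtrace_def)
  also have "\<dots> = i oo ltrace K' V V ((iK ** ide V) oo ?h oo (pK ** ide V)) oo p"
    using ltrace_out[of p V' V i V V' K' "(iK ** ide V) oo ?h oo (pK ** ide V)"] by (simp add: facts)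
  also have "ltrace K' V V ((iK ** ide V) oo ?h oo (pK ** ide V)) = ltrace K V V ?h"
    using ltrace_slide[of iK K K' V V "?h oo (pK ** ide V)"] by (simp add: facts 2)
  finally show ?thesis by (simp add: midtrace_def)
qed

lemma midtrace_slide_K:
  assumes "arr x" "src x = K" "trg x = K" "V \<in> Obj C" "R \<in> Obj C"
    and g: "arr g" "src g = K \<odot> V \<odot> R" "trg g = K \<odot> V \<odot> R"
  shows "midtrace K V R ((x ** ide V ** ide R) oo g) = midtrace K V R (g oo (x ** ide V ** ide R))"
proof -
  have [simp]: "K \<in> Obj C" using assms by auto
  show ?thesis unfolding midtrace_def
    using rtrace_out[of "ide (K \<odot> V)" "K \<odot> V" "K \<odot> V" "x ** ide V" "K \<odot> V" "K \<odot> V" R g]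
      rtrace_out[of "x ** ide V" "K \<odot> V" "K \<odot> V" "ide (K \<odot> V)" "K \<odot> V" "K \<odot> V" R g]
      ltrace_slide[of x K K V V "rtrace R (K \<odot> V) (K \<odot> V) g"] assms
    by (simp add: ide2_cmp ide3_cmp cmp_ide2 cmp_ide3)
qed

lemma midtrace_slide_R:
  assumes "arr x" "src x = R" "trg x = R" "V \<in> Obj C" "K \<in> Obj C"
    and g: "arr g" "src g = K \<odot> V \<odot> R" "trg g = K \<odot> V \<odot> R"
  shows "midtrace K V R ((ide K ** ide V ** x) oo g) = midtrace K V R (g oo (ide K ** ide V ** x))"
  unfolding midtrace_def
  using rtrace_slide[of x R R "K \<odot> V" "K \<odot> V" g] assms by simp

lemma midtrace_in:
  assumes "arr b" "src b = V" "trg b = V" "R \<in> Obj C" "K \<in> Obj C"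
    and g: "arr g" "src g = K \<odot> V \<odot> R" "trg g = K \<odot> V \<odot> R"
  shows "midtrace K V R (g oo (ide K ** b ** ide R)) = midtrace K V R g oo b"
  using midtrace_split[of "ide K" K K "ide K" "ide R" R R "ide R" "ide V" V V b g] assms
  by (auto simp: ide3_cmp)

end

section \<open>The endomorphism of a natural crossing\<close>

context strict_pivotal_category
begin

text \<open>
  The diagram of \<^const>\<open>FS\<close> for an arbitrary crossing \<open>T\<close>, with \<open>q\<close> inserted above the crossing.
\<close>

definition FS_arrow where
  "FS_arrow T m k r V q = midtrace (opow V k) V (opow V r) (coupon_closure T (opow V (m - (k + r
      + 1))) (opow V k \<odot> V \<odot> opow V r) (opow V m) q)"

lemma opow_factors:
  assumes "V \<in> Obj C"
  shows "opow V (k + r + 1) = opow V k \<odot> V \<odot> opow V r"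
  using opow_add[OF assms, of k "r + 1"] assms by (simp add: opow_Suc)

context
  fixes T and m k r :: nat
  assumes T: "natural_crossing T" and m: "k + r + 1 \<le> m"
begin

abbreviation "gap \<equiv> m - (k + r + 1)"

lemma FS_objects: assumes "V \<in> Obj C"
  shows "opow V gap \<odot> (opow V k \<odot> V \<odot> opow V r) = opow V m"
      "(opow V k \<odot> V \<odot> opow V r) \<odot> opow V gap = opow V m"
proof -
  have "gap + (k + r + 1) = m" "(k + r + 1) + gap = m" using m by auto
  then show "opow V gap \<odot> (opow V k \<odot> V \<odot> opow V r) = opow V m"
      "(opow V k \<odot> V \<odot> opow V r) \<odot> opow V gap = opow V m"
    using opow_factors[OF assms, of k r] opow_add[OF assms, of gap "k+r+1"]
        opow_add[OF assms, of "k+r+1" gap] by auto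
qed

lemma coupon_closure_ok:
  assumes "V \<in> Obj C" "arr q" "src q = opow V m" "trg q = opow V m"
  shows "arr (coupon_closure T (opow V gap) (opow V k \<odot> V \<odot> opow V r) (opow V m) q)"
    "src (coupon_closure T (opow V gap) (opow V k \<odot> V \<odot> opow V r) (opow V m) q) = opow V k \<odot> V \<odot> opow V r"
    "trg (coupon_closure T (opow V gap) (opow V k \<odot> V \<odot> opow V r) (opow V m) q) = opow V k \<odot> V \<odot> opow V r"
  using coupon_closure_simps[OF T _ _ FS_objects, of V q] assms by simp_all

lemma FS_arrow_simps [simp]:
  assumes "V \<in> Obj C" "arr q" "src q = opow V m" "trg q = opow V m"
  shows "arr (FS_arrow T m k r V q)" "src (FS_arrow T m k r V q) = V" "trg (FS_arrow T m k r V q) = V"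
  using coupon_closure_ok[OF assms] assms unfolding FS_arrow_def by simp_all

lemma at_pos_pos:
  assumes e: "arr e" "src e = W" "trg e = W"
  shows "j < k + r + 1 \<Longrightarrow> at_pos e {j} m = at_pos e {j} (k + r + 1) ** ide (opow W gap)"
    and "j < k + r + 1 \<Longrightarrow> at_pos e {(j + gap) mod m} m = ide (opow W gap) ** at_pos e {j} (k + r + 1)"
    and "k + r + 1 \<le> j \<Longrightarrow> j < m \<Longrightarrow> at_pos e {j} m
        = ide (opow W k \<odot> W \<odot> opow W r) ** at_pos e {j - (k + r + 1)} gap"
    and "k + r + 1 \<le> j \<Longrightarrow> j < m \<Longrightarrow> at_pos e {(j + gap) mod m} m
        = at_pos e {j - (k + r + 1)} gap ** ide (opow W k \<odot> W \<odot> opow W r)"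
    and "j < k \<Longrightarrow> at_pos e {j} (k + r + 1) = at_pos e {j} k ** ide W ** ide (opow W r)"
    and "at_pos e {k} (k + r + 1) = ide (opow W k) ** e ** ide (opow W r)"
    and "k < j \<Longrightarrow> j < k + r + 1 \<Longrightarrow> at_pos e {j} (k + r + 1)
        = ide (opow W k) ** ide W ** at_pos e {j - (k + 1)} r"
proof -
  have W: "W \<in> Obj C" using e by auto
  note rots = at_pos_rotation[OF e m, of j] and L = opow_factors[OF W, of k r]
  show "at_pos e {j} m = at_pos e {j} (k + r + 1) ** ide (opow W gap)" if "j < k + r + 1"
    by (rule rots(1)[OF that])
  show "at_pos e {(j + gap) mod m} m = ide (opow W gap) ** at_pos e {j} (k + r + 1)" if "j < k + r + 1"
    by (rule rots(2)[OF that])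
  show "at_pos e {j} m = ide (opow W k \<odot> W \<odot> opow W r) ** at_pos e {j - (k + r + 1)} gap"
    if "k + r + 1 \<le> j" "j < m"
    using rots(3)[OF that] unfolding L .
  show "at_pos e {(j + gap) mod m} m = at_pos e {j - (k + r + 1)} gap ** ide (opow W k \<odot> W \<odot> opow W r)"
    if "k + r + 1 \<le> j" "j < m"
    using rots(4)[OF that] unfolding L .
  show "at_pos e {j} (k + r + 1) = at_pos e {j} k ** ide W ** ide (opow W r)" if "j < k"
    using at_pos_left[of e j k "r+1"] that e W by (simp add: opow_Suc)
  show "at_pos e {k} (k + r + 1) = ide (opow W k) ** e ** ide (opow W r)"
    using at_pos_single[OF e, of k "k + r + 1"] by simp
  show "at_pos e {j} (k + r + 1) = ide (opow W k) ** ide W ** at_pos e {j - (k + 1)} r"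
    if "k < j" "j < k + r + 1"
    using at_pos_right[of e "k + 1" "j - (k+1)" r] that e W by (simp add: opow_Suc_right)
qed

text \<open>
  The strand that leaves the coupon in position \<open>j\<close> returns to it in position \<open>j + (m - l)\<close> modulo
  \<open>m\<close>: for \<open>j < k\<close> it is closed on the left, for \<open>k < j < l\<close> on the right, and for \<open>j \<ge> l\<close> it passes
  through the crossing.
\<close>

lemma FS_arrow_slide:
  assumes e: "arr e" "src e = W" "trg e = W" and j: "j < m" "j \<noteq> k"
    and q: "arr q" "src q = opow W m" "trg q = opow W m"
  shows "FS_arrow T m k r W (at_pos e {j} m oo q) = FS_arrow T m k r W (q oo at_pos e {(j + gap) mod m} m)"
proof -
  have W: "W \<in> Obj C" using e by auto
  let ?L = "opow W k \<odot> W \<odot> opow W r"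
  have at_pos: "arr (at_pos e Q n)" "src (at_pos e Q n) = opow W n" "trg (at_pos e Q n) = opow W n" for Q n
    using e at_pos_simps[of e Q n] by auto
  note coupon_closure = coupon_closure_ok[OF W q]
  show ?thesis
  proof (cases "k + r + 1 \<le> j")
    case True
    then show ?thesis unfolding FS_arrow_def at_pos_pos(3)[OF e True j(1)] at_pos_pos(4)[OF e True j(1)]
      using coupon_closure_slide[OF T _ _ FS_objects[OF W], of "at_pos e {j - (k + r + 1)} gap" q]
          at_pos q W
      by simp
  next
    case False
    then have jl: "j < k + r + 1" by simp
    let ?x = "at_pos e {j} (k + r + 1)"
    have 1: "coupon_closure T (opow W gap) ?L (opow W m) ((?x ** ide (opow W gap)) oo q)
        = ?x oo coupon_closure T (opow W gap) ?L (opow W m) q"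
      using coupon_closure_out_l[OF T _ _ FS_objects[OF W], of ?x q]
          at_pos q W opow_factors[OF W, of k r] by simp
    have 2: "coupon_closure T (opow W gap) ?L (opow W m) (q oo (ide (opow W gap) ** ?x))
        = coupon_closure T (opow W gap) ?L (opow W m) q oo ?x"
      using coupon_closure_out_r[OF T _ _ FS_objects[OF W], of ?x q]
          at_pos q W opow_factors[OF W, of k r] by simp
    show ?thesis
    proof (cases "j < k")
      case True
      show ?thesis unfolding FS_arrow_def at_pos_pos(1)[OF e jl] at_pos_pos(2)[OF e jl] 1 2
        unfolding at_pos_pos(5)[OF e True]
        by (rule midtrace_slide_K) (use at_pos W coupon_closure in simp_all)
    next
      case False
      then have kj: "k < j" using j by simp
      show ?thesis unfolding FS_arrow_def at_pos_pos(1)[OF e jl] at_pos_pos(2)[OF e jl] 1 2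
        unfolding at_pos_pos(7)[OF e kj jl]
        by (rule midtrace_slide_R) (use at_pos W coupon_closure in simp_all)
    qed
  qed
qed

text \<open>
  The lower end of the open strand enters the coupon in position \<open>k + (m - l)\<close>.
\<close>

lemma FS_arrow_in:
  assumes e: "arr e" "src e = W" "trg e = W"
    and q: "arr q" "src q = opow W m" "trg q = opow W m"
  shows "FS_arrow T m k r W (q oo at_pos e {(k + gap) mod m} m) = FS_arrow T m k r W q oo e"
proof -
  have W: "W \<in> Obj C" using e by auto
  let ?L = "opow W k \<odot> W \<odot> opow W r" and ?x = "at_pos e {k} (k + r + 1)"
  have at_pos: "arr (at_pos e Q n)" "src (at_pos e Q n) = opow W n" "trg (at_pos e Q n) = opow W n" for Q n
    using e at_pos_simps[of e Q n] by auto
  have kl: "k < k + r + 1" by simp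
  have 2: "coupon_closure T (opow W gap) ?L (opow W m) (q oo (ide (opow W gap) ** ?x))
      = coupon_closure T (opow W gap) ?L (opow W m) q oo ?x"
    using coupon_closure_out_r[OF T _ _ FS_objects[OF W], of ?x q] at_pos q W opow_factors[OF W, of k r]
      by simp
  show ?thesis unfolding FS_arrow_def at_pos_pos(2)[OF e kl] 2 unfolding at_pos_pos(6)[OF e]
    by (rule midtrace_in) (use e W coupon_closure_ok[OF W q] in simp_all)
qed

lemma mpow_factors: "arr f \<Longrightarrow> mpow f (k + r + 1) = mpow f k ** f ** mpow f r"
  using mprod_add[of k "1 + r" "\<lambda>_. f"] mprod_add[of 1 r "\<lambda>_. f"] by simp

lemma FS_arrow_split:
  assumes i: "arr i" "src i = V" "trg i = W" and p: "arr p" "src p = W" "trg p = V"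
    and pi: "p oo i = ide V"
  shows "FS_arrow T m k r W (mpow (i oo p) m) = i oo FS_arrow T m k r V (ide (opow V m)) oo p"
proof -
  have V: "V \<in> Obj C" and W: "W \<in> Obj C" using i by auto
  have pin: "mpow p n oo mpow i n = ide (opow V n)" for n
    using mprod_cmp[of n "\<lambda>_. p" V W "\<lambda>_. i" W] mprod_cmp[of n "\<lambda>_. p" W V "\<lambda>_. i" V]
        i p V W pi mprod_ide[OF V, of n] by simp
  have ipn: "mpow (i oo p) m = mpow i m oo mpow p m"
    using mprod_cmp[of m "\<lambda>_. i" V W "\<lambda>_. p" W] i p V W by simp
  have *: "(k + r + 1) + gap = m" "gap + (k + r + 1) = m" using m by auto
  have l: "mpow f (k + r + 1) ** mpow f gap = mpow f m" "mpow f gap ** mpow f (k + r + 1) = mpow f m"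
    if "arr f" for f
    using mprod_add[of "k + r + 1" gap "\<lambda>_. f"] mprod_add[of gap "k + r + 1" "\<lambda>_. f"] that unfolding *
      by auto
  have "coupon_closure T (opow W gap) (opow W k \<odot> W \<odot> opow W r) (opow W m) (mpow i m oo mpow p m)
    = mpow i (k + r + 1) oo coupon_closure T (opow V gap) (opow V k \<odot> V \<odot> opow V r) (opow V m) (ide (opow V m)) oo mpow p (k + r + 1)"
    by (rule coupon_closure_split[OF T _ _ _ _ FS_objects[OF V] FS_objects[OF W], where iA="mpow i gap"
        and pA="mpow p gap"])
      (use l i p V W pin in \<open>simp_all del: ide_tns mprod.simps add: opow_factors[simplified]\<close>)
  then show ?thesis
    unfolding FS_arrow_def ipn mpow_factors[OF i(1)] mpow_factors[OF p(1)]
    by (simp only:) (rule midtrace_split; use i p V W pin coupon_closure_ok[OF V, of "ide (opow V m)"]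
        in simp)
qed

text \<open>
  The idempotent \<open>i \<cdot> p\<close> at the lower end of the strand spreads to all positions, and then everything
  except its outermost factors \<open>i\<close> and \<open>p\<close> restricts to \<open>V\<close>.
\<close>

lemma FS_arrow_natural_split_mono:
  assumes "coprime m (k + r + 1)"
    and i: "arr i" "src i = V" "trg i = W" and p: "arr p" "src p = W" "trg p = V"
    and pi: "p oo i = ide V"
  shows "FS_arrow T m k r W (ide (opow W m)) oo i = i oo FS_arrow T m k r V (ide (opow V m))"
proof -
  have V: "V \<in> Obj C" and W: "W \<in> Obj C" using i by auto
  let ?e = "i oo p"
  have e: "arr ?e" "src ?e = W" "trg ?e = W" using i p by auto
  have idem: "?e oo ?e = ?e" using pi i p by (simp add: cmp_rewrite[OF pi])
  have "coprime gap m" by (rule coprime_gap[OF assms(1) m])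
  have "FS_arrow T m k r W (ide (opow W m)) oo ?e = FS_arrow T m k r W (at_pos ?e {(k + gap) mod m} m)"
    using FS_arrow_in[OF e, of "ide (opow W m)"] W e by simp
  also have "\<dots> = FS_arrow T m k r W (mpow ?e m)"
    using idempotent_spreads[OF e idem \<open>coprime gap m\<close>, of k "FS_arrow T m k r W"]
        m FS_arrow_slide[OF e] by auto
  also have "\<dots> = i oo FS_arrow T m k r V (ide (opow V m)) oo p" by (rule FS_arrow_split[OF i p pi])
  finally have "(FS_arrow T m k r W (ide (opow W m)) oo ?e) oo i
      = (i oo FS_arrow T m k r V (ide (opow V m)) oo p) oo i" by simp
  then show ?thesis using i p V W by (simp add: pi)
qed

end
end

section \<open>Duality as a contravariant monoidal functor\<close>

context strict_pivotal_category
begin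

lemma ev_cancel_left:
  assumes "arr f" "arr g" "src f = U" "src g = U" "trg f = Dual C V" "trg g = Dual C V" "V \<in> Obj C"
    and eq: "ev V oo (f ** ide V) = ev V oo (g ** ide V)"
  shows "f = g"
proof -
  have U: "U \<in> Obj C" using assms by auto
  let ?V = "Dual C V"
  have *: "h = ((ev V oo (h ** ide V)) ** ide ?V) oo (ide U ** db V)"
    if "arr h" "src h = U" "trg h = ?V" for h
  proof -
    have 1: "(h ** ide V ** ide ?V) oo (ide U ** db V) = (ide ?V ** db V) oo h"
      using that U assms(7) by (simp add: merge)
    show ?thesis using that U assms(7) by (simp add: whisk 1 cmp_rewrite[OF snake_dual])
  qed
  show ?thesis using *[of f] *[of g] assms by metis
qed

lemma ev_cancel_right:
  assumes f: "arr f" "src f = U" "trg f = V" and g: "arr g" "src g = U" "trg g = V"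
    and eq: "ev V oo (ide (Dual C V) ** f) = ev V oo (ide (Dual C V) ** g)"
  shows "f = g"
proof -
  have "dual f = dual g"
  proof (rule ev_cancel_left[of _ _ "Dual C V" U])
    show "U \<in> Obj C" using arr_Obj(1)[OF f(1)] f(2) by simp
    show "ev U oo (dual f ** ide U) = ev U oo (dual g ** ide U)"
      unfolding ev_slide[OF f, symmetric] ev_slide[OF g, symmetric] by (rule eq)
  qed (use f g in simp_all)
  then show ?thesis by (metis dual_involution f(1) g(1))
qed

lemma dual_ide [simp]: "A \<in> Obj C \<Longrightarrow> dual (ide A) = ide (Dual C A)"
  by (simp add: dual_def snake_dual cmp_ide3 ide3_cmp ide_cmp')

lemma dual_cmp:
  assumes f: "arr f" "src f = V" "trg f = W" and g: "arr g" "src g = U" "trg g = V"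
  shows "dual (f oo g) = dual g oo dual f"
proof (rule ev_cancel_left[of _ _ "Dual C W" U])
  show U: "U \<in> Obj C" using arr_Obj(1)[OF g(1)] g(2) by simp
  have V: "V \<in> Obj C" "W \<in> Obj C" using arr_Obj[OF f(1)] f(2,3) by simp_all
  have 1: "(ide (Dual C V) ** g) oo (dual f ** ide U) = (dual f ** ide V) oo (ide (Dual C W) ** g)"
    using f g U V by (simp add: merge)
  have "ev U oo ((dual g oo dual f) ** ide U) = (ev U oo (dual g ** ide U)) oo (dual f ** ide U)"
    using f g U V by (simp add: whisk)
  also have "\<dots> = (ev V oo (dual f ** ide V)) oo (ide (Dual C W) ** g)"
    unfolding ev_slide[OF g, symmetric] by (simp add: 1)
  also have "\<dots> = ev W oo (ide (Dual C W) ** (f oo g))"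
    unfolding ev_slide[OF f, symmetric] using f g U V by (simp add: whisk)
  also have "\<dots> = ev U oo (dual (f oo g) ** ide U)"
    using f g by (intro ev_slide) simp_all
  finally show "ev U oo (dual (f oo g) ** ide U) = ev U oo ((dual g oo dual f) ** ide U)" by (rule sym)
qed (use f g in simp_all)

text \<open>
  A cap and a cup that stand side by side commute, as each of them has an empty end.
\<close>

lemma cap_cup_commute: "\<lbrakk>arr e; arr d; trg e = \<one>; src d = \<one>\<rbrakk> \<Longrightarrow> e ** d = d ** e"
  using interchange[of "ide \<one>" d e "ide \<one>"] interchange[of d "ide \<one>" "ide \<one>" e] by simp

text \<open>
  The nested caps and cups satisfy the zigzag identities for \<open>V \<otimes> W\<close>.  By the axiom on the canonical
  isomorphism the nested cup also satisfies a zigzag identity together with \<open>ev (V \<otimes> W)\<close>, and a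
  partner in the zigzag identities is unique.
\<close>

lemma ev_tns:
  assumes [simp]: "V \<in> Obj C" "W \<in> Obj C"
  shows "ev (V \<odot> W) = ev W oo (ide (Dual C W) ** ev V ** ide W)"
    and "db (V \<odot> W) = (ide V ** db W ** ide (Dual C V)) oo db V"
proof -
  let ?V = "Dual C V" and ?W = "Dual C W"
  let ?E' = "ev W oo (ide ?W ** ev V ** ide W)" and ?D = "(ide V ** db W ** ide ?V) oo db V"
  let ?E = "ev (V \<odot> W)"
  define U where "U = V \<odot> W"
  define U' where "U' = ?W \<odot> ?V"
  have U [simp]: "U \<in> Obj C" "U' \<in> Obj C" "Dual C U = U'" "Dual C U' = U" by (auto simp: U_def U'_def)
  define E' where "E' = ?E'"
  define D where "D = ?D"
  have E' [simp]: "arr E'" "src E' = U' \<odot> U" "trg E' = \<one>" by (auto simp: E'_def U_def U'_def)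
  have D [simp]: "arr D" "src D = \<one>" "trg D = U \<odot> U'" by (auto simp: D_def U_def U'_def)
  have z1: "(ide U ** E') oo (D ** ide U) = ide U"
  proof -
    have 1: "(ide V ** ide W ** ide ?W ** ev V ** ide W) oo (ide V ** db W ** ide ?V ** ide V ** ide W)
      = (ide V ** db W ** ide W) oo (ide V ** ev V ** ide W)"
      using tns_assoc[of "ev V" "db W" "ide W"] by (simp add: merge cap_cup_commute[of "ev V" "db W"])
    have "(ide U ** E') oo (D ** ide U)
      = (ide V ** ide W ** ev W) oo ((ide V ** ide W ** ide ?W ** ev V ** ide W)
          oo (ide V ** db W ** ide ?V ** ide V ** ide W)) oo (db V ** ide V ** ide W)"
      unfolding U_def E'_def D_def by (simp add: whisk)
    also have "\<dots> = (ide V ** ((ide W ** ev W) oo (db W ** ide W)))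
        oo (((ide V ** ev V) oo (db V ** ide V)) ** ide W)"
      unfolding 1 by (simp add: whisk)
    also have "\<dots> = ide U" unfolding snake[OF assms(1)] snake[OF assms(2)] by (simp add: U_def cmp_ide2)
    finally show ?thesis .
  qed
  have z2: "(ev U ** ide U') oo (ide U' ** D) = ide U'"
  proof (rule arrow_eqI)
    have a: "(ev U ** ide U') oo (ide U' ** D) = (((ev (V \<odot> W) ** ide ?W) ** ide ?V)
        oo (((ide (Dual C (V \<odot> W)) ** ide V) ** db W) ** ide ?V)) oo (ide (Dual C (V \<odot> W)) ** db V)"
      by (simp add: U_def U'_def D_def whisk)
    have "mor ((((ev (V \<odot> W) ** ide ?W) ** ide ?V)
        oo (((ide (Dual C (V \<odot> W)) ** ide V) ** db W) ** ide ?V)) oo (ide (Dual C (V \<odot> W)) ** db V))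
      = Id C (Dual C (V \<odot> W))"
      using Dual_TensO_iso[OF assms] by (simp del: tns_assoc cmp_assoc ide_tns)
    then show "mor ((ev U ** ide U') oo (ide U' ** D)) = mor (ide U')" unfolding a
      by (simp add: U'_def del: ide_tns)
  qed auto
  have 1: "(ev U ** E') oo (ide U' ** D ** ide U) = ev U oo (ide U' ** ((ide U ** E') oo (D ** ide U)))"
  proof -
    have "ev U oo (ide U' ** ide U ** E') = ev U ** E'" by (simp add: merge)
    from cmp_rewrite[OF this] show ?thesis by (simp add: whisk)
  qed
  have 2: "(ev U ** E') oo (ide U' ** D ** ide U) = E' oo (((ev U ** ide U') oo (ide U' ** D)) ** ide U)"
  proof -
    have "E' oo (ev U ** ide U' ** ide U) = ev U ** E'" by (simp add: merge)
    from cmp_rewrite[OF this] show ?thesis by (simp add: whisk)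
  qed
  have "ev U = E'" using 1 2 unfolding z1 z2 by (simp flip: ide_tns)
  then show "?E = ?E'" by (simp add: U_def E'_def)
  have 3: "(D ** ide U ** ide U') oo db U = (ide U ** ide U' ** db U) oo D" by (simp add: merge)
  have "db U = (((ide U ** E') oo (D ** ide U)) ** ide U') oo db U" unfolding z1 by (simp flip: ide_tns)
  also have "\<dots> = (ide U ** ((E' ** ide U') oo (ide U' ** db U))) oo D" by (simp add: whisk 3)
  also have "(E' ** ide U') oo (ide U' ** db U) = ide U'" using snake_dual[of U] \<open>ev U = E'\<close> by simp
  finally show "db (V \<odot> W) = ?D" by (simp add: D_def[symmetric] U_def[symmetric] flip: ide_tns)
qed

lemma dual_tns:
  assumes "arr f" "arr g"
  shows "dual (f ** g) = dual g ** dual f"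
proof (rule ev_cancel_left[of _ _ "Dual C (trg f \<odot> trg g)" "src f \<odot> src g"])
  let ?V = "src f" and ?W = "trg f" and ?X = "src g" and ?Y = "trg g"
  have "ev (?V \<odot> ?X) oo (dual (f ** g) ** ide (?V \<odot> ?X))
      = ev (?W \<odot> ?Y) oo (ide (Dual C (?W \<odot> ?Y)) ** f ** g)"
    using ev_slide[of "f ** g" "?V \<odot> ?X" "?W \<odot> ?Y"] assms by simp
  also have "\<dots> = ev ?Y oo (ide (Dual C ?Y) ** (ev ?W oo (ide (Dual C ?W) ** f)) ** g)"
    using assms by (simp add: ev_tns interchange interchange_1_2)
  also have "\<dots> = (ev ?Y oo (ide (Dual C ?Y) ** g))
      oo (ide (Dual C ?Y) ** (ev ?V oo (dual f ** ide ?V)) ** ide ?X)"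
    unfolding ev_slide[OF assms(1) refl refl] using assms by (simp add: merge)
  also have "\<dots> = ev (?V \<odot> ?X) oo ((dual g ** dual f) ** ide (?V \<odot> ?X))"
    unfolding ev_slide[OF assms(2) refl refl] using assms by (simp add: ev_tns merge)
  finally show "ev (?V \<odot> ?X) oo (dual (f ** g) ** ide (?V \<odot> ?X))
      = ev (?V \<odot> ?X) oo ((dual g ** dual f) ** ide (?V \<odot> ?X))" .
qed (use assms in auto)

end

section \<open>Half-braidings and their duals\<close>

context strict_pivotal_category
begin

text \<open>
  The inverses are carried along as a family of their own, because the dual half-braiding and the
  twist are built from them.
\<close>

definition half_braid :: "'a \<Rightarrow> ('a \<Rightarrow> ('a, 'b) arrow) \<Rightarrow> ('a \<Rightarrow> ('a, 'b) arrow) \<Rightarrow> bool" where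
  "half_braid x s s' \<longleftrightarrow> x \<in> Obj C \<and>
    (\<forall>V\<in>Obj C. arr (s V) \<and> src (s V) = x \<odot> V \<and> trg (s V) = V \<odot> x \<and>
      arr (s' V) \<and> src (s' V) = V \<odot> x \<and> trg (s' V) = x \<odot> V \<and>
      s V oo s' V = ide (V \<odot> x) \<and> s' V oo s V = ide (x \<odot> V)) \<and>
    (\<forall>f. arr f \<longrightarrow> s (trg f) oo (ide x ** f) = (f ** ide x) oo s (src f)) \<and>
    s \<one> = ide x \<and>
    (\<forall>V\<in>Obj C. \<forall>W\<in>Obj C. s (V \<odot> W) = (ide V ** s W) oo (s V ** ide W))"

lemma half_braid_simps:
  assumes "half_braid x s s'"
  shows "x \<in> Obj C" "V \<in> Obj C \<Longrightarrow> arr (s V)" "V \<in> Obj C \<Longrightarrow> src (s V) = x \<odot> V" "V \<in> Obj C \<Longrightarrow> trg (s V) = V \<odot> x"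
    "V \<in> Obj C \<Longrightarrow> arr (s' V)" "V \<in> Obj C \<Longrightarrow> src (s' V) = V \<odot> x" "V \<in> Obj C \<Longrightarrow> trg (s' V) = x \<odot> V"
  using assms by (auto simp: half_braid_def)

lemma half_braid_inv: assumes "half_braid x s s'" "V \<in> Obj C"
  shows "s V oo s' V = ide V ** ide x" "s' V oo s V = ide x ** ide V"
  using assms by (auto simp: half_braid_def)

lemma half_braid_nat: "half_braid x s s' \<Longrightarrow> arr f \<Longrightarrow> s (trg f) oo (ide x ** f) = (f ** ide x) oo s (src f)"
  and half_braid_unit: "half_braid x s s' \<Longrightarrow> s \<one> = ide x"
  and half_braid_tens: "half_braid x s s' \<Longrightarrow> V \<in> Obj C \<Longrightarrow> W \<in> Obj C
      \<Longrightarrow> s (V \<odot> W) = (ide V ** s W) oo (s V ** ide W)"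
  by (auto simp: half_braid_def)

lemma half_braid_inv_nat:
  assumes s: "half_braid x s s'" and f: "arr f" "src f = V" "trg f = W"
  shows "(ide x ** f) oo s' V = s' W oo (f ** ide x)"
proof -
  have obj: "V \<in> Obj C" "W \<in> Obj C" "x \<in> Obj C" using arr_Obj[OF f(1)] f(2,3) half_braid_simps[OF s]
    by simp_all
  note facts = f obj half_braid_simps[OF s]
  have "(ide x ** f) oo s' V = s' W oo (s W oo (ide x ** f)) oo s' V"
    by (simp add: facts cmp_rewrite[OF half_braid_inv(2)[OF s]] ide2_cmp)
  also have "s W oo (ide x ** f) = (f ** ide x) oo s V" using half_braid_nat[OF s f(1)] f by simp
  also have "s' W oo ((f ** ide x) oo s V) oo s' V = s' W oo (f ** ide x)"
    by (simp add: facts half_braid_inv(1)[OF s] cmp_ide2)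
  finally show ?thesis .
qed

lemma half_braid_ev_slide:
  assumes s: "half_braid x s s'" and V: "V \<in> Obj C"
  shows "(ev V ** ide x) oo (ide (Dual C V) ** s V) = (ide x ** ev V) oo (s' (Dual C V) ** ide V)"
proof -
  let ?V = "Dual C V"
  note facts = V half_braid_simps[OF s]
  have "ide x ** ev V = (ev V ** ide x) oo (ide ?V ** s V) oo (s ?V ** ide V)"
    using half_braid_nat[OF s, of "ev V"] half_braid_unit[OF s] half_braid_tens[OF s, of ?V V]
      by (simp add: facts)
  then have "(ide x ** ev V) oo (s' ?V ** ide V)
      = (ev V ** ide x) oo (ide ?V ** s V) oo ((s ?V oo s' ?V) ** ide V)"
    by (simp add: facts whisk)
  then show ?thesis by (simp add: facts half_braid_inv(1)[OF s] cmp_ide3)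
qed

text \<open>
  By compatibility with tensor products and naturality for the evaluation of \<open>V\<close>, the half-braiding
  at the dual of \<open>V\<close> is inverse to the half-braiding at \<open>V\<close> with \<open>V\<close> bent around.
\<close>

lemma half_braid_inverse_mate:
  assumes s: "half_braid x s s'" and V: "V \<in> Obj C"
  shows "s' (Dual C V) = (ev V ** ide x ** ide (Dual C V)) oo (ide (Dual C V) ** s V ** ide (Dual C V))
    oo (ide (Dual C V) ** ide x ** db V)"
proof -
  let ?V = "Dual C V"
  note facts = V half_braid_simps[OF s]
  have 1: "(s' ?V ** ide V ** ide ?V) oo (ide ?V ** ide x ** db V) = (ide x ** ide ?V ** db V) oo s' ?V"
    by (simp add: facts merge)
  have "(ev V ** ide x ** ide ?V) oo (ide ?V ** s V ** ide ?V) oo (ide ?V ** ide x ** db V)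
    = (((ev V ** ide x) oo (ide ?V ** s V)) ** ide ?V) oo (ide ?V ** ide x ** db V)"
    by (simp add: facts whisk)
  also have "\<dots> = (ide x ** ((ev V ** ide ?V) oo (ide ?V ** db V))) oo s' ?V"
    unfolding half_braid_ev_slide[OF s V] by (simp add: facts whisk 1)
  also have "\<dots> = s' ?V" by (simp add: facts snake_dual ide2_cmp)
  finally show ?thesis by simp
qed

definition dual_braid :: "'a \<Rightarrow> ('a \<Rightarrow> ('a, 'b) arrow) \<Rightarrow> 'a \<Rightarrow> ('a, 'b) arrow" where
  "dual_braid x s' V = (ev x ** ide V ** ide (Dual C x)) oo (ide (Dual C x) ** s' V ** ide (Dual C x))
    oo (ide (Dual C x) ** ide V ** db x)"

text \<open>
  Bending both \<open>x\<close> and \<open>V\<close> around turns the half-braiding into its dual morphism.  This identifies the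
  dual half-braiding with a functorial construction, so that all its properties follow from those of
  duality.
\<close>

lemma dual_braid_dual:
  assumes s: "half_braid x s s'" and V: "V \<in> Obj C"
  shows "dual_braid x s' (Dual C V) = dual (s V)"
proof -
  let ?V = "Dual C V" and ?x = "Dual C x"
  note facts = V half_braid_simps[OF s]
  have 1: "(ev x ** ide ?V ** ide ?x) oo (ide ?x ** ev V ** ide x ** ide ?V ** ide ?x)
     = ev (V \<odot> x) ** ide ?V ** ide ?x"
    by (simp add: facts ev_tns whisk)
  have 2: "(ide ?x ** ide ?V ** ide x ** db V ** ide ?x) oo (ide ?x ** ide ?V ** db x)
      = ide ?x ** ide ?V ** db (x \<odot> V)"
    by (simp add: facts ev_tns whisk)
  have "dual_braid x s' ?V = ((ev x ** ide ?V ** ide ?x) oo (ide ?x ** ev V ** ide x ** ide ?V ** ide ?x))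
    oo (ide ?x ** ide ?V ** s V ** ide ?V ** ide ?x)
    oo (ide ?x ** ide ?V ** ide x ** db V ** ide ?x) oo (ide ?x ** ide ?V ** db x)"
    unfolding dual_braid_def half_braid_inverse_mate[OF s V] by (simp add: facts whisk)
  also have "\<dots> = dual (s V)"
    unfolding 1 2 dual_def by (simp add: facts)
  finally show ?thesis .
qed

lemma half_braid_dual:
  assumes s: "half_braid x s s'"
  shows "half_braid (Dual C x) (dual_braid x s') (\<lambda>V. dual (s' (Dual C V)))"
proof -
  note facts = half_braid_simps[OF s]
  have d: "dual_braid x s' V = dual (s (Dual C V))" if "V \<in> Obj C" for V
    using dual_braid_dual[OF s, of "Dual C V"] that by simp
  have inv: "dual (s (Dual C V)) oo dual (s' (Dual C V)) = ide (V \<odot> Dual C x)"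
    "dual (s' (Dual C V)) oo dual (s (Dual C V)) = ide (Dual C x \<odot> V)" if "V \<in> Obj C" for V
    using dual_cmp[of "s' (Dual C V)" _ _ "s (Dual C V)"] dual_cmp[of "s (Dual C V)" _ _ "s' (Dual C V)"]
      half_braid_inv[OF s, of "Dual C V"] dual_tns[of "ide (Dual C V)" "ide x"] dual_tns[of "ide x"
          "ide (Dual C V)"] that by (simp_all add: facts)
  have nat: "dual (s (Dual C (trg f))) oo (ide (Dual C x) ** f)
      = (f ** ide (Dual C x)) oo dual (s (Dual C (src f)))"
    if f: "arr f" for f
  proof -
    have "s (Dual C (src f)) oo (ide x ** dual f) = (dual f ** ide x) oo s (Dual C (trg f))"
      using half_braid_nat[OF s, of "dual f"] f by simp
    then have "dual (s (Dual C (src f)) oo (ide x ** dual f))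
        = dual ((dual f ** ide x) oo s (Dual C (trg f)))" by simp
    moreover have "dual (s (Dual C (src f)) oo (ide x ** dual f))
        = (f ** ide (Dual C x)) oo dual (s (Dual C (src f)))"
      using f by (subst dual_cmp[OF _ refl refl _ refl]) (simp_all add: facts dual_tns)
    moreover have "dual ((dual f ** ide x) oo s (Dual C (trg f)))
        = dual (s (Dual C (trg f))) oo (ide (Dual C x) ** f)"
      using f by (subst dual_cmp[OF _ refl refl _ refl]) (simp_all add: facts dual_tns)
    ultimately show ?thesis by simp
  qed
  have tens: "dual (s (Dual C (V \<odot> W))) = (ide V ** dual (s (Dual C W))) oo (dual (s (Dual C V)) ** ide W)"
    if "V \<in> Obj C" "W \<in> Obj C" for V W
    using that half_braid_tens[OF s, of "Dual C W" "Dual C V"]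
    by simp (subst dual_cmp[OF _ refl refl _ refl], simp_all add: facts dual_tns)
  show ?thesis
    unfolding half_braid_def
    using inv nat tens half_braid_unit[OF s] by (simp add: d facts)
qed

text \<open>
  Since duality of morphisms is an involution, the dual of the dual half-braiding is the original one:
  the strict pivotal structure lifts to the center.
\<close>

lemma dual_braid_involution:
  assumes s: "half_braid x s s'" and V: "V \<in> Obj C"
  shows "dual_braid (Dual C x) (\<lambda>V. dual (s' (Dual C V))) V = s V"
proof -
  have "dual_braid (Dual C x) (\<lambda>V. dual (s' (Dual C V))) (Dual C (Dual C V))
      = dual (dual_braid x s' (Dual C V))"
    by (rule dual_braid_dual[OF half_braid_dual[OF s]]) (use V in simp)
  then show ?thesis using V dual_braid_dual[OF s V] by (simp add: half_braid_simps[OF s])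
qed

text \<open>
  The condition for an arrow between objects with half-braidings \<open>s\<close> and \<open>t\<close> to be a morphism of the
  center.
\<close>

definition central where
  "central s t f \<longleftrightarrow> (\<forall>V\<in>Obj C. (ide V ** f) oo s V = t V oo (f ** ide V))"

lemma central_inv:
  assumes s: "half_braid x s s'" and t: "half_braid y t t'"
      and f: "arr f" "src f = x" "trg f = y" "central s t f" and V: "V \<in> Obj C"
  shows "t' V oo (ide V ** f) = (f ** ide V) oo s' V"
proof -
  note facts = half_braid_simps[OF s] half_braid_simps[OF t] f(1-3) V
  have "t' V oo (ide V ** f) = t' V oo ((ide V ** f) oo s V) oo s' V"
    by (simp add: facts half_braid_inv[OF s] cmp_ide2)
  also have "(ide V ** f) oo s V = t V oo (f ** ide V)" using f V by (simp add: central_def)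
  also have "t' V oo (t V oo (f ** ide V)) oo s' V = (f ** ide V) oo s' V"
    by (simp add: facts cmp_rewrite[OF half_braid_inv(2)[OF t]] ide2_cmp)
  finally show ?thesis .
qed

lemma central_ev:
  assumes s: "half_braid x s s'" and V: "V \<in> Obj C"
  shows "(ide V ** ev x) oo (dual_braid x s' V ** ide x) oo (ide (Dual C x) ** s V) = ev x ** ide V"
proof -
  let ?x = "Dual C x"
  note facts = half_braid_simps[OF s] V
  have 1: "(ide V ** ev x) oo (ev x ** ide V ** ide ?x ** ide x)
      = (ev x ** ide V) oo (ide ?x ** ide x ** ide V ** ev x)"
    by (simp add: facts merge)
  have 2: "(ide ?x ** ide x ** ide V ** ev x) oo (ide ?x ** s' V ** ide ?x ** ide x)
      = (ide ?x ** s' V) oo (ide ?x ** ide V ** ide x ** ev x)"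
    by (simp add: facts merge)
  have "(ide V ** ev x) oo (dual_braid x s' V ** ide x)
      = (ev x ** ide V) oo (ide ?x ** s' V) oo (ide ?x ** ide V ** ((ide x ** ev x) oo (db x ** ide x)))"
    unfolding dual_braid_def by (simp add: facts whisk cmp_rewrite[OF 1] cmp_rewrite[OF 2])
  also have "\<dots> = (ev x ** ide V) oo (ide ?x ** s' V)" by (simp add: facts snake cmp_ide3)
  finally have "((ide V ** ev x) oo (dual_braid x s' V ** ide x)) oo (ide ?x ** s V)
      = (ev x ** ide V) oo (ide ?x ** (s' V oo s V))"
    by (simp add: facts whisk)
  then show ?thesis by (simp add: facts half_braid_inv(2)[OF s] cmp_ide3)
qed

lemma central_db:
  assumes s: "half_braid x s s'" and V: "V \<in> Obj C"
  shows "(s V ** ide (Dual C x)) oo (ide x ** dual_braid x s' V) oo (db x ** ide V) = ide V ** db x"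
proof -
  let ?x = "Dual C x"
  note facts = half_braid_simps[OF s] V
  have 1: "(ide x ** ide ?x ** s' V ** ide ?x) oo (ide x ** ide ?x ** ide V ** db x) oo (db x ** ide V)
     = (db x ** ide x ** ide V ** ide ?x) oo (s' V ** ide ?x) oo (ide V ** db x)"
    by (simp add: facts merge)
  have "(ide x ** dual_braid x s' V) oo (db x ** ide V)
      = (((ide x ** ev x) oo (db x ** ide x)) ** ide V ** ide ?x) oo (s' V ** ide ?x) oo (ide V ** db x)"
    unfolding dual_braid_def by (simp add: facts whisk 1)
  also have "\<dots> = (s' V ** ide ?x) oo (ide V ** db x)" by (simp add: facts snake merge)
  finally have "(s V ** ide ?x) oo (ide x ** dual_braid x s' V) oo (db x ** ide V)
      = ((s V oo s' V) ** ide ?x) oo (ide V ** db x)"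
    by (simp add: facts whisk)
  then show ?thesis by (simp add: facts half_braid_inv(1)[OF s] ide3_cmp)
qed

end

section \<open>The twist\<close>

context strict_pivotal_category
begin

lemma cap_cap_commute: "\<lbrakk>arr e; arr d; trg e = \<one>; trg d = \<one>\<rbrakk>
  \<Longrightarrow> e oo (ide (src e) ** d) = d oo (e ** ide (src d))"
  using interchange[of e "ide \<one>" "ide (src e)" d] interchange[of "ide \<one>" d e "ide (src d)"] by simp

text \<open>
  The Yang-Baxter equation: naturality of the half-braiding of \<open>x\<close>, applied to the half-braiding
  morphism \<open>s V\<close> itself.
\<close>

lemma central_braiding:
  assumes s: "half_braid x s s'" and V: "V \<in> Obj C"
  shows "(ide V ** s x) oo (s V ** ide x) oo (ide x ** s V)
      = (s V ** ide x) oo (ide x ** s V) oo (s x ** ide V)"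
proof -
  note facts = half_braid_simps[OF s] V
  show ?thesis
    using half_braid_nat[OF s, of "s V"] half_braid_tens[OF s, of x V] half_braid_tens[OF s, of V x]
      by (simp add: facts)
qed

lemma central_braiding_inv:
  assumes s: "half_braid x s s'" and V: "V \<in> Obj C"
  shows "(ide V ** s' x) oo (s V ** ide x) oo (ide x ** s V)
      = (s V ** ide x) oo (ide x ** s V) oo (s' x ** ide V)"
proof -
  note facts = half_braid_simps[OF s] V
  note 1 = central_braiding[OF s V, symmetric]
  have "(ide V ** s' x) oo (s V ** ide x) oo (ide x ** s V)
    = (ide V ** s' x) oo ((s V ** ide x) oo (ide x ** s V) oo ((s x oo s' x) ** ide V))"
    by (simp add: facts half_braid_inv(1)[OF s] cmp_ide3)
  also have "\<dots> = (ide V ** s' x) oo ((s V ** ide x) oo (ide x ** s V) oo (s x ** ide V)) oo (s' x ** ide V)"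
    by (simp add: facts whisk)
  also have "\<dots> = (ide V ** (s' x oo s x)) oo (s V ** ide x) oo (ide x ** s V) oo (s' x ** ide V)"
    unfolding 1 by (simp add: facts whisk)
  also have "\<dots> = (s V ** ide x) oo (ide x ** s V) oo (s' x ** ide V)"
    by (simp add: facts half_braid_inv(2)[OF s] ide3_cmp)
  finally show ?thesis .
qed

text \<open>
  The Drinfeld morphism, a left curl on the inverse braiding, and the right curl on the braiding that
  turns out to be its inverse.
\<close>

definition curl where "curl x s' = ltrace x x x (s' x)"
definition curl_inv where "curl_inv x s = rtrace x x x (s x)"

lemma curl_simps: assumes "half_braid x s s'"
  shows "arr (curl x s')" "src (curl x s') = x" "trg (curl x s') = x"
    "arr (curl_inv x s)" "src (curl_inv x s) = x" "trg (curl_inv x s) = x"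
  using half_braid_simps[OF assms] by (simp_all add: curl_def curl_inv_def)

lemma central_curl:
  assumes s: "half_braid x s s'"
  shows "central s s (curl x s')"
  unfolding central_def
proof
  fix V assume V: "V \<in> Obj C"
  let ?x = "Dual C x" and ?d = "dual_braid x s'"
  note d = half_braid_simps[OF half_braid_dual[OF s]]
  note facts = half_braid_simps[OF s] V d(1-4)
  have dbb: "ide V ** db ?x = (?d V ** ide x) oo (ide ?x ** s V) oo (db ?x ** ide V)"
    using central_db[OF half_braid_dual[OF s] V] by (simp add: facts dual_braid_involution[OF s])
  have 1: "(db ?x ** ide V ** ide x) oo s V = (ide ?x ** ide x ** s V) oo (db ?x ** ide x ** ide V)"
    by (simp add: facts merge)
  have 2: "(ide V ** ide ?x ** s' x) oo (?d V ** ide x ** ide x)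
      = (?d V ** ide x ** ide x) oo (ide ?x ** ide V ** s' x)"
    by (simp add: facts merge)
  have 3: "s V oo (ev x ** ide x ** ide V) = (ev x ** ide V ** ide x) oo (ide ?x ** ide x ** s V)"
    by (simp add: facts merge)
  have "(ide V ** curl x s') oo s V = (ide V ** ev x ** ide x) oo (ide V ** ide ?x ** s' x)
      oo ((ide V ** db ?x) ** ide x) oo s V"
    unfolding curl_def ltrace_def by (simp add: facts whisk)
  also have "\<dots> = (ide V ** ev x ** ide x) oo ((ide V ** ide ?x ** s' x) oo (?d V ** ide x ** ide x))
      oo (ide ?x ** s V ** ide x) oo (db ?x ** ide V ** ide x) oo s V"
    unfolding dbb by (simp add: facts whisk)
  also have "\<dots> = (ide V ** ev x ** ide x) oo (?d V ** ide x ** ide x)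
      oo (ide ?x ** ((ide V ** s' x) oo (s V ** ide x) oo (ide x ** s V))) oo (db ?x ** ide x ** ide V)"
    unfolding 1 2 by (simp add: facts whisk)
  also have "\<dots> = (((ide V ** ev x) oo (?d V ** ide x) oo (ide ?x ** s V)) ** ide x)
      oo (ide ?x ** ide x ** s V) oo (ide ?x ** s' x ** ide V) oo (db ?x ** ide x ** ide V)"
    unfolding central_braiding_inv[OF s V] by (simp add: facts whisk)
  also have "\<dots> = ((ev x ** ide V ** ide x) oo (ide ?x ** ide x ** s V)) oo (ide ?x ** s' x ** ide V)
      oo (db ?x ** ide x ** ide V)"
    unfolding central_ev[OF s V] by (simp add: facts)
  also have "\<dots> = s V oo (curl x s' ** ide V)"
    unfolding 3[symmetric] curl_def ltrace_def by (simp add: facts whisk)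
  finally show "(ide V ** curl x s') oo s V = s V oo (curl x s' ** ide V)" .
qed

text \<open>
  The curl is untwisted against a cap: with a leg of the cap it forms a single crossing.  Together with
  the next lemma this is the computation that makes the two curls inverse to each other.
\<close>

lemma evbar_curl:
  assumes s: "half_braid x s s'"
  shows "ev (Dual C x) oo (curl x s' ** ide (Dual C x)) = ev x oo s (Dual C x)"
proof -
  let ?x = "Dual C x"
  note facts = half_braid_simps[OF s]
  have "(ide ?x ** s x) oo (s ?x ** ide x) oo (ide x ** db ?x) = db ?x ** ide x"
    using half_braid_nat[OF s, of "db ?x"] half_braid_unit[OF s] half_braid_tens[OF s, of ?x x]
      by (simp add: facts)
  then have "(ide ?x ** s' x) oo (db ?x ** ide x)
      = (ide ?x ** (s' x oo s x)) oo (s ?x ** ide x) oo (ide x ** db ?x)"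
    by (simp add: facts whisk)
  then have 1: "(ide ?x ** s' x) oo (db ?x ** ide x) = (s ?x ** ide x) oo (ide x ** db ?x)"
    by (simp add: facts half_braid_inv(2)[OF s] ide3_cmp)
  have 2: "ev ?x oo (ev x ** ide x ** ide ?x) oo (s ?x ** ide x ** ide ?x)
      = ev x oo s ?x oo (ide x ** ide ?x ** ev ?x)"
    by (simp add: facts merge)
  have "ev ?x oo (curl x s' ** ide ?x) = (ev ?x oo (ev x ** ide x ** ide ?x)
      oo (s ?x ** ide x ** ide ?x)) oo (ide x ** db ?x ** ide ?x)"
    unfolding curl_def ltrace_def 1 by (simp add: facts whisk)
  also have "\<dots> = ev x oo s ?x oo (ide x ** ((ide ?x ** ev ?x) oo (db ?x ** ide ?x)))"
    unfolding 2 by (simp add: facts whisk)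
  also have "\<dots> = ev x oo s ?x" by (simp add: facts snake cmp_ide2)
  finally show ?thesis .
qed

lemma ev_curl_inv:
  assumes s: "half_braid x s s'"
  shows "ev x oo (ide (Dual C x) ** curl_inv x s) = ev (Dual C x) oo s' (Dual C x)"
proof -
  let ?x = "Dual C x"
  note facts = half_braid_simps[OF s]
  have "(ev x ** ide x) oo (ide ?x ** s x) oo (s ?x ** ide x) = ide x ** ev x"
    using half_braid_nat[OF s, of "ev x"] half_braid_unit[OF s] half_braid_tens[OF s, of ?x x]
      by (simp add: facts)
  then have "(ide x ** ev x) oo (s' ?x ** ide x)
      = ((ev x ** ide x) oo (ide ?x ** s x) oo (s ?x ** ide x)) oo (s' ?x ** ide x)"
    by simp
  also have "\<dots> = (ev x ** ide x) oo (ide ?x ** s x) oo ((s ?x oo s' ?x) ** ide x)"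
    by (simp add: facts whisk)
  also have "\<dots> = (ev x ** ide x) oo (ide ?x ** s x)" by (simp add: facts half_braid_inv(1)[OF s] cmp_ide3)
  finally have 1: "(ev x ** ide x) oo (ide ?x ** s x) = (ide x ** ev x) oo (s' ?x ** ide x)" by simp
  have 2: "ev x oo (ide ?x ** ide x ** ev ?x) = ev ?x oo (ev x ** ide x ** ide ?x)"
    using cap_cap_commute[of "ev x" "ev ?x"] by (simp add: facts merge)
  have 3: "(s' ?x ** ide x ** ide ?x) oo (ide ?x ** ide x ** db x) = (ide x ** ide ?x ** db x) oo s' ?x"
    by (simp add: facts merge)
  have "ev x oo (ide ?x ** curl_inv x s) = (ev x oo (ide ?x ** ide x ** ev ?x))
      oo (ide ?x ** s x ** ide ?x) oo (ide ?x ** ide x ** db x)"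
    unfolding curl_inv_def rtrace_def by (simp add: facts whisk)
  also have "\<dots> = ev ?x oo (((ev x ** ide x) oo (ide ?x ** s x)) ** ide ?x) oo (ide ?x ** ide x ** db x)"
    unfolding 2 by (simp add: facts whisk)
  also have "\<dots> = ev ?x oo (ide x ** ((ev x ** ide ?x) oo (ide ?x ** db x))) oo s' ?x"
    unfolding 1 by (simp add: facts whisk 3)
  also have "\<dots> = ev ?x oo s' ?x" by (simp add: facts snake_dual ide2_cmp)
  finally show ?thesis .
qed

text \<open>
  Each curl turns a cap into a crossing or an inverse crossing, and these cancel.  The other
  composite is reduced to the first one: the curl can be moved from one strand of the braiding to the
  other by naturality, and around the closed strand by cyclicity of the partial trace.
\<close>

lemma curl_inverse:
  assumes s: "half_braid x s s'"
  shows "curl_inv x s oo curl x s' = ide x" "curl x s' oo curl_inv x s = ide x"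
proof -
  let ?x = "Dual C x" and ?u = "curl x s'" and ?v = "curl_inv x s"
  note facts = half_braid_simps[OF s] curl_simps[OF s]
  show vu: "?v oo ?u = ide x"
  proof (rule ev_cancel_right[of _ x x])
    have "ev x oo (ide ?x ** (?v oo ?u)) = (ev x oo (ide ?x ** ?v)) oo (ide ?x ** ?u)"
      by (simp add: facts whisk)
    also have "\<dots> = ev ?x oo s' ?x oo (ide ?x ** ?u)" unfolding ev_curl_inv[OF s] by simp
    also have "\<dots> = (ev ?x oo (?u ** ide ?x)) oo s' ?x"
      using central_inv[OF s s _ _ _ central_curl[OF s], of ?x] by (simp add: facts)
    also have "\<dots> = ev x" unfolding evbar_curl[OF s] by (simp add: facts half_braid_inv(1)[OF s] cmp_ide2)
    finally show "ev x oo (ide ?x ** (?v oo ?u)) = ev x oo (ide ?x ** ide x)" by (simp add: facts cmp_ide2)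
  qed (simp_all add: facts)
  \<comment> \<open>The first equation expresses that the curl is a morphism of the center, the second one is
    naturality of the half-braiding for the curl.\<close>
  have c1: "s x oo (?u ** ide x) = (ide x ** ?u) oo s x" using central_curl[OF s]
    by (simp add: central_def facts)
  have c2: "s x oo (ide x ** ?u) = (?u ** ide x) oo s x" using half_braid_nat[OF s, of ?u]
    by (simp add: facts)
  have "?v oo ?u = rtrace x x x (s x oo (?u ** ide x))"
    using rtrace_out[of ?u x x "ide x" x x x "s x"] by (simp add: facts curl_inv_def ide2_cmp)
  also have "\<dots> = rtrace x x x (s x oo (ide x ** ?u))"
    unfolding c1 by (rule rtrace_slide) (simp_all add: facts)
  also have "\<dots> = ?u oo ?v"
    unfolding c2 using rtrace_out[of "ide x" x x ?u x x x "s x"] by (simp add: facts curl_inv_def cmp_ide2)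
  finally show "?u oo ?v = ide x" using vu by simp
qed

lemma curl_natural:
  assumes s: "half_braid x s s'" and t: "half_braid y t t'"
      and f: "arr f" "src f = x" "trg f = y" "central s t f"
  shows "f oo curl x s' = curl y t' oo f"
proof -
  note facts = half_braid_simps[OF s] half_braid_simps[OF t] f(1-3)
  have 1: "(ide x ** f) oo s' x = s' y oo (f ** ide x)" by (rule half_braid_inv_nat[OF s f(1-3)])
  have 2: "(f ** ide y) oo s' y = t' y oo (ide y ** f)" using central_inv[OF s t f, of y]
    by (simp add: facts)
  have "f oo curl x s' = ltrace x x y ((ide x ** f) oo s' x)"
    using ltrace_out[of "ide x" x x f x y x "s' x"] by (simp add: facts curl_def cmp_ide2)
  also have "\<dots> = ltrace y x y ((f ** ide y) oo s' y)"
    unfolding 1 by (rule ltrace_slide[symmetric]) (simp_all add: facts)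
  also have "\<dots> = curl y t' oo f"
    unfolding 2 using ltrace_out[of f x y "ide y" y y y "t' y"] by (simp add: facts curl_def ide2_cmp)
  finally show ?thesis .
qed

end

section \<open>The center in terms of arrows\<close>

context strict_pivotal_category
begin

lemma inverses_unique:
  assumes "V \<in> Obj C" "W \<in> Obj C" "inverses C V W f g" "inverses C V W f g'"
  shows "g = g'"
proof -
  have "g' = g' \<cdot> (f \<cdot> g)" using assms Comp_Id[of W V g'] by (simp add: inverses_def)
  also have "\<dots> = (g' \<cdot> f) \<cdot> g" using assms Comp_assoc[of W V W V g' f g] by (simp add: inverses_def)
  also have "\<dots> = g" using assms Id_Comp[of W V g] by (simp add: inverses_def)
  finally show ?thesis by simp
qed

lemma inv_mor_eqI:
  assumes "V \<in> Obj C" "W \<in> Obj C" "inverses C V W f g"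
  shows "inv_mor C V W f = g"
  unfolding inv_mor_def using assms inverses_unique by blast

lemma inverses_center:
  assumes "inverses (center C) X Y f g"
  shows "inverses C (fst X) (fst Y) f g"
  using assms by (auto simp: inverses_def center_def split: prod.splits)

lemma inv_mor_center_eqI:
  assumes "fst X \<in> Obj C" "fst Y \<in> Obj C" "inverses (center C) X Y f g"
  shows "inv_mor (center C) X Y f = g"
  unfolding inv_mor_def using assms inverses_unique[OF assms(1,2)] inverses_center by blast

definition braid :: "'a \<times> ('a \<Rightarrow> 'b) \<Rightarrow> 'a \<Rightarrow> ('a, 'b) arrow" where
  "braid X V = Arrow (fst X \<odot> V) (snd X V) (V \<odot> fst X)"

definition braid_inv :: "'a \<times> ('a \<Rightarrow> 'b) \<Rightarrow> 'a \<Rightarrow> ('a, 'b) arrow" where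
  "braid_inv X V = Arrow (V \<odot> fst X) (inv_mor C (fst X \<odot> V) (V \<odot> fst X) (snd X V)) (fst X \<odot> V)"

lemma half_braid_center:
  assumes "X \<in> Obj (center C)"
  shows "half_braid (fst X) (braid X) (braid_inv X)"
proof -
  obtain x s where X: "X = (x, s)" by (cases X)
  have x: "x \<in> Obj C" and h: "half_braiding C x s" using assms by (auto simp: X center_def)
  have iso: "inverses C (x \<odot> V) (V \<odot> x) (s V) (inv_mor C (x \<odot> V) (V \<odot> x) (s V))" if V: "V \<in> Obj C" for V
  proof -
    obtain g where g: "inverses C (x \<odot> V) (V \<odot> x) (s V) g"
      using h V unfolding half_braiding_def is_iso_def by blast
    then show ?thesis using inv_mor_eqI[OF _ _ g] x V by simp
  qed
  have a: "arr (braid X V)" "arr (braid_inv X V)" if "V \<in> Obj C" for V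
    using iso[OF that] that x by (auto simp: braid_def braid_inv_def X inverses_def)
  have sr: "src (braid X V) = x \<odot> V" "trg (braid X V) = V \<odot> x" "src (braid_inv X V) = V \<odot> x"
      "trg (braid_inv X V) = x \<odot> V" for V
    by (auto simp: braid_def braid_inv_def X)
  have m: "mor (braid X V) = s V" "mor (braid_inv X V) = inv_mor C (x \<odot> V) (V \<odot> x) (s V)" for V
    by (simp_all add: braid_def braid_inv_def X)
  have inv: "braid X V oo braid_inv X V = ide (V \<odot> x)" "braid_inv X V oo braid X V = ide (x \<odot> V)"
    if V: "V \<in> Obj C" for V
    using iso[OF V] a[OF V] V x
    by (auto intro!: arrow_eqI simp: sr m inverses_def TensM_Id simp del: ide_tns)
  have nat: "braid X (trg f) oo (ide x ** f) = (f ** ide x) oo braid X (src f)" if f: "arr f" for f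
  proof (rule arrow_eqI)
    have "s (trg f) \<cdot> (Id C x \<otimes> mor f) = (mor f \<otimes> Id C x) \<cdot> s (src f)"
      using h arr_mor[OF f] f unfolding half_braiding_def by (meson arr_Obj)
    then show "mor (braid X (trg f) oo (ide x ** f)) = mor ((f ** ide x) oo braid X (src f))"
      using f x a by (simp add: sr m)
  qed (use f x a in \<open>simp_all add: sr\<close>)
  have unit: "braid X \<one> = ide x"
    using h x a[of \<one>] by (intro arrow_eqI) (simp_all add: sr m half_braiding_def)
  have tens: "braid X (V \<odot> W) = (ide V ** braid X W) oo (braid X V ** ide W)"
    if "V \<in> Obj C" "W \<in> Obj C" for V W
    using h x that a by (intro arrow_eqI) (simp_all add: sr m half_braiding_def)
  show ?thesis unfolding half_braid_def using x a sr inv nat unit tens by (simp add: X)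
qed

lemma center_Obj_fst: "X \<in> Obj (center C) \<Longrightarrow> fst X \<in> Obj C"
  by (auto simp: center_def)

lemma center_Hom_iff:
  assumes "X \<in> Obj (center C)" "Y \<in> Obj (center C)"
  shows "f \<in> Hom (center C) X Y \<longleftrightarrow>
    arr (Arrow (fst X) f (fst Y)) \<and> central (braid X) (braid Y) (Arrow (fst X) f (fst Y))"
proof (cases "f \<in> Hom C (fst X) (fst Y)")
  case True
  note facts = center_Obj_fst[OF assms(1)] center_Obj_fst[OF assms(2)]
      half_braid_simps[OF half_braid_center[OF assms(1)]]
      half_braid_simps[OF half_braid_center[OF assms(2)]]
  have a: "arr (Arrow (fst X) f (fst Y))" using True facts by simp
  have m: "mor (braid Z V) = snd Z V" for Z V by (simp add: braid_def)
  have "((ide V ** Arrow (fst X) f (fst Y)) oo braid X V = braid Y V oo (Arrow (fst X) f (fst Y) ** ide V))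
    \<longleftrightarrow> (Id C V \<otimes> f) \<cdot> snd X V = snd Y V \<cdot> (f \<otimes> Id C V)" (is "?l = ?r \<longleftrightarrow> _") if V: "V \<in> Obj C" for V
  proof -
    have *: "arr ?l" "arr ?r" "src ?l = src ?r" "trg ?l = trg ?r" using V a
      by (simp_all add: facts del: arr.simps)
    have "?l = ?r \<longleftrightarrow> mor ?l = mor ?r" using arrow_eqI[OF *] by auto
    then show ?thesis using V a by (simp add: facts m del: arr.simps)
  qed
  then show ?thesis using True facts by (auto simp: center_def central_def split: prod.splits)
next
  case False
  then show ?thesis using assms by (auto simp: center_def split: prod.splits)
qed

text \<open>
  Dualising twice gives back the half-braiding on the objects of \<open>C\<close>.  Elsewhere both half-braidings
  have the default value of extensional functions, so that the pairs are equal.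
\<close>

lemma center_dual_dual:
  assumes X: "X \<in> Obj (center C)"
  shows "Dual (center C) (Dual (center C) X) = X"
proof -
  obtain x s where Xs: "X = (x, s)" by (cases X)
  let ?x = "Dual C x"
  note h = half_braid_center[OF X]
  note facts = half_braid_simps[OF h[unfolded Xs], simplified]
  have x: "x \<in> Obj C" using facts by simp
  have ext: "s \<in> extensional (Obj C)" using X by (simp add: Xs center_def half_braiding_def)
  have raw: "(Ev C y \<otimes> Id C V \<otimes> Id C (Dual C y)) \<cdot> (Id C (Dual C y) \<otimes> mor g \<otimes> Id C (Dual C y))
      \<cdot> (Id C (Dual C y) \<otimes> Id C V \<otimes> Db C y) = mor (dual_braid y (\<lambda>_. g) V)"
    if "y \<in> Obj C" "V \<in> Obj C" "arr g" "src g = V \<odot> y" "trg g = y \<odot> V" for y V g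
  proof -
    have "dual_braid y (\<lambda>_. g) V = (((ev y ** ide V) ** ide (Dual C y))
        oo ((ide (Dual C y) ** g) ** ide (Dual C y)))
      oo ((ide (Dual C y) ** ide V) ** db y)" unfolding dual_braid_def by simp
    then show ?thesis using that by (simp del: tns_assoc cmp_assoc)
  qed
  have dc: "dual_braid y (\<lambda>_. s' V) V = dual_braid y s' V" for y s' V by (simp add: dual_braid_def)
  have m: "inv_mor C (x \<odot> V) (V \<odot> x) (s V) = mor (braid_inv X V)" for V by (simp add: braid_inv_def Xs)
  have D1: "Dual (center C) X = (?x, \<lambda>V\<in>Obj C. mor (dual_braid x (braid_inv X) V))"
    unfolding Xs center_def using raw[OF x, of _ "braid_inv X _"] facts
    by (auto simp: Xs dc m[unfolded Xs] intro!: restrict_ext)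
  note h' = half_braid_dual[OF h]
  note facts' = half_braid_simps[OF h', unfolded Xs, simplified]
  let ?g = "\<lambda>V. dual (braid_inv X (Dual C V))"
  have m': "inv_mor C (?x \<odot> V) (V \<odot> ?x) (mor (dual_braid x (braid_inv X) V)) = mor (?g V)"
    if V: "V \<in> Obj C" for V
  proof (rule inv_mor_eqI)
    have i: "dual_braid x (braid_inv X) V oo ?g V = ide (V \<odot> ?x)"
        "?g V oo dual_braid x (braid_inv X) V = ide (?x \<odot> V)"
      using half_braid_inv[OF h' V] V x by (simp_all add: Xs)
    have "mor (dual_braid x (braid_inv X) V oo ?g V) = Id C (V \<odot> ?x)"
        "mor (?g V oo dual_braid x (braid_inv X) V) = Id C (?x \<odot> V)"
      unfolding i using V x by (simp_all del: ide_tns)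
    moreover have "arr (dual_braid x (braid_inv X) V)" "arr (?g V)" using facts' V by (simp_all add: Xs)
    ultimately show "inverses C (?x \<odot> V) (V \<odot> ?x) (mor (dual_braid x (braid_inv X) V)) (mor (?g V))"
      using facts' V x arr_mor[of "dual_braid x (braid_inv X) V"] arr_mor[of "?g V"]
        unfolding inverses_def by (simp add: Xs)
  qed (use x V in simp_all)
  have "Dual (center C) (Dual (center C) X) = (x, \<lambda>V\<in>Obj C. mor (dual_braid ?x ?g V))"
    unfolding D1 unfolding center_def using raw[of ?x _ "?g _"] facts' x
    by (auto simp: Xs dc[of _ ?g, unfolded Xs] m'[unfolded Xs] intro!: restrict_ext)
  also have "\<dots> = (x, \<lambda>V\<in>Obj C. s V)"
    using dual_braid_involution[OF h] by (auto simp: Xs braid_def intro!: restrict_ext)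
  also have "\<dots> = X" using ext by (simp add: Xs extensional_restrict)
  finally show ?thesis .
qed

end

context strict_pivotal_category
begin

lemma center_sel [simp]:
  "Comp (center C) = Comp C" "TensM (center C) = TensM C" "scal (center C) = scal C"
  "Id (center C) X = Id C (fst X)" "Ev (center C) X = Ev C (fst X)" "Db (center C) X = Db C (fst X)"
  "fst (Dual (center C) X) = Dual C (fst X)" "fst (TensO (center C) X Y) = fst X \<odot> fst Y"
  by (auto simp: center_def split: prod.splits)

text \<open>
  The braiding of \<open>X\<close> with itself and its inverse are morphisms of the center, so the inverse taken in
  the center is the one of \<open>C\<close>.
\<close>

lemma drinfeld_u_eq:
  assumes X: "X \<in> Obj (center C)"
  shows "drinfeld_u C X = mor (curl (fst X) (braid_inv X))"
proof -
  obtain x s where Xs: "X = (x, s)" by (cases X)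
  note h = half_braid_center[OF X]
  note facts = half_braid_simps[OF h, unfolded Xs, simplified]
  let ?P = "TensO (center C) X X"
  have P: "?P = (x \<odot> x, \<lambda>V\<in>Obj C. mor ((braid X V ** ide x) oo (ide x ** braid X V)))"
    using facts by (auto simp: Xs center_def braid_def intro!: restrict_ext)
  have "inv_mor (center C) ?P ?P (snd X x) = mor (braid_inv X x)"
  proof (rule inv_mor_center_eqI)
    have "mor (braid X x oo braid_inv X x) = Id C (x \<odot> x)" "mor (braid_inv X x oo braid X x) = Id C (x \<odot> x)"
      using half_braid_inv[OF h, of x] facts by (simp_all add: Xs TensM_Id del: mor_cmp)
    then have i: "snd X x \<cdot> mor (braid_inv X x) = Id C (x \<odot> x)"
        "mor (braid_inv X x) \<cdot> snd X x = Id C (x \<odot> x)"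
      using facts by (simp_all add: Xs braid_def)
    have *: "mor f \<in> Hom (center C) ?P ?P"
      if f: "arr f" "src f = x \<odot> x" "trg f = x \<odot> x"
        and c: "\<And>V. V \<in> Obj C \<Longrightarrow> (ide V ** f) oo (braid X V ** ide x) oo (ide x ** braid X V)
          = (braid X V ** ide x) oo (ide x ** braid X V) oo (f ** ide V)" for f
    proof -
      have "(Id C V \<otimes> mor f) \<cdot> mor ((braid X V ** ide x) oo (ide x ** braid X V))
        = mor ((braid X V ** ide x) oo (ide x ** braid X V)) \<cdot> (mor f \<otimes> Id C V)" if V: "V \<in> Obj C" for V
      proof -
        have "mor ((ide V ** f) oo ((braid X V ** ide x) oo (ide x ** braid X V)))
          = mor (((braid X V ** ide x) oo (ide x ** braid X V)) oo (f ** ide V))" using c[OF V] by simp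
        then show ?thesis using V f facts by (subst (asm) (1 2) mor_cmp)
            (simp_all add: Xs del: cmp_assoc mor_cmp)
      qed
      then show ?thesis using arr_mor[OF f(1)] f(2,3) unfolding P by (simp add: center_def)
    qed
    have "mor (braid X x) \<in> Hom (center C) ?P ?P"
      by (rule *) (use facts central_braiding[OF h] in \<open>simp_all add: Xs\<close>)
    moreover have "mor (braid_inv X x) \<in> Hom (center C) ?P ?P"
      by (rule *) (use facts central_braiding_inv[OF h] in \<open>simp_all add: Xs\<close>)
    ultimately show "inverses (center C) ?P ?P (snd X x) (mor (braid_inv X x))"
      using i unfolding inverses_def by (simp add: braid_def Xs)
  qed (use facts in \<open>simp_all add: Xs\<close>)
  then have "drinfeld_u C X = (Ev C x \<otimes> Id C x) \<cdot> (Id C (Dual C x) \<otimes> mor (braid_inv X x))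
      \<cdot> (Db C (Dual C x) \<otimes> Id C x)"
    unfolding drinfeld_u_def Let_def center_dual_dual[OF X] by (simp add: braiding_def Xs)
  also have "\<dots> = mor (((ev x ** ide x) oo (ide (Dual C x) ** braid_inv X x)) oo (db (Dual C x) ** ide x))"
    using facts by (simp add: Xs del: cmp_assoc)
  also have "\<dots> = mor (curl x (braid_inv X))" by (simp add: curl_def ltrace_def)
  finally show ?thesis by (simp add: Xs)
qed

lemma center_inverses:
  assumes X: "X \<in> Obj (center C)"
  shows "inverses (center C) X X (mor (curl (fst X) (braid_inv X))) (mor (curl_inv (fst X) (braid X)))"
proof -
  let ?x = "fst X" and ?u = "curl (fst X) (braid_inv X)" and ?v = "curl_inv (fst X) (braid X)"
  note h = half_braid_center[OF X]
  note facts = half_braid_simps[OF h] curl_simps[OF h]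
  have eta: "Arrow ?x (mor f) ?x = f" if "arr f" "src f = ?x" "trg f = ?x" for f
    using that by (cases f) auto
  have hv: "central (braid X) (braid X) ?v" unfolding central_def
  proof
    fix V assume V: "V \<in> Obj C"
    have "(ide V ** ?v) oo braid X V = (ide V ** ?v) oo (braid X V oo (?u ** ide V)) oo (?v ** ide V)"
      using V curl_inverse(2)[OF h] by (simp add: facts flip: whiskR) (simp add: facts cmp_ide2)
    also have "braid X V oo (?u ** ide V) = (ide V ** ?u) oo braid X V" using central_curl[OF h] V
      by (simp add: central_def)
    also have "(ide V ** ?v) oo ((ide V ** ?u) oo braid X V) oo (?v ** ide V)
        = (ide V ** (?v oo ?u)) oo braid X V oo (?v ** ide V)"
      using V by (simp add: facts whisk)
    also have "\<dots> = braid X V oo (?v ** ide V)" using V curl_inverse(1)[OF h] by (simp add: facts ide2_cmp)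
    finally show "(ide V ** ?v) oo braid X V = braid X V oo (?v ** ide V)" .
  qed
  have "mor (?v oo ?u) = Id C ?x" "mor (?u oo ?v) = Id C ?x" unfolding curl_inverse[OF h]
    by (simp_all add: facts)
  then show ?thesis unfolding inverses_def center_Hom_iff[OF X X]
    using hv central_curl[OF h] by (simp add: eta facts del: arr.simps)
qed

lemma twist_inverse:
  assumes X: "X \<in> Obj (center C)"
  shows "inv_mor (center C) X X (twist C X) = mor (curl (fst X) (braid_inv X))"
proof -
  note i = center_inverses[OF X]
  note h = half_braid_center[OF X]
  note facts = half_braid_simps[OF h] curl_simps[OF h]
  have "twist C X = mor (curl_inv (fst X) (braid X)) \<cdot> Id C (fst X)"
    unfolding twist_def Let_def center_dual_dual[OF X] drinfeld_u_eq[OF X]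
    using inv_mor_center_eqI[OF _ _ i] facts by simp
  also have "\<dots> = mor (curl_inv (fst X) (braid X))"
    using Comp_Id[of "fst X" "fst X"] arr_mor[of "curl_inv (fst X) (braid X)"] facts by simp
  finally have t: "twist C X = mor (curl_inv (fst X) (braid X))" .
  have "inverses (center C) X X (mor (curl_inv (fst X) (braid X))) (mor (curl (fst X) (braid_inv X)))"
    using i by (simp add: inverses_def)
  then show ?thesis unfolding t using inv_mor_center_eqI facts by blast
qed

text \<open>
  The coupon in the diagram of \<^const>\<open>FS\<close>, with \<^term>\<open>curl\<close> in the place of the inverse twist.
\<close>

definition FS_crossing :: "('a, 'b) adjdata \<Rightarrow> ('a \<times> ('a \<Rightarrow> 'b) \<Rightarrow> 'b) \<Rightarrow> 'a \<Rightarrow> 'a \<Rightarrow> ('a, 'b) arrow" where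
  "FS_crossing A z N M = ((let K = KO A M; x = fst K in
     ((Arrow x (adj_c C A M) M oo Arrow x (z K) x) ** ide N) oo braid_inv K N oo
      (ide N ** (curl x (braid_inv K) oo Arrow M (adj_u C A M) x))))"

context
  fixes A z
  assumes A: "center_adjunction C A" and z: "natural_id_endo (center C) z"
begin

interpretation adj: center_adjunction C A "center C"
  using A .

lemma Id_center_Hom: "X \<in> Obj (center C) \<Longrightarrow> Id C (fst X) \<in> Hom (center C) X X"
proof -
  assume X: "X \<in> Obj (center C)"
  note facts = half_braid_simps[OF half_braid_center[OF X]]
  have e: "Arrow (fst X) (Id C (fst X)) (fst X) = ide (fst X)" using facts by (simp add: ide_def)
  show ?thesis unfolding center_Hom_iff[OF X X] e by (simp add: central_def facts cmp_ide2 ide2_cmp)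
qed

lemma KO_center: "M \<in> Obj C \<Longrightarrow> KO A M \<in> Obj (center C)"
  using adj.KO_Obj .

lemma adj_u_spec:
  assumes M: "M \<in> Obj C"
  shows "adj_u C A M \<in> Hom C M (fst (KO A M))" "PsiBar A M (KO A M) (adj_u C A M) = Id C (fst (KO A M))"
proof -
  have b: "bij_betw (PsiBar A M (KO A M)) (Hom C M (fst (KO A M))) (Hom (center C) (KO A M) (KO A M))"
    using adj.PsiBar_bij M KO_center by blast
  then have i: "Id C (fst (KO A M)) \<in> PsiBar A M (KO A M) ` Hom C M (fst (KO A M))"
    using Id_center_Hom[OF KO_center[OF M]] by (simp add: bij_betw_def)
  show "adj_u C A M \<in> Hom C M (fst (KO A M))" "PsiBar A M (KO A M) (adj_u C A M) = Id C (fst (KO A M))"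
    using inv_into_into[OF i] f_inv_into_f[OF i] by (simp_all add: adj_u_def)
qed

lemma adj_c_Hom:
  assumes M: "M \<in> Obj C"
  shows "adj_c C A M \<in> Hom C (fst (KO A M)) M"
  using bij_betw_apply[OF adj.Psi_bij[OF M KO_center[OF M]] Id_center_Hom[OF KO_center[OF M]]]
    by (simp add: adj_c_def)

lemma KM_Hom_C: "\<lbrakk>V \<in> Obj C; W \<in> Obj C; f \<in> Hom C V W\<rbrakk> \<Longrightarrow> KM A V W f \<in> Hom C (fst (KO A V)) (fst (KO A W))"
  using adj.KM_Hom[of V W f] center_Hom_iff[OF KO_center KO_center, of V W] by simp

text \<open>
  Both sides have the image \<open>KM f\<close> under the bijection \<^const>\<open>PsiBar\<close>.
\<close>

lemma adj_u_nat:
  assumes M: "M \<in> Obj C" "M' \<in> Obj C" and f: "f \<in> Hom C M' M"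
  shows "KM A M' M f \<cdot> adj_u C A M' = adj_u C A M \<cdot> f"
proof (rule inj_onD)
  let ?K = "KO A M" and ?K' = "KO A M'"
  note o = center_Obj_fst[OF KO_center[OF M(1)]] center_Obj_fst[OF KO_center[OF M(2)]]
  note k = KM_Hom_C[OF M(2,1) f] and u = adj_u_spec[OF M(1)] adj_u_spec[OF M(2)]
  show "inj_on (PsiBar A M' ?K) (Hom C M' (fst ?K))"
    using adj.PsiBar_bij[OF M(2) KO_center[OF M(1)]] by (simp add: bij_betw_def)
  have "PsiBar A M' ?K (Id C (fst ?K) \<cdot> adj_u C A M \<cdot> f) = Id C (fst ?K) \<cdot> Id C (fst ?K) \<cdot> KM A M' M f"
    using adj.PsiBar_natural[OF M KO_center[OF M(1)] KO_center[OF M(1)] f u(1)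
        Id_center_Hom[OF KO_center[OF M(1)]]] u by simp
  then have 1: "PsiBar A M' ?K (adj_u C A M \<cdot> f) = KM A M' M f"
    using o u k M f by (simp add: Id_Comp[of M "fst ?K"] Id_Comp[of "fst ?K"
        "fst ?K"] Id_Hom Id_Comp[of "fst ?K'" "fst ?K"])
  have "PsiBar A M' ?K (KM A M' M f \<cdot> adj_u C A M' \<cdot> Id C M')
      = KM A M' M f \<cdot> Id C (fst ?K') \<cdot> KM A M' M' (Id C M')"
    using adj.PsiBar_natural[OF M(2) M(2) KO_center[OF M(2)] KO_center[OF M(1)] Id_Hom[OF M(2)] u(3)
        adj.KM_Hom[OF M(2,1) f]] u by simp
  then have 2: "PsiBar A M' ?K (KM A M' M f \<cdot> adj_u C A M') = KM A M' M f"
    using o u k M f Comp_Hom[OF M(2) o(2,1) k u(3)] adj.KM_Id[OF M(2)]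
    by (simp add: Comp_Id[of M' "fst ?K"] Comp_Id[of "fst ?K'" "fst ?K"])
  show "PsiBar A M' ?K (KM A M' M f \<cdot> adj_u C A M') = PsiBar A M' ?K (adj_u C A M \<cdot> f)" using 1 2 by simp
  show "KM A M' M f \<cdot> adj_u C A M' \<in> Hom C M' (fst ?K)" using Comp_Hom[OF M(2) o(2,1) k u(3)] .
  show "adj_u C A M \<cdot> f \<in> Hom C M' (fst ?K)" using Comp_Hom[OF M(2,1) o(1) u(1) f] .
qed

text \<open>
  Both sides are the image of \<open>KM f\<close> under \<^const>\<open>Psi\<close>, by naturality in either argument.
\<close>

lemma adj_c_nat:
  assumes M: "M \<in> Obj C" "M' \<in> Obj C" and f: "f \<in> Hom C M' M"
  shows "adj_c C A M \<cdot> KM A M' M f = f \<cdot> adj_c C A M'"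
proof -
  let ?K = "KO A M" and ?K' = "KO A M'"
  note o = center_Obj_fst[OF KO_center[OF M(1)]] center_Obj_fst[OF KO_center[OF M(2)]]
  note k = KM_Hom_C[OF M(2,1) f] and c = adj_c_Hom[OF M(1)] adj_c_Hom[OF M(2)]
  have "Psi A ?K' M (KM A M' M f \<cdot> Id C (fst ?K') \<cdot> Id C (fst ?K')) = f \<cdot> adj_c C A M' \<cdot> Id C (fst ?K')"
    using adj.Psi_natural[OF M(2,1) KO_center[OF M(2)] KO_center[OF M(2)]
        f Id_center_Hom[OF KO_center[OF M(2)]] Id_center_Hom[OF KO_center[OF M(2)]]]
    by (simp add: adj_c_def)
  then have 1: "Psi A ?K' M (KM A M' M f) = f \<cdot> adj_c C A M'"
    using o k M f c Comp_Hom[OF o(2) M(2,1) f c(2)]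
      by (simp add: Comp_Id[of "fst ?K'" "fst ?K"] Comp_Id[of "fst ?K'" M])
  have "Psi A ?K' M (KM A M M (Id C M) \<cdot> Id C (fst ?K) \<cdot> KM A M' M f) = Id C M \<cdot> adj_c C A M \<cdot> KM A M' M f"
    using adj.Psi_natural[OF M(1,1) KO_center[OF M(1)] KO_center[OF M(2)] Id_Hom[OF M(1)]
        Id_center_Hom[OF KO_center[OF M(1)]] adj.KM_Hom[OF M(2,1) f]]
    by (simp add: adj_c_def)
  then have 2: "Psi A ?K' M (KM A M' M f) = adj_c C A M \<cdot> KM A M' M f"
    using o k M f c adj.KM_Id[OF M(1)] by (simp add: Id_Comp[of "fst ?K"
        "fst ?K"] Id_Hom Id_Comp[of "fst ?K'" "fst ?K"] Id_Comp[of "fst ?K" M])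
  show ?thesis using 1 2 by simp
qed

lemma z_Hom: "X \<in> Obj (center C) \<Longrightarrow> z X \<in> Hom C (fst X) (fst X)"
  using z center_Hom_iff[of X X "z X"] unfolding natural_id_endo_def by auto

lemma FS_crossing_parts:
  assumes M: "M \<in> Obj C"
  shows "arr (Arrow (fst (KO A M)) (adj_c C A M) M)"
      "arr (Arrow (fst (KO A M)) (z (KO A M)) (fst (KO A M)))"
    "arr (Arrow M (adj_u C A M) (fst (KO A M)))" "fst (KO A M) \<in> Obj C"
  using adj_c_Hom[OF M] adj_u_spec[OF M] z_Hom[OF KO_center[OF M]] M center_Obj_fst[OF KO_center[OF M]]
    by auto

text \<open>
  In \<open>N\<close> this is naturality of the half-braiding.  In \<open>M\<close>, a morphism passes through the unit of the
  adjunction and becomes a morphism of the center; as such it commutes with the twist, the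
  half-braiding and \<open>z\<close>, before it passes through the counit.
\<close>

lemma natural_crossing_FS: "natural_crossing (FS_crossing A z)"
  unfolding natural_crossing_def
proof (intro conjI allI impI)
  note [simp del] = arr.simps
  fix N M assume N: "N \<in> Obj C" and M: "M \<in> Obj C"
  note facts = N M FS_crossing_parts[OF M] half_braid_simps[OF half_braid_center[OF KO_center[OF M]]]
      curl_simps[OF half_braid_center[OF KO_center[OF M]]]
  show "arr (FS_crossing A z N M)" "src (FS_crossing A z N M) = N \<odot> M" "trg (FS_crossing A z N M) = M \<odot> N"
    by (simp_all add: FS_crossing_def Let_def facts)
next
  note [simp del] = arr.simps
  fix a M assume a: "arr a" and M: "M \<in> Obj C"
  let ?K = "KO A M"
  let ?x = "fst ?K" and ?s = "src a" and ?t = "trg a"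
  define c where "c = Arrow ?x (adj_c C A M) M oo Arrow ?x (z ?K) ?x"
  define b where "b = curl ?x (braid_inv ?K) oo Arrow M (adj_u C A M) ?x"
  note facts0 = a M FS_crossing_parts[OF M] half_braid_simps[OF half_braid_center[OF KO_center[OF M]]]
      curl_simps[OF half_braid_center[OF KO_center[OF M]]]
  have cb: "arr c" "src c = ?x" "trg c = M" "arr b" "src b = M" "trg b = ?x"
    by (simp_all add: c_def b_def facts0)
  note facts = facts0 cb
  have 1: "(ide M ** a) oo (c ** ide ?s) = (c ** ide ?t) oo (ide ?x ** a)" by (simp add: facts merge)
  have 2: "(a ** ide ?x) oo (ide ?s ** b) = (ide ?t ** b) oo (a ** ide M)" by (simp add: facts merge)
  have 3: "(ide ?x ** a) oo braid_inv ?K ?s = braid_inv ?K ?t oo (a ** ide ?x)"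
    by (rule half_braid_inv_nat[OF half_braid_center[OF KO_center[OF M]] a refl refl])
  show "(ide M ** a) oo FS_crossing A z (src a) M = FS_crossing A z (trg a) M oo (a ** ide M)"
    unfolding FS_crossing_def Let_def c_def[symmetric] b_def[symmetric]
    by (simp add: cmp_rewrite[OF 1] cmp_rewrite[OF 3] 2)
next
  note [simp del] = arr.simps
  fix f N assume f: "arr f" and N: "N \<in> Obj C"
  let ?M = "src f" and ?M' = "trg f"
  have M: "?M \<in> Obj C" "?M' \<in> Obj C" using f by auto
  let ?K = "KO A ?M" and ?K' = "KO A ?M'"
  let ?x = "fst ?K" and ?y = "fst ?K'"
  define k where "k = Arrow ?x (KM A ?M ?M' (mor f)) ?y"
  define c where "c = Arrow ?x (adj_c C A ?M) ?M"
  define e where "e = Arrow ?x (z ?K) ?x"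
  define u where "u = Arrow ?M (adj_u C A ?M) ?x"
  define c' where "c' = Arrow ?y (adj_c C A ?M') ?M'"
  define e' where "e' = Arrow ?y (z ?K') ?y"
  define u' where "u' = Arrow ?M' (adj_u C A ?M') ?y"
  note h = half_braid_center[OF KO_center[OF M(1)]] and h' = half_braid_center[OF KO_center[OF M(2)]]
  have kD: "KM A ?M ?M' (mor f) \<in> Hom (center C) ?K ?K'" using adj.KM_Hom[OF M arr_mor[OF f]] .
  then have k: "arr k" "src k = ?x" "trg k = ?y" "central (braid ?K) (braid ?K') k"
    unfolding center_Hom_iff[OF KO_center[OF M(1)] KO_center[OF M(2)]] k_def by simp_all
  have parts: "arr c" "src c = ?x" "trg c = ?M" "arr e" "src e = ?x" "trg e = ?x" "arr u" "src u = ?M"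
      "trg u = ?x"
      "arr c'" "src c' = ?y" "trg c' = ?M'" "arr e'" "src e' = ?y" "trg e' = ?y" "arr u'" "src u' = ?M'"
          "trg u' = ?y"
    using FS_crossing_parts[OF M(1)] FS_crossing_parts[OF M(2)]
      by (simp_all add: c_def e_def u_def c'_def e'_def u'_def)
  note facts = f N M k parts half_braid_simps[OF h] half_braid_simps[OF h'] curl_simps[OF h]
      curl_simps[OF h']
  have 1: "u' oo f = k oo u"
    by (rule arrow_eqI) (use adj_u_nat[OF M(2,1) arr_mor[OF f]]
        in \<open>simp_all add: facts\<close>, simp add: u'_def k_def u_def)
  have 2: "c' oo k = f oo c"
    by (rule arrow_eqI) (use adj_c_nat[OF M(2,1) arr_mor[OF f]]
        in \<open>simp_all add: facts\<close>, simp add: c'_def k_def c_def)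
  have "KM A ?M ?M' (mor f) \<cdot> z ?K = z ?K' \<cdot> KM A ?M ?M' (mor f)"
    using z kD KO_center[OF M(1)] KO_center[OF M(2)] unfolding natural_id_endo_def by simp
  then have 3: "e' oo k = k oo e"
    by (intro arrow_eqI) (simp_all add: facts, simp add: e'_def k_def e_def)
  have 4: "curl ?y (braid_inv ?K') oo k = k oo curl ?x (braid_inv ?K)" using curl_natural[OF h h' k] by simp
  have 5: "braid_inv ?K' N oo (ide N ** k) = (k ** ide N) oo braid_inv ?K N"
    using central_inv[OF h h' k N] .
  have T: "FS_crossing A z N ?M = (c ** ide N) oo (e ** ide N) oo braid_inv ?K N
      oo (ide N ** curl ?x (braid_inv ?K)) oo (ide N ** u)"
    unfolding FS_crossing_def Let_def c_def[symmetric] e_def[symmetric] u_def[symmetric]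
      by (simp add: facts whisk)
  have T': "FS_crossing A z N ?M' = (c' ** ide N) oo (e' ** ide N) oo braid_inv ?K' N
      oo (ide N ** curl ?y (braid_inv ?K')) oo (ide N ** u')"
    unfolding FS_crossing_def Let_def c'_def[symmetric] e'_def[symmetric] u'_def[symmetric]
      by (simp add: facts whisk)
  have "FS_crossing A z N ?M' oo (ide N ** f)
    = (c' ** ide N) oo (e' ** ide N) oo braid_inv ?K' N oo (ide N ** curl ?y (braid_inv ?K'))
        oo (ide N ** (u' oo f))"
    unfolding T' by (simp add: facts whisk)
  also have "\<dots> = (c' ** ide N) oo (e' ** ide N) oo braid_inv ?K' N
      oo (ide N ** (curl ?y (braid_inv ?K') oo k)) oo (ide N ** u)"
    unfolding 1 by (simp add: facts whisk)
  also have "\<dots> = (c' ** ide N) oo (e' ** ide N) oo (braid_inv ?K' N oo (ide N ** k))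
      oo (ide N ** curl ?x (braid_inv ?K)) oo (ide N ** u)"
    unfolding 4 by (simp add: facts whisk)
  also have "\<dots> = (c' ** ide N) oo ((e' oo k) ** ide N) oo braid_inv ?K N
      oo (ide N ** curl ?x (braid_inv ?K)) oo (ide N ** u)"
    unfolding 5 by (simp add: facts whisk)
  also have "\<dots> = ((c' oo k) ** ide N) oo (e ** ide N) oo braid_inv ?K N
      oo (ide N ** curl ?x (braid_inv ?K)) oo (ide N ** u)"
    unfolding 3 by (simp add: facts whisk)
  also have "\<dots> = (f ** ide N) oo FS_crossing A z N ?M"
    unfolding 2 T by (simp add: facts whisk)
  finally show "FS_crossing A z N (trg f) oo (ide N ** f) = (f ** ide N) oo FS_crossing A z N (src f)" .
qed

end
end

section \<open>Naturality of the Frobenius-Schur endomorphisms\<close>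

context strict_pivotal_category
begin

lemma zpow_simps:
  "zpow C V (int n) = opow V n" "V \<in> Obj C \<Longrightarrow> zpow C V (- int n) = Dual C (opow V n)"
proof -
  show "zpow C V (int n) = opow V n" by (simp add: zpow_def opow_def)
  show "zpow C V (- int n) = Dual C (opow V n)" if "V \<in> Obj C"
    unfolding Dual_opow[OF that] by (cases "n = 0") (simp_all add: zpow_def opow_def)
qed

text \<open>
  The layers of the definition of \<^const>\<open>FS\<close> differ from iterated partial traces only in the heights
  of the caps and cups.
\<close>

lemma midtrace_layers:
  assumes obj: "K \<in> Obj C" "V \<in> Obj C" "R \<in> Obj C" "A \<in> Obj C" "x \<in> Obj C"
    and f: "arr f" "src f = A \<odot> K \<odot> V \<odot> R" "trg f = x"
    and g: "arr g" "src g = x" "trg g = K \<odot> V \<odot> R \<odot> A"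
    and h: "arr h" "src h = Dual C A \<odot> x" "trg h = x \<odot> Dual C A"
  shows "midtrace K V R ((ide K ** ide V ** ide R ** ev (Dual C A))
      oo ((g ** ide (Dual C A)) oo h oo (ide (Dual C A) ** f))
      oo (db (Dual C A) ** ide K ** ide V ** ide R))
    = (ide V ** ev (Dual C R))
    oo (ev K ** ide V ** ide R ** ev (Dual C A) ** ide (Dual C R))
    oo (ide (Dual C K) ** g ** ide (Dual C A) ** ide (Dual C R))
    oo (ide (Dual C K) ** h ** ide (Dual C R))
    oo (ide (Dual C K) ** ide (Dual C A) ** f ** ide (Dual C R))
    oo (ide (Dual C K) ** db (Dual C A) ** ide K ** ide V ** ide R ** ide (Dual C R))
    oo (db (Dual C K) ** ide V ** db R)"
proof -
  note facts = obj f g h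
  have 1: "(ev K ** ide V) oo (ide (Dual C K) ** ide K ** ide V ** ev (Dual C R))
      oo (ide (Dual C K) ** ide K ** ide V ** ide R ** ev (Dual C A) ** ide (Dual C R))
    = (ide V ** ev (Dual C R)) oo (ev K ** ide V ** ide R ** ev (Dual C A) ** ide (Dual C R))"
    by (simp add: facts merge)
  have 2: "(ide (Dual C K) ** ide K ** ide V ** db R) oo (db (Dual C K) ** ide V)
      = db (Dual C K) ** ide V ** db R"
    by (simp add: facts merge)
  show ?thesis unfolding midtrace_def ltrace_def rtrace_def
    by (simp add: facts whisk 2 cmp_rewrite[OF 1, simplified])
qed

lemma FS_eq:
  assumes A: "center_adjunction C A" and z: "natural_id_endo (center C) z"
    and V: "V \<in> Obj C" and m: "k + r + 1 \<le> m"
  shows "FS C A z m k r V = mor (FS_arrow (FS_crossing A z) m k r V (ide (opow V m)))"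
proof -
  note [simp del] = arr.simps
  define n where "n = m - (k + r + 1)"
  let ?M = "opow V m" and ?A = "opow V n" and ?K = "opow V k" and ?R = "opow V r"
  let ?L = "?K \<odot> V \<odot> ?R"
  have M: "?M \<in> Obj C" using V by simp
  have rot: "?A \<odot> ?K \<odot> V \<odot> ?R = ?M" "?K \<odot> V \<odot> ?R \<odot> ?A = ?M"
    using FS_objects[OF natural_crossing_FS[OF A z] m V] V by (simp_all add: n_def)
  let ?X = "KO A ?M" let ?x = "fst ?X"
  note X = KO_center[OF A z M]
  define c where "c = Arrow ?x (adj_c C A ?M) ?M"
  define e where "e = Arrow ?x (z ?X) ?x"
  define u where "u = Arrow ?M (adj_u C A ?M) ?x"
  define t where "t = curl ?x (braid_inv ?X)"
  define h where "h = braid_inv ?X (Dual C ?A)"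
  have parts: "arr c" "src c = ?x" "trg c = ?M" "arr e" "src e = ?x" "trg e = ?x" "arr u" "src u = ?M"
      "trg u = ?x" "?x \<in> Obj C"
    "mor c = adj_c C A ?M" "mor e = z ?X" "mor u = adj_u C A ?M"
    using FS_crossing_parts[OF A z M] by (simp_all add: c_def e_def u_def)
  have tt: "arr t" "src t = ?x" "trg t = ?x" using curl_simps[OF half_braid_center[OF X]]
    by (simp_all add: t_def)
  have hh: "arr h" "src h = Dual C ?A \<odot> ?x" "trg h = ?x \<odot> Dual C ?A"
     "mor h = inv_mor C (?x \<odot> Dual C ?A) (Dual C ?A \<odot> ?x) (snd ?X (Dual C ?A))"
    using half_braid_simps(2-7)[OF half_braid_center[OF X], of "Dual C ?A"] V
      by (simp_all add: h_def, simp add: braid_inv_def)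
  define T where "T = FS_crossing A z (Dual C ?A) ?M"
  have T: "T = ((c oo e) ** ide (Dual C ?A)) oo h oo (ide (Dual C ?A) ** (t oo u))"
    by (simp add: T_def FS_crossing_def Let_def c_def e_def u_def t_def h_def)
  have Ta: "arr T" "src T = Dual C ?A \<odot> ?M" "trg T = ?M \<odot> Dual C ?A" unfolding T using parts tt hh V
    by simp_all
  have E: "coupon_closure (FS_crossing A z) ?A ?L ?M (ide ?M)
      = (ide ?K ** ide V ** ide ?R ** ev (Dual C ?A)) oo T
      oo (db (Dual C ?A) ** ide ?K ** ide V ** ide ?R)"
    unfolding coupon_closure_def crossing_closure_def T_def[symmetric]
    using V Ta M rot by (simp add: cmp_rewrite[OF ide2_cmp] cmp_ide2 ide2_cmp)
  have "FS_arrow (FS_crossing A z) m k r V (ide ?M)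
    = (ide V ** ev (Dual C ?R))
    oo (ev ?K ** ide V ** ide ?R ** ev (Dual C ?A) ** ide (Dual C ?R))
    oo (ide (Dual C ?K) ** (c oo e) ** ide (Dual C ?A) ** ide (Dual C ?R))
    oo (ide (Dual C ?K) ** h ** ide (Dual C ?R))
    oo (ide (Dual C ?K) ** ide (Dual C ?A) ** (t oo u) ** ide (Dual C ?R))
    oo (ide (Dual C ?K) ** db (Dual C ?A) ** ide ?K ** ide V ** ide ?R ** ide (Dual C ?R))
    oo (db (Dual C ?K) ** ide V ** db ?R)"
    unfolding FS_arrow_def n_def[symmetric] E T
    by (rule midtrace_layers[where x="?x"]) (use V parts tt hh rot in simp_all)
  also have "\<dots> = ((((((ide V ** ev (Dual C ?R))
    oo ((((ev ?K ** ide V) ** ide ?R) ** ev (Dual C ?A)) ** ide (Dual C ?R)))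
    oo (((ide (Dual C ?K) ** (c oo e)) ** ide (Dual C ?A)) ** ide (Dual C ?R)))
    oo ((ide (Dual C ?K) ** h) ** ide (Dual C ?R)))
    oo (((ide (Dual C ?K) ** ide (Dual C ?A)) ** (t oo u)) ** ide (Dual C ?R)))
    oo (((((ide (Dual C ?K) ** db (Dual C ?A)) ** ide ?K) ** ide V) ** ide ?R) ** ide (Dual C ?R)))
    oo ((db (Dual C ?K) ** ide V) ** db ?R)" by simp
  finally have F: "mor (FS_arrow (FS_crossing A z) m k r V (ide ?M)) = mor \<dots>" by simp
  have l: "int (k + r + 1) - int m = - int n" "int m - int (k + r + 1) = int n" using m
    by (simp_all add: n_def)
  have tw: "inv_mor (center C) ?X ?X (twist C ?X) = mor t" unfolding t_def by (rule twist_inverse[OF X])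
  have rot': "?A \<odot> (?K \<odot> (V \<odot> ?R)) = ?M" "?K \<odot> (V \<odot> (?R \<odot> ?A)) = ?M" using rot V by simp_all
  have rot'': "?A \<odot> (?K \<odot> (V \<odot> (?R \<odot> Z))) = ?M \<odot> Z" "?K \<odot> (V \<odot> (?R \<odot> (?A \<odot> Z))) = ?M \<odot> Z"
    if "Z \<in> Obj C" for Z
    using arg_cong[OF rot(1), of "\<lambda>Y. Y \<odot> Z"] arg_cong[OF rot(2), of "\<lambda>Y. Y \<odot> Z"] V that by simp_all
  show ?thesis
    unfolding F FS_def Let_def l zpow_simps(1) zpow_simps(2)[OF V] tw Evbar_def Dbbar_def
    using V parts tt hh M by (simp del: tns_assoc cmp_assoc add: rot' rot'')
qed

end

context strict_pivotal_fusion_category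
begin

text \<open>
  Let \<open>W = V \<oplus> V'\<close>.  The inclusions of \<open>V\<close> and \<open>V'\<close> and the graph \<open>V \<rightarrow> W\<close> of \<open>f\<close> are split
  monomorphisms, so \<open>FS W\<close> commutes with all of them.  Subtracting the inclusion of \<open>V\<close> from the
  graph shows that it commutes with the composite of \<open>f\<close> and the inclusion of \<open>V'\<close>.
\<close>

lemma FS_natural:
  assumes A: "center_adjunction C A" and z: "natural_id_endo (center C) z"
    and m: "k + r + 1 \<le> m" and "coprime m (k + r + 1)"
  shows "natural_id_endo C (\<lambda>V. FS C A z m k r V)"
  unfolding natural_id_endo_def
proof (intro conjI ballI)
  let ?F = "\<lambda>V. FS_arrow (FS_crossing A z) m k r V (ide (opow V m))"
  note T = natural_crossing_FS[OF A z]
  have F: "arr (?F V)" "src (?F V) = V" "trg (?F V) = V" if "V \<in> Obj C" for V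
    using FS_arrow_simps[OF T m that, of "ide (opow V m)"] that by simp_all
  show "FS C A z m k r V \<in> Hom C V V" if "V \<in> Obj C" for V
    using arr_mor[of "?F V"] F that by (simp add: FS_eq[OF A z that m])
  note mono = FS_arrow_natural_split_mono[OF T m assms(4)]
  fix V V' f assume V: "V \<in> Obj C" "V' \<in> Obj C" and f: "f \<in> Hom C V V'"
  obtain W where W: "W \<in> Obj C" "is_direct_sum2 C V V' W" using direct_sums[OF V] by blast
  then obtain \<iota> \<pi> where ip: "\<And>b. \<iota> b \<in> Hom C (if b then V else V') W"
      "\<And>b. \<pi> b \<in> Hom C W (if b then V else V')"
    "\<And>b b'. \<pi> b \<cdot> \<iota> b' = (if b = b' then Id C (if b then V else V') else 0)"
    unfolding is_direct_sum2_def is_direct_sum_def by blast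
  let ?i = "Arrow V (\<iota> True) W" and ?j = "Arrow V' (\<iota> False) W"
  let ?p = "Arrow W (\<pi> True) V" and ?q = "Arrow W (\<pi> False) V'"
  let ?f = "Arrow V f V'"
  \<comment> \<open>The graph of \<open>f\<close>, which has the projection to \<open>V\<close> as a left inverse.\<close>
  let ?g = "Arrow V (\<iota> True + \<iota> False \<cdot> f) W"
  note iT = ip(1)[of True, simplified] and iF = ip(1)[of False, simplified]
    and pT = ip(2)[of True, simplified] and pF = ip(2)[of False, simplified]
  have "vector_space (scal C)" by (rule scal)
  then interpret vector_space "scal C" .
  have jf: "\<iota> False \<cdot> f \<in> Hom C V W" using Comp_Hom[OF V(1,2) W(1) iF f] .
  have g: "\<iota> True + \<iota> False \<cdot> f \<in> Hom C V W"
    using subspace_add[OF Hom_subspace[OF V(1) W(1)] iT jf] .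
  have zero: "0 \<in> Hom C A B" if "A \<in> Obj C" "B \<in> Obj C" for A B using subspace_0[OF Hom_subspace[OF that]] .
  have z0: "0 \<cdot> f = 0" using Comp_add_left[OF V(1,2,1) zero zero f] V by simp
  have "\<pi> True \<cdot> (\<iota> True + \<iota> False \<cdot> f) = Id C V"
    using Comp_add_right[OF V(1) W(1) V(1) pT iT jf] Comp_assoc[OF V W(1) V(1) pT iF f] ip(3) z0 by simp
  then have pg: "?p oo ?g = ide V" using pT g V W by (intro arrow_eqI) auto
  have pi: "?p oo ?i = ide V" using pT iT V W ip(3)[of True True] by (intro arrow_eqI) auto
  have qj: "?q oo ?j = ide V'" using pF iF V W ip(3)[of False False] by (intro arrow_eqI) auto
  have 1: "?F W oo ?g = ?g oo ?F V" by (rule mono[where p="?p"]) (use V W pT g pg in simp_all)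
  have 2: "?F W oo ?i = ?i oo ?F V" by (rule mono[where p="?p"]) (use V W pT iT pi in simp_all)
  have 3: "?F W oo ?j = ?j oo ?F V'" by (rule mono[where p="?q"]) (use V W pF iF qj in simp_all)
  define a where "a = mor (?F V)"
  define b where "b = mor (?F V')"
  define w where "w = mor (?F W)"
  have hom: "a \<in> Hom C V V" "b \<in> Hom C V' V'" "w \<in> Hom C W W"
    using arr_mor[of "?F V"] arr_mor[of "?F V'"] arr_mor[of "?F W"] F V W
      by (simp_all add: a_def b_def w_def)
  have 1: "w \<cdot> (\<iota> True + \<iota> False \<cdot> f) = (\<iota> True + \<iota> False \<cdot> f) \<cdot> a"
    using arg_cong[OF 1, of mor] F[OF W(1)] F[OF V(1)] V W g by (simp add: a_def w_def)
  have 2: "w \<cdot> \<iota> True = \<iota> True \<cdot> a"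
    using arg_cong[OF 2, of mor] F[OF W(1)] F[OF V(1)] V W iT by (simp add: a_def w_def)
  have 3: "w \<cdot> \<iota> False = \<iota> False \<cdot> b"
    using arg_cong[OF 3, of mor] F[OF W(1)] F[OF V(2)] V W iF by (simp add: b_def w_def)
  have "w \<cdot> (\<iota> False \<cdot> f) = (\<iota> False \<cdot> f) \<cdot> a"
    using 1 2 Comp_add_right[OF V(1) W(1) W(1) hom(3) iT jf] Comp_add_left[OF V(1,1) W(1) iT jf hom(1)]
      by simp
  then have "\<iota> False \<cdot> (b \<cdot> f) = \<iota> False \<cdot> (f \<cdot> a)"
    using 3 Comp_assoc[OF V W(1,1) hom(3) iF f] Comp_assoc[OF V(1,1,2) W(1) iF f hom(1)]
      Comp_assoc[OF V(1,2,2) W(1) iF hom(2) f] by simp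
  then have "\<pi> False \<cdot> (\<iota> False \<cdot> (b \<cdot> f)) = \<pi> False \<cdot> (\<iota> False \<cdot> (f \<cdot> a))" by simp
  moreover have "\<pi> False \<cdot> (\<iota> False \<cdot> h) = h" if h: "h \<in> Hom C V V'" for h
    using Comp_assoc[OF V W(1) V(2) pF iF h] ip(3)[of False False] Id_Comp[OF V h] by simp
  ultimately have "f \<cdot> a = b \<cdot> f"
    using Comp_Hom[OF V(1,1,2) f hom(1)] Comp_Hom[OF V(1,2,2) hom(2) f] by simp
  then show "f \<cdot> FS C A z m k r V = FS C A z m k r V' \<cdot> f"
    unfolding FS_eq[OF A z V(1) m] FS_eq[OF A z V(2) m] a_def b_def .
qed

end

section \<open>Traces and rotation of morphism spaces\<close>

text \<open>
  The traces concern subspaces of one large space that contains all morphisms.  A linear map between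
  such subspaces is a function on the whole space whose values outside the subspace are arbitrary,
  so linearity is only required on the subspace.
\<close>

locale trace_space = vector_space scale
  for scale :: "'a::field \<Rightarrow> 'b::ab_group_add \<Rightarrow> 'b"
begin

definition fin_dim :: "'b set \<Rightarrow> bool" where
  "fin_dim S \<longleftrightarrow> subspace S \<and> (\<exists>B. finite B \<and> S = span B)"

definition linear_betw :: "'b set \<Rightarrow> 'b set \<Rightarrow> ('b \<Rightarrow> 'b) \<Rightarrow> bool" where
  "linear_betw S T f \<longleftrightarrow> (\<forall>x\<in>S. f x \<in> T) \<and> (\<forall>x\<in>S. \<forall>y\<in>S. f (x + y) = f x + f y)
      \<and> (\<forall>c. \<forall>x\<in>S. f (scale c x) = scale c (f x))"

definition trace_basis :: "'b set \<Rightarrow> 'b set" where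
  "trace_basis S = (SOME B. B \<subseteq> S \<and> \<not> dependent B \<and> span B = S)"

lemma trace_on_eq: "trace_on scale S T = (\<Sum>b\<in>trace_basis S. representation (trace_basis S) (T b) b)"
  by (simp add: trace_on_def trace_basis_def Let_def)

lemma trace_basis:
  assumes "fin_dim S"
  shows "trace_basis S \<subseteq> S" "independent (trace_basis S)" "span (trace_basis S) = S"
      "finite (trace_basis S)"
proof -
  obtain F where F: "finite F" "S = span F" and S: "subspace S" using assms by (auto simp: fin_dim_def)
  obtain B where "B \<subseteq> S" "independent B" "S \<subseteq> span B" using maximal_independent_subset[of S] by blast
  then have "B \<subseteq> S \<and> independent B \<and> span B = S" using span_minimal[OF _ S] by blast
  then have *: "trace_basis S \<subseteq> S \<and> independent (trace_basis S) \<and> span (trace_basis S) = S"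
    unfolding trace_basis_def by (rule someI)
  then show "trace_basis S \<subseteq> S" "independent (trace_basis S)" "span (trace_basis S) = S" by auto
  show "finite (trace_basis S)" using independent_span_bound[OF F(1), of "trace_basis S"] * F(2) by auto
qed

lemma linear_betw_sum:
  assumes f: "linear_betw S T f" and S: "subspace S" and T: "subspace T"
      and "finite D" "\<And>d. d \<in> D \<Longrightarrow> v d \<in> S"
  shows "(\<Sum>d\<in>D. scale (c d) (v d)) \<in> S \<and> f (\<Sum>d\<in>D. scale (c d) (v d)) = (\<Sum>d\<in>D. scale (c d) (f (v d)))"
  using assms(4,5)
proof (induction D rule: finite_induct)
  case empty
  have "f (scale 0 0) = scale 0 (f 0)" using f subspace_0[OF S] by (simp only: linear_betw_def)
  then show ?case using subspace_0[OF S] by simp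
next
  case (insert d D)
  then have "scale (c d) (v d) \<in> S" using subspace_scale[OF S] by simp
  then show ?case using insert f subspace_add[OF S] by (simp add: linear_betw_def)
qed

text \<open>
  Expanding in bases of \<open>S\<close> and \<open>T\<close> gives the same double sum on both sides.
\<close>

lemma trace_on_commute:
  assumes S: "fin_dim S" and T: "fin_dim T" and f: "linear_betw S T f" and g: "linear_betw T S g"
  shows "trace_on scale S (\<lambda>x. g (f x)) = trace_on scale T (\<lambda>y. f (g y))"
proof -
  have *: "representation (trace_basis S') (g' (f' b)) b
      = (\<Sum>d\<in>trace_basis T'. representation (trace_basis T') (f' b) d * representation (trace_basis S') (g' d) b)"
    if S': "fin_dim S'" and T': "fin_dim T'" and f': "linear_betw S' T' f'"
        and g': "linear_betw T' S' g'" and b: "b \<in> trace_basis S'"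
    for S' T' f' g' b
  proof -
    note B = trace_basis[OF S'] and D = trace_basis[OF T']
    let ?r = "representation (trace_basis T') (f' b)"
    have fb: "f' b \<in> T'" using f' b B by (auto simp: linear_betw_def)
    have "f' b = (\<Sum>d\<in>trace_basis T'. scale (?r d) d)"
      using sum_representation_eq[OF D(2), of "f' b" "trace_basis T'"] fb D by simp
    then have "g' (f' b) = g' (\<Sum>d\<in>trace_basis T'. scale (?r d) d)" by simp
    also have "\<dots> = (\<Sum>d\<in>trace_basis T'. scale (?r d) (g' d))"
      using linear_betw_sum[OF g' _ _ D(4), of "\<lambda>d. d" ?r] S' T' D by (auto simp: fin_dim_def)
    finally have "representation (trace_basis S') (g' (f' b)) b
        = representation (trace_basis S') (\<Sum>d\<in>trace_basis T'. scale (?r d) (g' d)) b" by simp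
    also have "\<dots> = (\<Sum>d\<in>trace_basis T'. representation (trace_basis S') (scale (?r d) (g' d)) b)"
      by (subst representation_sum[OF B(2)]) (use g' D B S' in \<open>auto simp: linear_betw_def fin_dim_def
          subspace_scale\<close>)
    also have "\<dots> = (\<Sum>d\<in>trace_basis T'. ?r d * representation (trace_basis S') (g' d) b)"
      by (rule sum.cong[OF refl], subst representation_scale[OF B(2)])
          (use g' D B in \<open>auto simp: linear_betw_def\<close>)
    finally show ?thesis .
  qed
  have "trace_on scale S (\<lambda>x. g (f x))
    = (\<Sum>b\<in>trace_basis S. \<Sum>d\<in>trace_basis T. representation (trace_basis T) (f b) d * representation (trace_basis S) (g d) b)"
    unfolding trace_on_eq by (rule sum.cong[OF refl]) (rule *[OF S T f g])
  also have "\<dots> = (\<Sum>d\<in>trace_basis T. \<Sum>b\<in>trace_basis S. representation (trace_basis S) (g d) b * representation (trace_basis T) (f b) d)"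
    by (subst sum.swap) (simp add: mult.commute)
  also have "\<dots> = trace_on scale T (\<lambda>y. f (g y))"
    unfolding trace_on_eq by (rule sum.cong[OF refl]) (rule *[OF T S g f, symmetric])
  finally show ?thesis .
qed

lemma trace_on_add:
  assumes S: "fin_dim S" and "\<And>x. x \<in> S \<Longrightarrow> f x \<in> S" "\<And>x. x \<in> S \<Longrightarrow> g x \<in> S"
  shows "trace_on scale S (\<lambda>x. f x + g x) = trace_on scale S f + trace_on scale S g"
  unfolding trace_on_eq sum.distrib[symmetric]
  using trace_basis[OF S] assms by (intro sum.cong refl) (auto simp: representation_add subset_iff)

lemma trace_on_cong:
  assumes S: "fin_dim S" and "\<And>x. x \<in> S \<Longrightarrow> f x = g x"
  shows "trace_on scale S f = trace_on scale S g"
  unfolding trace_on_eq using trace_basis[OF S] assms by (intro sum.cong refl) auto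

end

context strict_pivotal_category
begin

text \<open>
  The map that defines the indicator, for a target \<open>A \<otimes> B\<close> with arbitrary factors: the strand \<open>A\<close> is
  moved from the left end to the right end, passing through the half-braiding.
\<close>

definition GFS_rotate where
  "GFS_rotate X A B f = (ev A ** ide B ** ide A) oo (ide (Dual C A) ** f ** ide A)
      oo (braid X (Dual C A) ** ide A)
    oo (ide (fst X) ** db (Dual C A))"

lemma GFS_rotate_simps:
  assumes X: "X \<in> Obj (center C)" and "A \<in> Obj C" "B \<in> Obj C" "arr f" "src f = fst X" "trg f = A \<odot> B"
  shows "arr (GFS_rotate X A B f)" "src (GFS_rotate X A B f) = fst X" "trg (GFS_rotate X A B f) = B \<odot> A"
  using assms half_braid_simps[OF half_braid_center[OF X]] by (simp_all add: GFS_rotate_def)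

text \<open>
  The morphism \<open>a\<close> travels down the left leg of the cap as its dual, through the half-braiding by
  naturality, and up again on the right leg of the cup.
\<close>

lemma GFS_rotate_nat:
  assumes X: "X \<in> Obj (center C)" and a: "arr a" "src a = A" "trg a = A'"
      and b: "arr b" "src b = B" "trg b = B'"
    and f: "arr f" "src f = fst X" "trg f = A \<odot> B"
  shows "GFS_rotate X A' B' ((a ** b) oo f) = (b ** a) oo GFS_rotate X A B f"
proof -
  note h = half_braid_center[OF X]
  let ?x = "fst X" and ?A = "Dual C A" and ?A' = "Dual C A'" and ?s = "braid X"
  have obj: "A \<in> Obj C" "A' \<in> Obj C" "B \<in> Obj C" "B' \<in> Obj C"
    using arr_Obj[OF a(1)] arr_Obj[OF b(1)] a b by simp_all
  note facts = half_braid_simps[OF h] a b f obj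
  have 0: "(ev A' ** ide B' ** ide A') oo (ide ?A' ** a ** b ** ide A')
      = (ev A ** b ** ide A') oo (dual a ** ide A ** ide B ** ide A')"
  proof -
    have "(ev A' ** ide B' ** ide A') oo (ide ?A' ** a ** b ** ide A')
        = (ev A' oo (ide ?A' ** a)) ** b ** ide A'"
      by (simp add: facts merge)
    also have "\<dots> = (ev A ** b ** ide A') oo (dual a ** ide A ** ide B ** ide A')"
      unfolding ev_slide[OF a] by (simp add: facts merge)
    finally show ?thesis .
  qed
  have 1: "(dual a ** ide A ** ide B ** ide A') oo (ide ?A' ** f ** ide A')
      = (ide ?A ** f ** ide A') oo (dual a ** ide ?x ** ide A')"
    using interchange[of "dual a" "ide A ** ide B ** ide A'" "ide ?A'" "f ** ide A'"]
      interchange[of "ide ?A" "f ** ide A'" "dual a" "ide ?x ** ide A'"]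
    by (simp add: facts merge)
  have 2: "(dual a ** ide ?x) oo ?s ?A' = ?s ?A oo (ide ?x ** dual a)"
    using half_braid_nat[OF h, of "dual a"] by (simp add: facts)
  have 3: "(ev A ** b ** ide A') oo (ide ?A ** f ** ide A') oo (?s ?A ** ide A') oo (ide ?x ** ide ?A ** a)
    = (b ** a) oo (ev A ** ide B ** ide A) oo (ide ?A ** f ** ide A) oo (?s ?A ** ide A)"
  proof -
    have 31: "(?s ?A ** ide A') oo (ide ?x ** ide ?A ** a) = (ide ?A ** ide ?x ** a) oo (?s ?A ** ide A)"
      by (simp add: facts merge)
    have 32: "(ide ?A ** f ** ide A') oo (ide ?A ** ide ?x ** a)
        = (ide ?A ** ide A ** ide B ** a) oo (ide ?A ** f ** ide A)"
      by (simp add: facts merge)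
    have 33: "(ev A ** b ** ide A') oo (ide ?A ** ide A ** ide B ** a)
        = (b ** a) oo (ev A ** ide B ** ide A)"
      by (simp add: facts merge)
    show ?thesis by (simp add: facts 31 cmp_rewrite[OF 32] cmp_rewrite[OF 33])
  qed
  have "GFS_rotate X A' B' ((a ** b) oo f)
    = ((ev A' ** ide B' ** ide A') oo (ide ?A' ** a ** b ** ide A')) oo (ide ?A' ** f ** ide A')
        oo (?s ?A' ** ide A') oo (ide ?x ** db ?A')"
    unfolding GFS_rotate_def by (simp add: facts whisk)
  also have "\<dots> = (ev A ** b ** ide A') oo (ide ?A ** f ** ide A')
      oo (((dual a ** ide ?x) oo ?s ?A') ** ide A') oo (ide ?x ** db ?A')"
    unfolding 0 by (simp add: facts whisk cmp_rewrite[OF 1])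
  also have "\<dots> = (ev A ** b ** ide A') oo (ide ?A ** f ** ide A') oo (?s ?A ** ide A')
      oo (ide ?x ** ((dual a ** ide A') oo db ?A'))"
    unfolding 2 by (simp add: facts whisk)
  also have "\<dots> = ((ev A ** b ** ide A') oo (ide ?A ** f ** ide A') oo (?s ?A ** ide A')
      oo (ide ?x ** ide ?A ** a)) oo (ide ?x ** db ?A)"
    unfolding dbbar_slide[OF a, symmetric] by (simp add: facts whisk)
  also have "\<dots> = (b ** a) oo GFS_rotate X A B f"
    unfolding 3 GFS_rotate_def by simp
  finally show ?thesis .
qed

abbreviation GFS_arrow where "GFS_arrow X m l V f \<equiv> GFS_rotate X (opow V l) (opow V (m - l)) (Arrow (fst X) f (opow V m))"

lemma opow_split: "V \<in> Obj C \<Longrightarrow> l \<le> m \<Longrightarrow> opow V m = opow V l \<odot> opow V (m - l)" "V \<in> Obj C \<Longrightarrow> l \<le> m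
    \<Longrightarrow> opow V m = opow V (m - l) \<odot> opow V l"
  using opow_add[of V l "m - l"] opow_add[of V "m - l" l] by auto

lemma GFS_map_eq:
  assumes X: "X \<in> Obj (center C)" and V: "V \<in> Obj C" and l: "l \<le> m" and f: "f \<in> Hom C (fst X) (opow V m)"
  shows "GFS_map C X m l V f = mor (GFS_arrow X m l V f)"
    and "arr (GFS_arrow X m l V f)" "src (GFS_arrow X m l V f) = fst X"
        "trg (GFS_arrow X m l V f) = opow V m"
proof -
  let ?x = "fst X"
  note [simp del] = arr.simps
  note facts = half_braid_simps[OF half_braid_center[OF X]] V
  let ?f = "Arrow ?x f (opow V m)"
  have f': "arr ?f" using f facts by (simp add: arr.simps)
  have t: "opow V m = opow V l \<odot> opow V (m - l)" using opow_split[OF V l] by simp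
  have t': "opow V (m - l) \<odot> opow V l = opow V m" using opow_split[OF V l] by simp
  show "arr (GFS_arrow X m l V f)" "src (GFS_arrow X m l V f) = ?x" "trg (GFS_arrow X m l V f) = opow V m"
    using GFS_rotate_simps[OF X, of "opow V l" "opow V (m - l)" ?f] f' facts t t' by simp_all
  have "GFS_arrow X m l V f = ((((ev (opow V l) ** ide (opow V m))
      oo ((ide (Dual C (opow V l)) ** ?f) ** ide (opow V l)))
     oo (braid X (Dual C (opow V l)) ** ide (opow V l))) oo (ide ?x ** db (Dual C (opow V l))))"
    unfolding GFS_rotate_def using V by (simp add: ide_tns[symmetric] t' del: ide_tns)
  moreover have "opow V l \<odot> (opow V (m - l) \<odot> opow V l) = opow V m \<odot> opow V l" using V by (simp add: t)
  ultimately show "GFS_map C X m l V f = mor (GFS_arrow X m l V f)"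
    unfolding GFS_map_def zpow_simps(1) zpow_simps(2)[OF V] Dbbar_def
    using f' facts t' by (simp del: tns_assoc cmp_assoc) (simp add: braid_def)
qed

end

section \<open>Additivity of the indicators\<close>

context strict_pivotal_fusion_category
begin

lemma trace_space_scal: "trace_space (scal C)"
  using scal by (simp add: trace_space_def)

lemma fin_dim_Hom: "V \<in> Obj C \<Longrightarrow> W \<in> Obj C \<Longrightarrow> trace_space.fin_dim (scal C) (Hom C V W)"
  using Hom_subspace Hom_finite_dim trace_space.fin_dim_def[OF trace_space_scal] by blast

lemma linear_betw_comp:
  assumes "U \<in> Obj C" "V \<in> Obj C" "W \<in> Obj C" "p \<in> Hom C V W"
  shows "trace_space.linear_betw (scal C) (Hom C U V) (Hom C U W) (\<lambda>f. p \<cdot> f)"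
  unfolding trace_space.linear_betw_def[OF trace_space_scal]
  using Comp_Hom[OF assms] Comp_add_right[OF assms] Comp_scal_right[OF assms] by auto

lemma linear_betw_trans:
  assumes "trace_space.linear_betw (scal C) S T f" "trace_space.linear_betw (scal C) T U g"
  shows "trace_space.linear_betw (scal C) S U (\<lambda>x. g (f x))"
  using assms unfolding trace_space.linear_betw_def[OF trace_space_scal] by auto

lemma GFS_map_linear:
  assumes X: "X \<in> Obj (center C)" and V: "V \<in> Obj C" and l: "l \<le> m"
  shows "trace_space.linear_betw (scal C) (Hom C (fst X) (opow V m)) (Hom C (fst X) (opow V m)) (GFS_map C X m l V)"
  unfolding trace_space.linear_betw_def[OF trace_space_scal]
proof (intro conjI ballI allI)
  let ?x = "fst X" and ?M = "opow V m" and ?l = "opow V l" and ?l' = "Dual C (opow V l)"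
  note facts = half_braid_simps[OF half_braid_center[OF X]] V
  have M: "?M \<in> Obj C" "?l \<in> Obj C" "?l' \<in> Obj C" "?x \<in> Obj C" using V facts by simp_all
  let ?P = "Ev C ?l \<otimes> Id C ?M" and ?Q = "braid X ?l' ** ide ?l" and ?R = "Id C ?x \<otimes> Db C ?l'"
  have eq: "GFS_map C X m l V f = ?P \<cdot> (Id C ?l' \<otimes> f \<otimes> Id C ?l) \<cdot> mor ?Q \<cdot> mor (ide ?x ** db ?l')" for f
    unfolding GFS_map_def zpow_simps(1) zpow_simps(2)[OF V] Dbbar_def using facts M by (simp add: braid_def)
  have LM: "?l \<odot> ?M = ?M \<odot> ?l"
    using opow_add[OF V, of l m] opow_add[OF V, of m l] by (simp only: add.commute)
  have P: "?P \<in> Hom C (?l' \<odot> ?M \<odot> ?l) ?M"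
    using arr_mor[of "ev ?l ** ide ?M"] M LM by simp
  have Q: "mor ?Q \<in> Hom C (?x \<odot> ?l' \<odot> ?l) (?l' \<odot> ?x \<odot> ?l)"
    using arr_mor[of ?Q] facts M by simp
  have R: "mor (ide ?x ** db ?l') \<in> Hom C ?x (?x \<odot> ?l' \<odot> ?l)"
    using arr_mor[of "ide ?x ** db ?l'"] facts M by simp
  have I: "Id C ?l' \<in> Hom C ?l' ?l'" "Id C ?l \<in> Hom C ?l ?l" using M Id_Hom by auto
  have F: "Id C ?l' \<otimes> f \<otimes> Id C ?l \<in> Hom C (?l' \<odot> ?x \<odot> ?l) (?l' \<odot> ?M \<odot> ?l)" if "f \<in> Hom C ?x ?M" for f
    using TensM_Hom[OF _ _ M(2,2) TensM_Hom[OF M(3,3,4,1) I(1) that] I(2)] M by simp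
  have obj: "?l' \<odot> ?M \<odot> ?l \<in> Obj C" "?l' \<odot> ?x \<odot> ?l \<in> Obj C" "?x \<odot> ?l' \<odot> ?l \<in> Obj C" using M by auto
  fix f assume f: "f \<in> Hom C ?x ?M"
  note PF = Comp_Hom[OF obj(2,1) M(1) P F]
  note PFQ = Comp_Hom[OF obj(3,2) M(1) PF Q]
  show "GFS_map C X m l V f \<in> Hom C ?x ?M"
    unfolding eq by (rule Comp_Hom[OF M(4) obj(3) M(1) PFQ[OF f] R])
  show "GFS_map C X m l V (f + g) = GFS_map C X m l V f + GFS_map C X m l V g" if g: "g \<in> Hom C ?x ?M" for g
  proof -
    have "Id C ?l' \<otimes> (f + g) \<otimes> Id C ?l = Id C ?l' \<otimes> f \<otimes> Id C ?l + Id C ?l' \<otimes> g \<otimes> Id C ?l"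
      using TensM_add_right[OF M(3,3,4,1) I(1) f g]
          TensM_add_left[OF _ _ M(2,2) TensM_Hom[OF M(3,3,4,1) I(1) f] TensM_Hom[OF M(3,3,4,1) I(1) g]
          I(2)] M
      by simp
    then show ?thesis unfolding eq
      using Comp_add_right[OF obj(2,1) M(1) P F[OF f] F[OF g]]
        Comp_add_left[OF obj(3,2) M(1) PF[OF f] PF[OF g] Q]
            Comp_add_left[OF M(4) obj(3) M(1) PFQ[OF f] PFQ[OF g] R] by simp
  qed
  show "GFS_map C X m l V (scal C c f) = scal C c (GFS_map C X m l V f)" for c
  proof -
    have "Id C ?l' \<otimes> (scal C c f) \<otimes> Id C ?l = scal C c (Id C ?l' \<otimes> f \<otimes> Id C ?l)"
      using TensM_scal_right[OF M(3,3,4,1) I(1) f]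
          TensM_scal_left[OF _ _ M(2,2) TensM_Hom[OF M(3,3,4,1) I(1) f] I(2)] M
      by simp
    then show ?thesis unfolding eq
      using Comp_scal_right[OF obj(2,1) M(1) P F[OF f]]
        Comp_scal_left[OF obj(3,2) M(1) PF[OF f] Q] Comp_scal_left[OF M(4) obj(3) M(1) PFQ[OF f] R] by simp
  qed
qed

lemma GFS_map_natural:
  assumes X: "X \<in> Obj (center C)" and l: "l \<le> m" and V: "V \<in> Obj C" "W \<in> Obj C"
    and a: "arr a" "src a = opow V l" "trg a = opow W l"
        and b: "arr b" "src b = opow V (m - l)" "trg b = opow W (m - l)"
    and f: "f \<in> Hom C (fst X) (opow V m)"
  shows "GFS_map C X m l W (mor (a ** b) \<cdot> f) = mor (b ** a) \<cdot> GFS_map C X m l V f"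
proof -
  note [simp del] = arr.simps
  let ?x = "fst X" and ?f = "Arrow (fst X) f (opow V m)"
  note facts = half_braid_simps[OF half_braid_center[OF X]] V a b
  have f': "arr ?f" using f facts by (simp add: arr.simps)
  have 1: "(a ** b) oo ?f = Arrow ?x (mor (a ** b) \<cdot> f) (opow W m)"
    using f' a b opow_split[OF V(1) l] opow_split[OF V(2) l] by (simp add: cmp_def)
  have g: "mor (a ** b) \<cdot> f \<in> Hom C ?x (opow W m)"
    using arr_mor[of "(a ** b) oo ?f"] f' a b opow_split[OF V(1) l] opow_split[OF V(2) l] by simp
  have "GFS_arrow X m l W (mor (a ** b) \<cdot> f) = (b ** a) oo GFS_arrow X m l V f"
    using GFS_rotate_nat[OF X a b, of ?f] f' opow_split[OF V(1) l] unfolding 1 by simp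
  then show ?thesis
    unfolding GFS_map_eq(1)[OF X V(2) l g] GFS_map_eq(1)[OF X V(1) l f]
    using GFS_map_eq(2-4)[OF X V(1) l f] a b opow_split(2)[OF V(1) l] by simp
qed

lemma GFS_mpow:
  assumes X: "X \<in> Obj (center C)" and l: "l \<le> m" and i: "arr i" "src i = V" "trg i = W"
    and f: "f \<in> Hom C (fst X) (opow V m)"
  shows "GFS_map C X m l W (mor (mpow i m) \<cdot> f) = mor (mpow i m) \<cdot> GFS_map C X m l V f"
proof -
  have V: "V \<in> Obj C" "W \<in> Obj C" using i by auto
  have "mpow i m = mpow i l ** mpow i (m - l)" "mpow i m = mpow i (m - l) ** mpow i l"
    using mprod_add[of l "m - l" "\<lambda>_. i"] mprod_add[of "m - l" l "\<lambda>_. i"] l i by simp_all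
  then show ?thesis using GFS_map_natural[OF X l V, of "mpow i l" "mpow i (m - l)" f] i f by simp
qed

lemma GFS_at_pos:
  assumes X: "X \<in> Obj (center C)" and l: "l \<le> m" and e: "arr e" "src e = W" "trg e = W"
    and j: "j < m" and f: "f \<in> Hom C (fst X) (opow W m)"
  shows "GFS_map C X m l W (mor (at_pos e {j} m) \<cdot> f)
      = mor (at_pos e {(j + (m - l)) mod m} m) \<cdot> GFS_map C X m l W f"
proof -
  have W: "W \<in> Obj C" using e by auto
  have at_pos: "arr (at_pos e Q n)" "src (at_pos e Q n) = opow W n" "trg (at_pos e Q n) = opow W n" for Q n
    using e at_pos_simps[of e Q n] by auto
  show ?thesis
  proof (cases "j < l")
    case True
    then show ?thesis unfolding at_pos_rotation(1,2)[OF e l True]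
      using GFS_map_natural[OF X l W W, of "at_pos e {j} l" "ide (opow W (m - l))" f] at_pos W f by simp
  next
    case False
    then have j': "l \<le> j" by simp
    then show ?thesis unfolding at_pos_rotation(3,4)[OF e l j' j]
      using GFS_map_natural[OF X l W W, of "ide (opow W l)" "at_pos e {j - l} (m - l)" f] at_pos W f by simp
  qed
qed

text \<open>
  Let \<open>\<phi> q\<close> be the trace of the rotation map after composition with \<open>q\<close>.  Cyclicity of the trace and
  compatibility of the rotation map with insertions allow the idempotent \<open>i \<cdot> p\<close> to spread to all
  positions; then a second use of cyclicity moves the trace from \<open>W\<close> to \<open>V\<close>.
\<close>

lemma GFS_idempotent_part:
  assumes X: "X \<in> Obj (center C)" and l: "l \<le> m" "0 < m" "coprime m l"
    and i: "arr i" "src i = V" "trg i = W" and p: "arr p" "src p = W" "trg p = V" and pi: "p oo i = ide V"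
  shows "trace_on (scal C) (Hom C (fst X) (opow W m)) (\<lambda>f. GFS_map C X m l W (mor (at_pos (i
      oo p) {(0 + (m - l)) mod m} m) \<cdot> f))
    = GFS_indicator C X m l V"
proof -
  interpret trace_space "scal C" by (rule trace_space_scal)
  have V: "V \<in> Obj C" and W: "W \<in> Obj C" and x: "fst X \<in> Obj C"
    using i half_braid_simps(1)[OF half_braid_center[OF X]] by auto
  let ?e = "i oo p" and ?G = "GFS_map C X m l" and ?S = "Hom C (fst X) (opow W m)"
      and ?S' = "Hom C (fst X) (opow V m)"
  define \<phi> where "\<phi> q = trace_on (scal C) ?S (\<lambda>f. ?G W (mor q \<cdot> f))" for q :: "('a, 'b) arrow"
  have e: "arr ?e" "src ?e = W" "trg ?e = W" using i p by auto
  have idem: "?e oo ?e = ?e" using pi i p by (simp add: cmp_rewrite[OF pi])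
  have cop: "coprime (m - l) m" by (rule coprime_gap[OF l(3,1)])
  note finS = fin_dim_Hom[OF x, of "opow W m"] and finS' = fin_dim_Hom[OF x, of "opow V m"]
  have "\<phi> (at_pos ?e {(0 + (m - l)) mod m} m) = \<phi> (mpow ?e m)"
  proof (rule idempotent_spreads[OF e idem cop l(2)])
    fix j q assume j: "j < m" and q: "arr q" "src q = opow W m" "trg q = opow W m"
    let ?P = "at_pos ?e {j} m" and ?P' = "at_pos ?e {(j + (m - l)) mod m} m"
    have P: "arr ?P" "src ?P = opow W m" "trg ?P = opow W m" "arr ?P'" "src ?P' = opow W m"
        "trg ?P' = opow W m"
      using at_pos_simps[of ?e] e by auto
    note homs = arr_mor[OF P(1), unfolded P(2,3)] arr_mor[OF P(4), unfolded P(5,6)]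
        arr_mor[OF q(1), unfolded q(2,3)]
    have M: "opow W m \<in> Obj C" using W by simp
    have "\<phi> (?P oo q) = trace_on (scal C) ?S (\<lambda>f. mor ?P' \<cdot> ?G W (mor q \<cdot> f))"
      unfolding \<phi>_def
    proof (rule trace_on_cong[OF finS[OF M]])
      fix f assume f: "f \<in> ?S"
      have qf: "mor q \<cdot> f \<in> ?S" by (rule Comp_Hom[OF x M M homs(3) f])
      have "mor (?P oo q) \<cdot> f = mor ?P \<cdot> (mor q \<cdot> f)"
        using Comp_assoc[OF x M M M homs(1,3) f] P q by simp
      then show "?G W (mor (?P oo q) \<cdot> f) = mor ?P' \<cdot> ?G W (mor q \<cdot> f)"
        using GFS_at_pos[OF X l(1) e j qf] by simp
    qed
    also have "\<dots> = trace_on (scal C) ?S (\<lambda>f. ?G W (mor q \<cdot> (mor ?P' \<cdot> f)))"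
      by (rule trace_on_commute[OF finS[OF M] finS[OF M]
          linear_betw_trans[OF linear_betw_comp[OF x M M homs(3)] GFS_map_linear[OF X W l(1)]]
          linear_betw_comp[OF x M M homs(2)]])
    also have "\<dots> = \<phi> (q oo ?P')"
      unfolding \<phi>_def
    proof (rule trace_on_cong[OF finS[OF M]])
      fix f assume f: "f \<in> ?S"
      show "?G W (mor q \<cdot> (mor ?P' \<cdot> f)) = ?G W (mor (q oo ?P') \<cdot> f)"
        using Comp_assoc[OF x M M M homs(3,2) f] P q by simp
    qed
    finally show "\<phi> (?P oo q) = \<phi> (q oo ?P')" .
  qed
  also have "\<phi> (mpow ?e m) = GFS_indicator C X m l V"
  proof -
    have M: "opow W m \<in> Obj C" "opow V m \<in> Obj C" using V W by simp_all
    have pin: "mpow p m oo mpow i m = ide (opow V m)"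
      using mprod_cmp[of m "\<lambda>_. p" W V "\<lambda>_. i" V] i p V W pi mprod_ide[OF V, of m] by simp
    have ipn: "mpow ?e m = mpow i m oo mpow p m"
      using mprod_cmp[of m "\<lambda>_. i" V W "\<lambda>_. p" W] i p V W by simp
    have hi: "mor (mpow i m) \<in> Hom C (opow V m) (opow W m)"
        and hp: "mor (mpow p m) \<in> Hom C (opow W m) (opow V m)"
      using arr_mor[of "mpow i m"] arr_mor[of "mpow p m"] i p by auto
    have pim: "mor (mpow p m) \<cdot> mor (mpow i m) = Id C (opow V m)"
      using arg_cong[OF pin, of mor] i p M by simp
    have "\<phi> (mpow ?e m) = trace_on (scal C) ?S (\<lambda>f. mor (mpow i m) \<cdot> ?G V (mor (mpow p m) \<cdot> f))"
      unfolding \<phi>_def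
    proof (rule trace_on_cong[OF finS[OF M(1)]])
      fix f assume f: "f \<in> ?S"
      have pf: "mor (mpow p m) \<cdot> f \<in> ?S'" by (rule Comp_Hom[OF x M hp f])
      have "mor (mpow ?e m) \<cdot> f = mor (mpow i m) \<cdot> (mor (mpow p m) \<cdot> f)"
        using Comp_assoc[OF x M(1,2,1) hi hp f] i p unfolding ipn by simp
      then show "?G W (mor (mpow ?e m) \<cdot> f) = mor (mpow i m) \<cdot> ?G V (mor (mpow p m) \<cdot> f)"
        using GFS_mpow[OF X l(1) i pf] by simp
    qed
    also have "\<dots> = trace_on (scal C) ?S' (\<lambda>f. ?G V (mor (mpow p m) \<cdot> (mor (mpow i m) \<cdot> f)))"
      by (rule trace_on_commute[OF finS[OF M(1)] finS'[OF M(2)]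
          linear_betw_trans[OF linear_betw_comp[OF x M hp] GFS_map_linear[OF X V l(1)]]
          linear_betw_comp[OF x M(2,1) hi]])
    also have "\<dots> = trace_on (scal C) ?S' (?G V)"
    proof (rule trace_on_cong[OF finS'[OF M(2)]])
      fix f assume f: "f \<in> ?S'"
      show "?G V (mor (mpow p m) \<cdot> (mor (mpow i m) \<cdot> f)) = ?G V f"
        using Comp_assoc[OF x M(2,1,2) hp hi f] pim Id_Comp[OF x M(2) f] by simp
    qed
    finally show ?thesis unfolding GFS_indicator_def zpow_simps(1) .
  qed
  finally show ?thesis by (simp add: \<phi>_def)
qed

text \<open>
  The identity of \<open>W\<^sup>m\<close> is the sum of the two idempotents of the direct sum in any single position;
  each of them contributes the indicator of its image.
\<close>

lemma GFS_additive:
  assumes X: "X \<in> Obj (center C)" and l: "l \<le> m" "0 < m" "coprime m l"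
    and V: "U \<in> Obj C" "V \<in> Obj C" "W \<in> Obj C" "is_direct_sum2 C U V W"
  shows "GFS_indicator C X m l W = GFS_indicator C X m l U + GFS_indicator C X m l V"
proof -
  interpret trace_space "scal C" by (rule trace_space_scal)
  have x: "fst X \<in> Obj C" using half_braid_simps(1)[OF half_braid_center[OF X]] .
  obtain \<iota> \<pi> where ip: "\<And>b. \<iota> b \<in> Hom C (if b then U else V) W" "\<And>b. \<pi> b \<in> Hom C W (if b then U else V)"
    "\<And>b b'. \<pi> b \<cdot> \<iota> b' = (if b = b' then Id C (if b then U else V) else 0)"
    and sum: "(\<Sum>b\<in>UNIV. \<iota> b \<cdot> \<pi> b) = Id C W"
    using V(4) unfolding is_direct_sum2_def is_direct_sum_def by blast
  let ?i = "Arrow U (\<iota> True) W" and ?j = "Arrow V (\<iota> False) W"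
  let ?p = "Arrow W (\<pi> True) U" and ?q = "Arrow W (\<pi> False) V"
  note iT = ip(1)[of True, simplified] and iF = ip(1)[of False, simplified]
    and pT = ip(2)[of True, simplified] and pF = ip(2)[of False, simplified]
  have pi: "?p oo ?i = ide U" using pT iT V ip(3)[of True True] by (intro arrow_eqI) auto
  have qj: "?q oo ?j = ide V" using pF iF V ip(3)[of False False] by (intro arrow_eqI) auto
  let ?c = "(0 + (m - l)) mod m"
  let ?S = "Hom C (fst X) (opow W m)" and ?G = "GFS_map C X m l W"
  have c: "?c < m" using l by simp
  let ?P = "at_pos (?i oo ?p) {?c} m" and ?Q = "at_pos (?j oo ?q) {?c} m"
  have e: "arr (?i oo ?p)" "src (?i oo ?p) = W" "trg (?i oo ?p) = W" "arr (?j oo ?q)"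
      "src (?j oo ?q) = W" "trg (?j oo ?q) = W"
    using iT iF pT pF V by auto
  have P: "arr ?P" "src ?P = opow W m" "trg ?P = opow W m" "arr ?Q" "src ?Q = opow W m" "trg ?Q = opow W m"
    using at_pos_simps[of "?i oo ?p"] at_pos_simps[of "?j oo ?q"] e by auto
  have M: "opow W m \<in> Obj C" using V by simp
  note homs = arr_mor[OF P(1), unfolded P(2,3)] arr_mor[OF P(4), unfolded P(5,6)]
  have PQ: "mor ?P + mor ?Q = Id C (opow W m)"
  proof -
    let ?a = "opow W ?c" and ?b = "opow W (m - Suc ?c)"
    have cc: "?c + Suc (m - Suc ?c) = m" using c by linarith
    have ab: "?a \<in> Obj C" "?b \<in> Obj C" using V by simp_all
    have hs: "\<iota> True \<cdot> \<pi> True \<in> Hom C W W" "\<iota> False \<cdot> \<pi> False \<in> Hom C W W"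
      using Comp_Hom[OF V(3,1,3) iT pT] Comp_Hom[OF V(3,2,3) iF pF] .
    note Ia = Id_Hom[OF ab(1)] and Ib = Id_Hom[OF ab(2)]
    have braid: "g \<otimes> Id C ?b \<in> Hom C (W \<odot> ?b) (W \<odot> ?b)" if "g \<in> Hom C W W" for g
      by (rule TensM_Hom[OF V(3,3) ab(2,2) that Ib])
    have Wb: "W \<odot> ?b \<in> Obj C" using V ab by simp
    have "mor ?P + mor ?Q = Id C ?a \<otimes> ((\<iota> True \<cdot> \<pi> True) \<otimes> Id C ?b)
        + Id C ?a \<otimes> ((\<iota> False \<cdot> \<pi> False) \<otimes> Id C ?b)"
      unfolding at_pos_single[OF e(1-3) c] at_pos_single[OF e(4-6) c] using ab V iT iF pT pF by simp
    also have "\<dots> = Id C ?a \<otimes> ((\<iota> True \<cdot> \<pi> True + \<iota> False \<cdot> \<pi> False) \<otimes> Id C ?b)"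
      using TensM_add_right[OF ab(1,1) Wb Wb Ia braid[OF hs(1)] braid[OF hs(2)]]
          TensM_add_left[OF V(3,3) ab(2,2) hs Ib] by simp
    also have "\<dots> = Id C ?a \<otimes> (Id C W \<otimes> Id C ?b)" using sum by (simp add: UNIV_bool add.commute)
    also have "\<dots> = Id C (?a \<odot> (W \<odot> ?b))" using V ab Wb by (simp add: TensM_Id)
    also have "?a \<odot> (W \<odot> ?b) = opow W m"
      using opow_add[OF V(3), of ?c "Suc (m - Suc ?c)"] cc by (simp add: opow_Suc del: add_Suc_right)
    finally show ?thesis .
  qed
  have "GFS_indicator C X m l W = trace_on (scal C) ?S ?G"
    by (simp add: GFS_indicator_def zpow_simps(1))
  also have "\<dots> = trace_on (scal C) ?S (\<lambda>f. ?G (mor ?P \<cdot> f) + ?G (mor ?Q \<cdot> f))"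
  proof (rule trace_on_cong[OF fin_dim_Hom[OF x M]])
    fix f assume f: "f \<in> ?S"
    have "f = mor ?P \<cdot> f + mor ?Q \<cdot> f"
      using Comp_add_left[OF x M M homs f] Id_Comp[OF x M f] unfolding PQ by simp
    then have "?G f = ?G (mor ?P \<cdot> f + mor ?Q \<cdot> f)" by simp
    also have "\<dots> = ?G (mor ?P \<cdot> f) + ?G (mor ?Q \<cdot> f)"
      using GFS_map_linear[OF X V(3) l(1)] Comp_Hom[OF x M M homs(1) f] Comp_Hom[OF x M M homs(2) f]
        unfolding linear_betw_def by blast
    finally show "?G f = ?G (mor ?P \<cdot> f) + ?G (mor ?Q \<cdot> f)" .
  qed
  also have "\<dots> = trace_on (scal C) ?S (\<lambda>f. ?G (mor ?P \<cdot> f)) + trace_on (scal C) ?S (\<lambda>f. ?G (mor ?Q \<cdot> f))"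
    using linear_betw_trans[OF linear_betw_comp[OF x M M homs(1)] GFS_map_linear[OF X V(3) l(1)]]
        linear_betw_trans[OF linear_betw_comp[OF x M M homs(2)] GFS_map_linear[OF X V(3) l(1)]]
    by (intro trace_on_add[OF fin_dim_Hom[OF x M]]) (auto simp: linear_betw_def)
  also have "trace_on (scal C) ?S (\<lambda>f. ?G (mor ?P \<cdot> f)) = GFS_indicator C X m l U"
    by (rule GFS_idempotent_part[OF X l _ _ _ _ _ _ pi]) (use V iT pT in simp_all)
  also have "trace_on (scal C) ?S (\<lambda>f. ?G (mor ?Q \<cdot> f)) = GFS_indicator C X m l V"
    by (rule GFS_idempotent_part[OF X l _ _ _ _ _ _ qj]) (use V iF pF in simp_all)
  finally show ?thesis .
qed

end

section \<open>Traces in a spherical category and endomorphisms of simple objects\<close>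

context strict_pivotal_category
begin

lemma ltrace_tensor:
  assumes "K \<in> Obj C" "V \<in> Obj C" "arr g" "src g = K \<odot> V" "trg g = K \<odot> V"
  shows "ltrace (K \<odot> V) \<one> \<one> g = ltrace V \<one> \<one> (ltrace K V V g)"
  unfolding ltrace_def using assms ev_tns(1)[of K V] ev_tns(2)[of "Dual C V" "Dual C K"]
    by (simp add: whisk)

lemma rtrace_tensor:
  assumes "B \<in> Obj C" "R \<in> Obj C" "arr g" "src g = B \<odot> R" "trg g = B \<odot> R"
  shows "rtrace (B \<odot> R) \<one> \<one> g = rtrace B \<one> \<one> (rtrace R B B g)"
  unfolding rtrace_def using assms ev_tns(1)[of "Dual C R" "Dual C B"] ev_tns(2)[of B R]
    by (simp add: whisk)

lemma ptr_arrow: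
  assumes "arr g" "src g = V" "trg g = V" "V \<in> Obj C"
  shows "ptr_l C V (mor g) = mor (ltrace V \<one> \<one> g)" "ptr_r C V (mor g) = mor (rtrace V \<one> \<one> g)"
proof -
  have "ltrace V \<one> \<one> g = (ev V oo (ide (Dual C V) ** g)) oo db (Dual C V)"
    unfolding ltrace_def using assms by simp
  then show "ptr_l C V (mor g) = mor (ltrace V \<one> \<one> g)"
    unfolding ptr_l_def Dbbar_def using assms by (simp del: cmp_assoc)
  have "rtrace V \<one> \<one> g = (ev (Dual C V) oo (g ** ide (Dual C V))) oo db V"
    unfolding rtrace_def using assms by simp
  then show "ptr_r C V (mor g) = mor (rtrace V \<one> \<one> g)"
    unfolding ptr_r_def Evbar_def using assms by (simp del: cmp_assoc)
qed

lemma spherical_arrow: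
  assumes "spherical C" "arr g" "src g = V" "trg g = V" "V \<in> Obj C"
  shows "ltrace V \<one> \<one> g = rtrace V \<one> \<one> g"
proof (rule arrow_eqI)
  show "mor (ltrace V \<one> \<one> g) = mor (rtrace V \<one> \<one> g)"
    using assms arr_mor[of g] unfolding ptr_arrow[OF assms(2-5), symmetric] spherical_def by simp
qed (use assms in simp_all)

text \<open>
  The trace over \<open>V\<^sup>k\<close> on the left and the trace over \<open>V\<close> on the left combine into one over
  \<open>V\<^bsup>k+1\<^esup>\<close>.  Sphericality turns it into a trace on the right, which combines with the one over
  \<open>V\<^sup>r\<close>.
\<close>

lemma FS_arrow_trace:
  assumes sph: "spherical C" and T: "natural_crossing T" and m: "k + r + 1 \<le> m" and V: "V \<in> Obj C"
  shows "ltrace V \<one> \<one> (FS_arrow T m k r V (ide (opow V m)))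
    = rtrace (opow V (k + r + 1)) \<one> \<one> (coupon_closure T (opow V (m - (k + r + 1))) (opow V (k + r
        + 1)) (opow V m) (ide (opow V m)))"
proof -
  let ?K = "opow V k" and ?R = "opow V r"
  let ?E = "coupon_closure T (opow V (m - (k + r + 1))) (?K \<odot> V \<odot> ?R) (opow V m) (ide (opow V m))"
  have o: "?K \<in> Obj C" "?R \<in> Obj C" using V by simp_all
  have E: "arr ?E" "src ?E = ?K \<odot> V \<odot> ?R" "trg ?E = ?K \<odot> V \<odot> ?R"
    using coupon_closure_ok[OF T m V, of "ide (opow V m)"] V by simp_all
  let ?g = "rtrace ?R (?K \<odot> V) (?K \<odot> V) ?E"
  have g: "arr ?g" "src ?g = ?K \<odot> V" "trg ?g = ?K \<odot> V" using E o V by simp_all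
  have "ltrace V \<one> \<one> (FS_arrow T m k r V (ide (opow V m))) = ltrace (?K \<odot> V) \<one> \<one> ?g"
    unfolding FS_arrow_def midtrace_def by (rule ltrace_tensor[symmetric]) (use g o V in simp_all)
  also have "\<dots> = rtrace (?K \<odot> V) \<one> \<one> ?g" by (rule spherical_arrow[OF sph]) (use g o V in simp_all)
  also have "\<dots> = rtrace (?K \<odot> V \<odot> ?R) \<one> \<one> ?E" by (rule rtrace_tensor[symmetric]) (use E o V in simp_all)
  finally show ?thesis unfolding opow_factors[OF V] .
qed

end

context linear_category
begin

lemma module_scal: "module (scal C)"
  using scal by (simp add: vector_space_def module_def)

lemma zero_Hom: "V \<in> Obj C \<Longrightarrow> W \<in> Obj C \<Longrightarrow> 0 \<in> Hom C V W"
  using module.subspace_0[OF module_scal Hom_subspace] by simp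

lemma scal_Hom: "V \<in> Obj C \<Longrightarrow> W \<in> Obj C \<Longrightarrow> f \<in> Hom C V W \<Longrightarrow> scal C c f \<in> Hom C V W"
  using module.subspace_scale[OF module_scal Hom_subspace] by simp

lemma add_Hom: "V \<in> Obj C \<Longrightarrow> W \<in> Obj C \<Longrightarrow> f \<in> Hom C V W \<Longrightarrow> g \<in> Hom C V W \<Longrightarrow> f + g \<in> Hom C V W"
  using module.subspace_add[OF module_scal Hom_subspace] by simp

lemma diff_Hom: "V \<in> Obj C \<Longrightarrow> W \<in> Obj C \<Longrightarrow> f \<in> Hom C V W \<Longrightarrow> g \<in> Hom C V W \<Longrightarrow> f - g \<in> Hom C V W"
  using module.subspace_diff[OF module_scal Hom_subspace] by simp

lemma sum_Hom: "V \<in> Obj C \<Longrightarrow> W \<in> Obj C \<Longrightarrow> (\<And>i. i \<in> I \<Longrightarrow> f i \<in> Hom C V W) \<Longrightarrow> sum f I \<in> Hom C V W"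
  by (induction I rule: infinite_finite_induct) (auto simp: zero_Hom add_Hom)

lemma scal_zero [simp]: "scal C 0 f = 0" "scal C c 0 = 0"
  using module.scale_zero_left[OF module_scal] module.scale_zero_right[OF module_scal] by auto

lemma Comp_zero_right: "\<lbrakk>U \<in> Obj C; V \<in> Obj C; W \<in> Obj C; f \<in> Hom C V W\<rbrakk> \<Longrightarrow> f \<cdot> 0 = 0"
  using Comp_scal_right[of U V W f 0 0] zero_Hom[of U V] by simp

lemma Comp_zero_left: "\<lbrakk>U \<in> Obj C; V \<in> Obj C; W \<in> Obj C; g \<in> Hom C U V\<rbrakk> \<Longrightarrow> 0 \<cdot> g = 0"
  using Comp_scal_left[of U V W 0 g 0] zero_Hom[of V W] by simp

lemma Comp_diff_right: "\<lbrakk>U \<in> Obj C; V \<in> Obj C; W \<in> Obj C; f \<in> Hom C V W; g \<in> Hom C U V; h \<in> Hom C U V\<rbrakk>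
  \<Longrightarrow> f \<cdot> (g - h) = f \<cdot> g - f \<cdot> h"
  using Comp_add_right[of U V W f "g - h" h] diff_Hom[of U V g h] by (simp add: eq_diff_eq)

lemma Comp_sum_right:
  assumes "U \<in> Obj C" "V \<in> Obj C" "W \<in> Obj C" "f \<in> Hom C V W" "\<And>i. i \<in> I \<Longrightarrow> g i \<in> Hom C U V"
  shows "f \<cdot> sum g I = (\<Sum>i\<in>I. f \<cdot> g i)"
  using assms(5)
  by (induction I rule: infinite_finite_induct)
    (auto simp: Comp_zero_right[OF assms(1-4)] Comp_add_right[OF assms(1-4)] sum_Hom[OF assms(1,2)])

lemma Comp_sum_left:
  assumes "U \<in> Obj C" "V \<in> Obj C" "W \<in> Obj C" "f \<in> Hom C U V" "\<And>i. i \<in> I \<Longrightarrow> g i \<in> Hom C V W"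
  shows "sum g I \<cdot> f = (\<Sum>i\<in>I. g i \<cdot> f)"
  using assms(5)
proof (induction I rule: infinite_finite_induct)
  case (insert i I)
  then show ?case
    using Comp_add_left[OF assms(1-3), of "g i" "sum g I" f] sum_Hom[OF assms(2,3), of I g] assms(4) by simp
qed (simp_all add: Comp_zero_left[OF assms(1-4)])

end

context semisimple_category
begin

text \<open>
  Schur's lemma: the kernel of \<open>f\<close> is a monomorphism into \<open>S\<close>, hence zero or invertible.  If it is
  invertible then \<open>f = 0\<close>; otherwise \<open>f\<close> is a monomorphism into \<open>T\<close>.
\<close>

lemma simple_iso:
  assumes S: "simple_obj C S" and T: "simple_obj C T" and f: "f \<in> Hom C S T" "f \<noteq> 0"
  shows "is_iso C S T f"
proof -
  have o: "S \<in> Obj C" "T \<in> Obj C" using S T by (auto simp: simple_obj_def)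
  obtain K i where K: "K \<in> Obj C" "is_kernel C S T f K i" using kernels[OF o f(1)] by blast
  have i: "i \<in> Hom C K S" "f \<cdot> i = 0"
    and uni: "\<And>U g. U \<in> Obj C \<Longrightarrow> g \<in> Hom C U S \<Longrightarrow> f \<cdot> g = 0 \<Longrightarrow> \<exists>!h. h \<in> Hom C U K \<and> i \<cdot> h = g"
    using K(2) unfolding is_kernel_def by blast+
  have "is_mono C K S i"
    unfolding is_mono_def
  proof (intro conjI ballI impI i(1))
    fix U g h assume U: "U \<in> Obj C" and gh: "g \<in> Hom C U K" "h \<in> Hom C U K" and eq: "i \<cdot> g = i \<cdot> h"
    have "f \<cdot> (i \<cdot> g) = 0"
      using Comp_assoc[OF U K(1) o f(1) i(1) gh(1)] i(2) Comp_zero_left[OF U K(1) o(2) gh(1)] by simp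
    then have "\<exists>!h'. h' \<in> Hom C U K \<and> i \<cdot> h' = i \<cdot> g" using uni U Comp_Hom[OF U K(1) o(1) i(1) gh(1)]
      by blast
    then show "g = h" using gh eq by metis
  qed
  then have "i = 0 \<or> is_iso C K S i" using S K(1) by (simp add: simple_obj_def)
  then have i0: "i = 0"
  proof
    assume "is_iso C K S i"
    then obtain j where j: "j \<in> Hom C S K" "i \<cdot> j = Id C S" by (auto simp: is_iso_def inverses_def)
    have "f = (f \<cdot> i) \<cdot> j" using Comp_assoc[OF o(1) K(1) o f(1) i(1) j(1)] j(2) Comp_Id[OF o f(1)] by simp
    then show ?thesis using f(2) i(2) Comp_zero_left[OF o(1) K(1) o(2) j(1)] by simp
  qed simp
  have "is_mono C S T f"
    unfolding is_mono_def
  proof (intro conjI ballI impI f(1))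
    fix U g h assume U: "U \<in> Obj C" and gh: "g \<in> Hom C U S" "h \<in> Hom C U S" and eq: "f \<cdot> g = f \<cdot> h"
    have d: "g - h \<in> Hom C U S" by (rule diff_Hom[OF U o(1) gh])
    have "f \<cdot> (g - h) = 0" using Comp_diff_right[OF U o f(1) gh] eq by simp
    then obtain h' where "h' \<in> Hom C U K" "i \<cdot> h' = g - h" using uni[OF U d] by blast
    then show "g = h" using i0 Comp_zero_left[OF U K(1) o(1)] by simp
  qed
  then show ?thesis using T o(1) f(2) unfolding simple_obj_def by blast
qed

lemma simple_cancel:
  assumes S: "simple_obj C S" and f: "f \<in> Hom C S S" and g: "g \<in> Hom C S S" "g \<noteq> 0" and "f \<cdot> g = 0"
  shows "f = 0"
proof -
  have o: "S \<in> Obj C" using S by (simp add: simple_obj_def)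
  obtain h where h: "h \<in> Hom C S S" "g \<cdot> h = Id C S"
    using simple_iso[OF S S g] by (auto simp: is_iso_def inverses_def)
  have "f = (f \<cdot> g) \<cdot> h" using Comp_assoc[OF o o o o f g(1) h(1)] h(2) Comp_Id[OF o o f] by simp
  then show ?thesis using assms(5) Comp_zero_left[OF o o o h(1)] by simp
qed

text \<open>
  The value of a polynomial at the endomorphism \<open>f\<close> of \<open>S\<close>, by Horner's scheme.
\<close>

definition poly_at :: "'b \<Rightarrow> 'a \<Rightarrow> 'c poly \<Rightarrow> 'b" where
  "poly_at f S p = fold_coeffs (\<lambda>a x. scal C a (Id C S) + f \<cdot> x) p 0"

context
  fixes S f
  assumes S: "simple_obj C S" and f: "f \<in> Hom C S S"
begin

lemma S_Obj: "S \<in> Obj C" using S by (simp add: simple_obj_def)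

lemma poly_at_0: "poly_at f S 0 = 0" by (simp add: poly_at_def)

lemma poly_at_pCons: "poly_at f S (pCons a p) = scal C a (Id C S) + f \<cdot> poly_at f S p"
  using Comp_zero_right[OF S_Obj S_Obj S_Obj f]
  by (cases "a = 0 \<and> p = 0") (auto simp: poly_at_def)

lemma poly_at_Hom: "poly_at f S p \<in> Hom C S S"
  by (induction p) (auto simp: poly_at_0 poly_at_pCons zero_Hom S_Obj add_Hom scal_Hom Id_Hom
      Comp_Hom[OF S_Obj S_Obj S_Obj f])

lemma poly_at_add: "poly_at f S (p + q) = poly_at f S p + poly_at f S q"
  by (induction p q rule: poly_induct2)
    (simp_all add: poly_at_0 poly_at_pCons Comp_add_right[OF S_Obj S_Obj S_Obj f poly_at_Hom poly_at_Hom] module.scale_left_distrib[OF module_scal])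

lemma poly_at_smult: "poly_at f S (smult c p) = scal C c (poly_at f S p)"
  by (induction p)
    (simp_all add: poly_at_0 poly_at_pCons Comp_scal_right[OF S_Obj S_Obj S_Obj f poly_at_Hom]
        module.scale_right_distrib[OF module_scal] module.scale_scale[OF module_scal])

lemma poly_at_sum: "poly_at f S (\<Sum>i\<in>I. p i) = (\<Sum>i\<in>I. poly_at f S (p i))"
  by (induction I rule: infinite_finite_induct) (auto simp: poly_at_0 poly_at_add)

text \<open>
  If the space of endomorphisms is spanned by \<open>n\<close> elements, then the powers of \<open>f\<close> with exponents
  from \<open>0\<close> to \<open>n\<close> are too many to be linearly independent; if two of them coincide, their
  difference gives a polynomial that vanishes at \<open>f\<close>.
\<close>

lemma poly_at_annihilator:
  assumes "finite B" "Hom C S S = module.span (scal C) B"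
  shows "\<exists>p. p \<noteq> 0 \<and> poly_at f S p = 0"
proof -
  interpret V: vector_space "scal C" by (rule scal)
  let ?n = "card B" and ?v = "\<lambda>i. poly_at f S (monom 1 i)"
  show ?thesis
  proof (cases "inj_on ?v {..?n}")
    case False
    then obtain i j where ij: "i \<noteq> j" "?v i = ?v j" by (auto simp: inj_on_def)
    have "poly_at f S (monom 1 i + smult (-1) (monom 1 j)) = 0"
      unfolding poly_at_add poly_at_smult using ij by (simp add: V.scale_minus_left)
    moreover have "coeff (monom 1 i + smult (-1) (monom 1 j) :: 'c poly) i = 1" using ij by simp
    then have "monom 1 i + smult (-1) (monom 1 j) \<noteq> (0 :: 'c poly)" by (metis coeff_0 zero_neq_one)
    ultimately show ?thesis by blast
  next
    case True
    let ?A = "?v ` {..?n}"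
    have "card ?A = Suc ?n" using True by (simp add: card_image)
    moreover have "?A \<subseteq> V.span B" using poly_at_Hom assms(2) by auto
    ultimately have "V.dependent ?A" using V.independent_span_bound[OF assms(1), of ?A] by auto
    then obtain u w where u: "w \<in> ?A" "u w \<noteq> 0" "(\<Sum>v\<in>?A. scal C (u v) v) = 0"
      using V.dependent_finite[of ?A] by auto
    then obtain j where j: "j \<le> ?n" "u (?v j) \<noteq> 0" by auto
    let ?p = "\<Sum>i\<le>?n. smult (u (?v i)) (monom 1 i)"
    have "poly_at f S ?p = (\<Sum>i\<le>?n. scal C (u (?v i)) (?v i))"
      by (simp add: poly_at_sum poly_at_smult del: smult_monom)
    also have "\<dots> = 0" using u(3) by (simp add: sum.reindex[OF True])
    finally have "poly_at f S ?p = 0" .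
    moreover have "coeff ?p j = u (?v j)" using j
      by (simp add: coeff_sum if_distrib sum.delta cong: if_cong)
    then have "?p \<noteq> 0" using j by auto
    ultimately show ?thesis by blast
  qed
qed

text \<open>
  Let \<open>p\<close> be a nonzero polynomial of least degree that vanishes at \<open>f\<close>, and \<open>c\<close> a root of \<open>p\<close>.  Then
  \<open>p = (x - c) * q\<close>, and \<open>q\<close> does not vanish at \<open>f\<close>, so its value there is invertible and \<open>f - c = 0\<close>.
\<close>

lemma simple_End:
  assumes "finite B" "Hom C S S = module.span (scal C) B"
    and closed: "\<And>p :: 'c poly. degree p > 0 \<Longrightarrow> \<exists>x. poly p x = 0"
  shows "\<exists>c. f = scal C c (Id C S)"
proof -
  interpret V: vector_space "scal C" by (rule scal)
  note o = S_Obj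
  have "\<exists>p. p \<noteq> 0 \<and> poly_at f S p = 0 \<and> (\<forall>q. q \<noteq> 0 \<and> poly_at f S q = 0 \<longrightarrow> degree p \<le> degree q)"
    using ex_has_least_nat[of "\<lambda>p. p \<noteq> 0 \<and> poly_at f S p
        = 0" _ degree] poly_at_annihilator[OF assms(1,2)] by blast
  then obtain p where p: "p \<noteq> 0" "poly_at f S p = 0"
      and min: "\<And>q. q \<noteq> 0 \<Longrightarrow> poly_at f S q = 0 \<Longrightarrow> degree p \<le> degree q" by blast
  have "degree p > 0"
  proof (rule ccontr)
    assume "\<not> degree p > 0"
    then obtain a where a: "p = [:a:]" using degree_eq_zeroE by auto
    then have "scal C a (Id C S) = 0" using p(2) Comp_zero_right[OF o o o f]
      by (simp add: poly_at_pCons poly_at_0)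
    then show False using a p(1) S by (auto simp: simple_obj_def)
  qed
  then obtain c where "poly p c = 0" using closed by blast
  then obtain q where q: "p = [:-c, 1:] * q" using poly_eq_0_iff_dvd by blast
  have q0: "q \<noteq> 0" using q p by auto
  have "degree p = Suc (degree q)" unfolding q using q0 by (subst degree_mult_eq) auto
  then have qe: "poly_at f S q \<noteq> 0" using min[OF q0] by auto
  have fc: "f - scal C c (Id C S) \<in> Hom C S S" using diff_Hom[OF o o f] scal_Hom[OF o o Id_Hom[OF o]]
    by simp
  have cI: "scal C c (Id C S) \<cdot> poly_at f S q = scal C c (poly_at f S q)"
    using Comp_scal_left[OF o o o Id_Hom[OF o] poly_at_Hom] Id_Comp[OF o o poly_at_Hom] by simp
  have "f \<cdot> poly_at f S q = (f - scal C c (Id C S)) \<cdot> poly_at f S q + scal C c (Id C S) \<cdot> poly_at f S q"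
    using Comp_add_left[OF o o o fc scal_Hom[OF o o Id_Hom[OF o], of c] poly_at_Hom, of q] by simp
  moreover have "p = pCons 0 q + smult (-c) q" by (simp add: q)
  then have "poly_at f S p = f \<cdot> poly_at f S q - scal C c (poly_at f S q)"
    by (simp only: poly_at_add poly_at_smult poly_at_pCons) (simp add: V.scale_minus_left)
  ultimately have "(f - scal C c (Id C S)) \<cdot> poly_at f S q = 0" using p(2) cI by simp
  then have "f - scal C c (Id C S) = 0" by (rule simple_cancel[OF S fc poly_at_Hom qe])
  then show ?thesis by auto
qed

end
end

section \<open>Comparison in a spherical category\<close>

context strict_pivotal_fusion_category
begin

text \<open>
  The cup \<open>\<one> \<rightarrow> S\<^sup>\<or> \<otimes> S\<close> is a nonzero morphism from a simple object, hence has a left inverse \<open>p\<close>.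
  By duality \<open>p\<close> corresponds to an endomorphism of \<open>S\<close>, that is to a scalar, so \<open>p\<close> is a multiple of
  the cap.  Therefore the composite of cup and cap is not zero.
\<close>

lemma simple_dim_nonzero:
  assumes S: "simple_obj C S" and closed: "\<And>p :: 'c poly. degree p > 0 \<Longrightarrow> \<exists>x. poly p x = 0"
  shows "Ev C S \<cdot> Db C (Dual C S) \<noteq> 0"
proof -
  note [simp del] = arr.simps
  have o [simp]: "S \<in> Obj C" using S by (simp add: simple_obj_def)
  let ?S = "Dual C S" and ?Y = "Dual C S \<odot> S"
  have Y: "?Y \<in> Obj C" by simp
  note Dh = Db_Hom[of ?S, simplified]
  have "Db C ?S \<noteq> 0"
  proof
    assume z: "Db C ?S = 0"
    have "Id C S = mor ((ev ?S ** ide S) oo (ide S ** db ?S))" using snake_dual[of ?S] by simp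
    also have "\<dots> = (Ev C ?S \<otimes> Id C S) \<cdot> (Id C S \<otimes> 0)" using z by simp
    also have "Id C S \<otimes> 0 = 0"
      using TensM_scal_right[OF o o Unit_Obj Y Id_Hom[OF o] Dh, of 0] by simp
    also have "(Ev C ?S \<otimes> Id C S) \<cdot> 0 = 0"
      using Comp_zero_right[OF o _ o, of "S \<odot> ?S \<odot> S" "Ev C ?S \<otimes> Id C S"] arr_mor[of "ev ?S ** ide S"]
        by simp
    finally show False using S by (simp add: simple_obj_def)
  qed
  obtain n :: nat and T where T: "\<And>i. i < n \<Longrightarrow> simple_obj C (T i)" "is_direct_sum C {..<n} T ?Y"
    using sum_of_simples[OF Y] by blast
  then obtain \<iota> \<pi> where ip: "\<And>i. i < n \<Longrightarrow> \<iota> i \<in> Hom C (T i) ?Y" "\<And>i. i < n \<Longrightarrow> \<pi> i \<in> Hom C ?Y (T i)"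
    and sum: "(\<Sum>i<n. \<iota> i \<cdot> \<pi> i) = Id C ?Y"
    unfolding is_direct_sum_def by blast
  have To: "i < n \<Longrightarrow> T i \<in> Obj C" for i using T(1) by (auto simp: simple_obj_def)
  obtain i where i: "i < n" "\<pi> i \<cdot> Db C ?S \<noteq> 0"
  proof (rule ccontr)
    assume "\<not> thesis"
    then have z: "\<pi> i \<cdot> Db C ?S = 0" if "i < n" for i
      using that \<open>\<And>i. i < n \<Longrightarrow> \<pi> i \<cdot> Db C ?S \<noteq> 0 \<Longrightarrow> thesis\<close> by blast
    have h: "\<iota> i \<cdot> \<pi> i \<in> Hom C ?Y ?Y" if "i < n" for i using Comp_Hom[OF Y To[OF that] Y ip[OF that]] .
    have "Id C ?Y \<cdot> Db C ?S = (\<Sum>i<n. (\<iota> i \<cdot> \<pi> i)) \<cdot> Db C ?S" by (simp only: sum)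
    also have "\<dots> = (\<Sum>i<n. (\<iota> i \<cdot> \<pi> i) \<cdot> Db C ?S)"
      by (rule Comp_sum_left[OF Unit_Obj Y Y Dh]) (use h in simp)
    also have "\<dots> = 0"
    proof (rule sum.neutral, intro ballI)
      fix i assume "i \<in> {..<n}"
      then have i: "i < n" by simp
      show "(\<iota> i \<cdot> \<pi> i) \<cdot> Db C ?S = 0"
        using Comp_assoc[OF Unit_Obj Y To[OF i] Y ip[OF i] Dh] z[OF i]
            Comp_zero_right[OF Unit_Obj To[OF i] Y ip(1)[OF i]] by simp
    qed
    finally show False using \<open>Db C ?S \<noteq> 0\<close> Id_Comp[OF Unit_Obj Y Dh] by simp
  qed
  have "\<pi> i \<cdot> Db C ?S \<in> Hom C \<one> (T i)" using Comp_Hom[OF Unit_Obj Y To[OF i(1)] ip(2)[OF i(1)] Dh] .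
  then obtain q where q: "q \<in> Hom C (T i) \<one>" "q \<cdot> (\<pi> i \<cdot> Db C ?S) = Id C \<one>"
    using simple_iso[OF Unit_simple T(1)[OF i(1)]] i(2) unfolding is_iso_def inverses_def by blast
  define p where "p = Arrow ?Y (q \<cdot> \<pi> i) \<one>"
  have pH: "q \<cdot> \<pi> i \<in> Hom C ?Y \<one>" using Comp_Hom[OF Y To[OF i(1)] Unit_Obj q(1) ip(2)[OF i(1)]] .
  have p: "arr p" "src p = ?Y" "trg p = \<one>" "mor p = q \<cdot> \<pi> i" using pH by (simp_all add: p_def arr.simps)
  have pD: "(q \<cdot> \<pi> i) \<cdot> Db C ?S = Id C \<one>"
    using Comp_assoc[OF Unit_Obj Y To[OF i(1)] Unit_Obj q(1) ip(2)[OF i(1)] Dh] q(2) by simp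
  define h where "h = (p ** ide ?S) oo (ide ?S ** db S)"
  have h: "arr h" "src h = ?S" "trg h = ?S" using p by (simp_all add: h_def)
  have 1: "ev S oo (p ** ide ?S ** ide S) = p oo (ide ?S ** ide S ** ev S)"
    using p cap_cap_commute[of p "ev S"] by simp
  have "ev S oo (h ** ide S) = (ev S oo (p ** ide ?S ** ide S)) oo (ide ?S ** db S ** ide S)"
    unfolding h_def using p by (simp add: whisk)
  also have "\<dots> = p oo (ide ?S ** ((ide S ** ev S) oo (db S ** ide S)))"
    unfolding 1 using p by (simp add: whisk)
  also have "\<dots> = p" using p by (simp add: snake cmp_ide2)
  finally have "p = ev S oo (ide ?S ** dual h)" using ev_slide[of "dual h" S S] h by simp
  moreover obtain c where c: "mor (dual h) = scal C c (Id C S)"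
  proof -
    obtain B where B: "finite B" "Hom C S S = module.span (scal C) B" using Hom_finite_dim[OF o o] by blast
    have "mor (dual h) \<in> Hom C S S" using arr_mor[of "dual h"] h by simp
    then show ?thesis using that simple_End[OF S _ B closed, of "mor (dual h)"] by blast
  qed
  ultimately have "mor p = Ev C S \<cdot> (Id C ?S \<otimes> scal C c (Id C S))" using h by simp
  also have "\<dots> = scal C c (Ev C S)"
    using TensM_scal_right[of ?S ?S S S "Id C ?S" "Id C S" c] TensM_Id[of ?S S] Id_Hom[of ?S] Id_Hom[of S]
      Comp_scal_right[OF Y Y Unit_Obj Ev_Hom[OF o] Id_Hom[OF Y], of c]
          Comp_Id[OF Y Unit_Obj Ev_Hom[OF o]] by simp
  finally have "Id C \<one> = scal C c (Ev C S) \<cdot> Db C ?S" using pD p by simp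
  also have "\<dots> = scal C c (Ev C S \<cdot> Db C ?S)" by (rule
      Comp_scal_left[OF Unit_Obj Y Unit_Obj Ev_Hom[OF o] Dh])
  finally show ?thesis using Unit_simple by (auto simp: simple_obj_def)
qed

text \<open>
  Both endomorphisms are scalars, and their traces are these scalars times the dimension of \<open>S\<close>.
\<close>

lemma simple_endo_eqI:
  assumes S: "simple_obj C S" and closed: "\<And>p :: 'c poly. degree p > 0 \<Longrightarrow> \<exists>x. poly p x = 0"
    and f: "f \<in> Hom C S S" and g: "g \<in> Hom C S S" and eq: "ptr_l C S f = ptr_l C S g"
  shows "f = g"
proof -
  have o [simp]: "S \<in> Obj C" using S by (simp add: simple_obj_def)
  interpret V: vector_space "scal C" by (rule scal)
  let ?S = "Dual C S" and ?Y = "Dual C S \<odot> S"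
  have Y: "?Y \<in> Obj C" by simp
  note Dh = Db_Hom[of ?S, simplified]
  obtain B where B: "finite B" "Hom C S S = module.span (scal C) B" using Hom_finite_dim[OF o o] by blast
  obtain a b where ab: "f = scal C a (Id C S)" "g = scal C b (Id C S)"
    using simple_End[OF S f B closed] simple_End[OF S g B closed] by blast
  have *: "ptr_l C S (scal C c (Id C S)) = scal C c (Ev C S \<cdot> Db C ?S)" for c
    unfolding ptr_l_def Dbbar_def
    using TensM_scal_right[of ?S ?S S S "Id C ?S" "Id C S" c] TensM_Id[of ?S S] Id_Hom[of ?S] Id_Hom[of S]
      Comp_scal_right[OF Y Y Unit_Obj Ev_Hom[OF o] Id_Hom[OF Y], of c] Comp_Id[OF Y Unit_Obj Ev_Hom[OF o]]
      Comp_scal_left[OF Unit_Obj Y Unit_Obj Ev_Hom[OF o] Dh, of c] by simp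
  show ?thesis using eq simple_dim_nonzero[OF S closed] unfolding ab * by simp
qed

text \<open>
  On a direct sum, a natural endomorphism is determined by its values on the summands.
\<close>

lemma natural_endo_eqI:
  assumes F: "natural_id_endo C F" and G: "natural_id_endo C G"
    and simples: "\<And>S. simple_obj C S \<Longrightarrow> F S = G S" and V: "V \<in> Obj C"
  shows "F V = G V"
proof -
  obtain n :: nat and T where T: "\<And>i. i < n \<Longrightarrow> simple_obj C (T i)" "is_direct_sum C {..<n} T V"
    using sum_of_simples[OF V] by blast
  then obtain \<iota> \<pi> where ip: "\<And>i. i < n \<Longrightarrow> \<iota> i \<in> Hom C (T i) V" "\<And>i. i < n \<Longrightarrow> \<pi> i \<in> Hom C V (T i)"
    and sum: "(\<Sum>i<n. \<iota> i \<cdot> \<pi> i) = Id C V"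
    unfolding is_direct_sum_def by blast
  have To: "i < n \<Longrightarrow> T i \<in> Obj C" for i using T(1) by (auto simp: simple_obj_def)
  have *: "H V = (\<Sum>i<n. (\<iota> i \<cdot> H (T i)) \<cdot> \<pi> i)" if H: "natural_id_endo C H" for H
  proof -
    have HV: "H V \<in> Hom C V V" using H V by (simp add: natural_id_endo_def)
    have "H V = H V \<cdot> (\<Sum>i<n. \<iota> i \<cdot> \<pi> i)" unfolding sum using Comp_Id[OF V V HV] by simp
    also have "\<dots> = (\<Sum>i<n. H V \<cdot> (\<iota> i \<cdot> \<pi> i))"
      by (rule Comp_sum_right[OF V V V HV]) (use Comp_Hom[OF V To V ip] in simp)
    also have "\<dots> = (\<Sum>i<n. (\<iota> i \<cdot> H (T i)) \<cdot> \<pi> i)"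
    proof (rule sum.cong[OF refl])
      fix i assume "i \<in> {..<n}"
      then have i: "i < n" by simp
      show "H V \<cdot> (\<iota> i \<cdot> \<pi> i) = (\<iota> i \<cdot> H (T i)) \<cdot> \<pi> i"
        using Comp_assoc[OF V To[OF i] V V HV ip[OF i]] H ip(1)[OF i] To[OF i] V
          unfolding natural_id_endo_def by simp
    qed
    finally show ?thesis .
  qed
  show ?thesis unfolding *[OF F] *[OF G] using simples T(1) by (intro sum.cong refl) simp
qed

lemma FS_spherical:
  assumes closed: "\<And>p :: 'c poly. degree p > 0 \<Longrightarrow> \<exists>x. poly p x = 0"
    and sph: "spherical C" and A: "center_adjunction C A" and z: "natural_id_endo (center C) z"
    and m: "k + r + 1 \<le> m" and cop: "coprime m (k + r + 1)" and V: "V \<in> Obj C"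
  shows "FS C A z m k r V = FS2 C A z m (k + r + 1) V"
proof -
  have m': "(k + r) + 0 + 1 \<le> m" and cop': "coprime m ((k + r) + 0 + 1)" using m cop by simp_all
  note N = FS_natural[OF A z m cop] FS_natural[OF A z m' cop']
  note T = natural_crossing_FS[OF A z]
  have "FS C A z m k r V = FS C A z m (k + r) 0 V"
  proof (rule natural_endo_eqI[OF N _ V])
    fix S assume S: "simple_obj C S"
    then have o: "S \<in> Obj C" by (simp add: simple_obj_def)
    have t: "ptr_l C S (FS C A z m k' r' S) = mor (rtrace (opow S (k' + r'
        + 1)) \<one> \<one> (coupon_closure (FS_crossing A z) (opow S (m - (k' + r' + 1))) (opow S (k' + r'
        + 1)) (opow S m) (ide (opow S m))))"
      if "k' + r' + 1 \<le> m" for k' r'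
    proof -
      have "ptr_l C S (FS C A z m k' r' S) = mor (ltrace S \<one> \<one> (FS_arrow (FS_crossing A z) m k' r' S (ide (opow S m))))"
        unfolding FS_eq[OF A z o that]
        by (rule ptr_arrow) (use FS_arrow_simps[OF T that o, of "ide (opow S m)"] o in simp_all)
      then show ?thesis unfolding FS_arrow_trace[OF sph T that o] .
    qed
    show "FS C A z m k r S = FS C A z m (k + r) 0 S"
    proof (rule simple_endo_eqI[OF S closed])
      show "ptr_l C S (FS C A z m k r S) = ptr_l C S (FS C A z m (k + r) 0 S)"
        unfolding t[OF m] t[OF m'] by simp
    qed (use N o in \<open>simp_all add: natural_id_endo_def\<close>)
  qed
  then show ?thesis by (simp add: FS2_def)
qed

end

theorem proposition9p5:
  fixes C :: "('o, 'm::ab_group_add, 'k::{alg_closed_field, field_char_0}) pivcat"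
    and k r m l :: nat
  assumes "strict_pivotal_fusion_category C"
    and "l = k + r + 1" and "l \<le> m"
    and "coprime m l"
  shows "(\<forall>A z. center_adjunction C A \<and> natural_id_endo (center C) z \<longrightarrow>
            natural_id_endo C (\<lambda>V. FS C A z m k r V))
    \<and> (\<forall>X U V W. simple_obj (center C) X \<and> U \<in> Obj C \<and> V \<in> Obj C \<and> W \<in> Obj C
            \<and> is_direct_sum2 C U V W \<longrightarrow>
            GFS_indicator C X m l W = GFS_indicator C X m l U + GFS_indicator C X m l V)
    \<and> (spherical C \<longrightarrow>
         (\<forall>A z. center_adjunction C A \<and> natural_id_endo (center C) z \<longrightarrow>
            (\<forall>V\<in>Obj C. FS C A z m k r V = FS2 C A z m l V)))"
proof -
  interpret strict_pivotal_fusion_category C by (rule assms(1))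
  have m: "k + r + 1 \<le> m" and cop: "coprime m (k + r + 1)" and "0 < m" using assms by simp_all
  show ?thesis
  proof (intro conjI allI impI ballI)
    fix A z assume "center_adjunction C A \<and> natural_id_endo (center C) z"
    then show "natural_id_endo C (\<lambda>V. FS C A z m k r V)" using FS_natural[OF _ _ m cop] by blast
  next
    fix X U V W
    assume "simple_obj (center C) X \<and> U \<in> Obj C \<and> V \<in> Obj C \<and> W \<in> Obj C \<and> is_direct_sum2 C U V W"
    moreover from this have "X \<in> Obj (center C)" by (simp add: simple_obj_def)
    ultimately show "GFS_indicator C X m l W = GFS_indicator C X m l U + GFS_indicator C X m l V"
      using GFS_additive[OF _ assms(3) \<open>0 < m\<close> assms(4)] by blast
  next
    fix A z V
    assume "spherical C" "center_adjunction C A \<and> natural_id_endo (center C) z" "V \<in> Obj C"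
    then show "FS C A z m k r V = FS2 C A z m l V"
      using FS_spherical[OF alg_closed_imp_poly_has_root _ _ _ m cop] unfolding assms(2) by blast
  qed
qed

end
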